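(* Let $(\Gamma,S)$ be a Coxeter system with $S$ finite. For a vector of positive rates $\mathbf r=(r_s)_{s\in S}$, let $\sigma(\mathbf r)$ be the limiting speed of the continuous-time random walk on the Cayley graph of $(\Gamma,S)$ with rates $\mathbf r$. Then $\sigma(\mathbf r)$ is monotone increasing in $\mathbf r$ (that is, $r_s\le r'_s$ for all $s\in S$ implies $\sigma(\mathbf r)\le\sigma(\mathbf r')$). If, moreover, $(\Gamma,S)$ is irreducible and nonelementary hyperbolic, then $\sigma(\mathbf r)$ is strictly increasing in $\mathbf r$ (strictly increasing in each $r_s$).
   Context: A Coxeter system $(\Gamma,S)$ is a group $\Gamma$ with generating set $S$ given by a presentation $\langle S\mid (ss')^{m(s,s')}\ \forall s,s'\in S\rangle$ where each $m(s,s')=m(s',s)$ is a positive integer or $\infty$ (no relation if $\infty$), $m(s,s)=1$, and $m(s,s')\ge 2$ for $s\ne s'$. Its Coxeter diagram is the graph on $S$ with an edge between $s$ and $s'$ when $m(s,s')\ge 3$; the system is irreducible if this graph is connected. Nonelementary hyperbolic means that $\Gamma$ is word hyperbolic (Gromov hyperbolic in a Cayley graph) and neither finite nor virtually cyclic. The (right) Cayley graph has vertex set $\Gamma$ and edges $\{x,xs\}$, $x\in\Gamma$, $s\in S$. Let $o$ be the identity and $|x|$ the graph distance from $o$ to $x$. The random walk $(Z_t)_{t\ge 0}$ with rates $\mathbf r$ is the continuous-time Markov chain with $Z_0=o$ that jumps from $x$ to $xs$ at rate $r_s>0$ for each $s\in S$. The limiting speed is $\sigma(\mathbf r):=\lim_{t\to\infty}\mathbf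 E[|Z_t|]/t$, which exists by subadditivity. *)

theory Defs
  imports
    "HOL-Algebra.Elementary_Groups"
    "HOL-Library.Extended_Nat"
    "HOL-Probability.Probability"
begin

section \<open>Presentations and Coxeter systems\<close>

text \<open>
  A letter \<open>(s, True)\<close> stands for \<open>s\<close> and \<open>(s, False)\<close> for its formal inverse.
\<close>

type_synonym 'a word = "('a \<times> bool) list"

definition letter_val :: "('a, 'b) monoid_scheme \<Rightarrow> 'a \<times> bool \<Rightarrow> 'a" where
  "letter_val G l = (if snd l then fst l else inv\<^bsub>G\<^esub> (fst l))"

definition word_val :: "('a, 'b) monoid_scheme \<Rightarrow> 'a word \<Rightarrow> 'a" where
  "word_val G w = foldr (\<lambda>l x. letter_val G l \<otimes>\<^bsub>G\<^esub> x) w \<one>\<^bsub>G\<^esub>"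

inductive deletion :: "'a set \<Rightarrow> 'a word set \<Rightarrow> 'a word \<Rightarrow> 'a word \<Rightarrow> bool"
  for S R where
  cancel: "s \<in> S \<Longrightarrow> deletion S R (u @ [(s, e), (s, \<not> e)] @ v) (u @ v)"
| relator: "\<rho> \<in> R \<Longrightarrow> deletion S R (u @ \<rho> @ v) (u @ v)"

text \<open>
  \<open>G = \<langle>S | R\<rangle>\<close>: the set \<open>S\<close> generates \<open>G\<close>, and the words in the kernel of the canonical map from
  the free group on \<open>S\<close> onto \<open>G\<close> are precisely the consequences of the relators, i.e. the words that
  can be turned into the empty word by inserting and deleting relators and pairs of mutually inverse
  letters.
\<close>

definition group_presentation ::
  "('a, 'b) monoid_scheme \<Rightarrow> 'a set \<Rightarrow> 'a word set \<Rightarrow> bool" where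
  "group_presentation G S R \<longleftrightarrow>
     group G \<and> S \<subseteq> carrier G \<and> generate G S = carrier G \<and>
     (\<forall>w \<in> lists (S \<times> UNIV). word_val G w = \<one>\<^bsub>G\<^esub> \<longleftrightarrow> equivclp (deletion S R) w [])"

definition coxeter_relators :: "'a set \<Rightarrow> ('a \<Rightarrow> 'a \<Rightarrow> enat) \<Rightarrow> 'a word set" where
  "coxeter_relators S m =
     {concat (replicate k [(s, True), (s', True)]) | s s' k. s \<in> S \<and> s' \<in> S \<and> m s s' = enat k}"

definition coxeter_system ::
  "('a, 'b) monoid_scheme \<Rightarrow> 'a set \<Rightarrow> ('a \<Rightarrow> 'a \<Rightarrow> enat) \<Rightarrow> bool" where
  "coxeter_system G S m \<longleftrightarrow>
     (\<forall>s\<in>S. m s s = 1) \<and>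
     (\<forall>s\<in>S. \<forall>s'\<in>S. m s s' = m s' s) \<and>
     (\<forall>s\<in>S. \<forall>s'\<in>S. s \<noteq> s' \<longrightarrow> 2 \<le> m s s') \<and>
     group_presentation G S (coxeter_relators S m)"

definition coxeter_diagram :: "'a set \<Rightarrow> ('a \<Rightarrow> 'a \<Rightarrow> enat) \<Rightarrow> ('a \<times> 'a) set" where
  "coxeter_diagram S m = {(s, s'). s \<in> S \<and> s' \<in> S \<and> 3 \<le> m s s'}"

definition irreducible_coxeter :: "'a set \<Rightarrow> ('a \<Rightarrow> 'a \<Rightarrow> enat) \<Rightarrow> bool" where
  "irreducible_coxeter S m \<longleftrightarrow> (\<forall>s\<in>S. \<forall>s'\<in>S. (s, s') \<in> (coxeter_diagram S m)\<^sup>*)"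

section \<open>Cayley graphs and hyperbolicity\<close>

text \<open>The undirected edges \<open>{x, xs}\<close> are represented by a symmetric relation.\<close>

definition cayley_edges :: "('a, 'b) monoid_scheme \<Rightarrow> 'a set \<Rightarrow> ('a \<times> 'a) set" where
  "cayley_edges G S =
     {(x, x \<otimes>\<^bsub>G\<^esub> s) | x s. x \<in> carrier G \<and> s \<in> S} \<union>
     {(x \<otimes>\<^bsub>G\<^esub> s, x) | x s. x \<in> carrier G \<and> s \<in> S}"

definition cayley_dist :: "('a, 'b) monoid_scheme \<Rightarrow> 'a set \<Rightarrow> 'a \<Rightarrow> 'a \<Rightarrow> nat" where
  "cayley_dist G S x y = (LEAST n. (x, y) \<in> cayley_edges G S ^^ n)"

definition gromov_product :: "('a \<Rightarrow> 'a \<Rightarrow> real) \<Rightarrow> 'a \<Rightarrow> 'a \<Rightarrow> 'a \<Rightarrow> real" where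
  "gromov_product d w x y = (d x w + d y w - d x y) / 2"

definition gromov_hyperbolic :: "'a set \<Rightarrow> ('a \<Rightarrow> 'a \<Rightarrow> real) \<Rightarrow> bool" where
  "gromov_hyperbolic X d \<longleftrightarrow>
     (\<exists>\<delta>\<ge>0. \<forall>w\<in>X. \<forall>x\<in>X. \<forall>y\<in>X. \<forall>z\<in>X.
        min (gromov_product d w x y) (gromov_product d w y z) - \<delta> \<le> gromov_product d w x z)"

text \<open>
  The four-point condition is imposed on the vertices only; compared with the geometric realisation
  of the Cayley graph this changes nothing but the value of \<open>\<delta>\<close>.
\<close>

definition word_hyperbolic :: "('a, 'b) monoid_scheme \<Rightarrow> bool" where
  "word_hyperbolic G \<longleftrightarrow>
     (\<exists>T \<subseteq> carrier G. finite T \<and> generate G T = carrier G \<and>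
        gromov_hyperbolic (carrier G) (\<lambda>x y. real (cayley_dist G T x y)))"

definition virtually_cyclic :: "('a, 'b) monoid_scheme \<Rightarrow> bool" where
  "virtually_cyclic G \<longleftrightarrow>
     (\<exists>H. subgroup H G \<and> finite (rcosets\<^bsub>G\<^esub> H) \<and> cyclic_group (subgroup_generated G H))"

definition nonelementary_hyperbolic :: "('a, 'b) monoid_scheme \<Rightarrow> bool" where
  "nonelementary_hyperbolic G \<longleftrightarrow>
     word_hyperbolic G \<and> infinite (carrier G) \<and> \<not> virtually_cyclic G"

section \<open>Continuous-time Markov chains and the random walk\<close>

text \<open>\<open>p t x y\<close> is the probability of going from \<open>x\<close> to \<open>y\<close> in time \<open>t\<close>.\<close>

definition transition_function :: "'a set \<Rightarrow> (real \<Rightarrow> 'a \<Rightarrow> 'a \<Rightarrow> real) \<Rightarrow> bool" where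
  "transition_function X p \<longleftrightarrow>
     (\<forall>t\<ge>0. \<forall>x\<in>X. \<forall>y\<in>X. 0 \<le> p t x y) \<and>
     (\<forall>t\<ge>0. \<forall>x\<in>X. (p t x has_sum 1) X) \<and>
     (\<forall>x\<in>X. \<forall>y\<in>X. p 0 x y = of_bool (x = y)) \<and>
     (\<forall>t\<ge>0. \<forall>u\<ge>0. \<forall>x\<in>X. \<forall>y\<in>X. ((\<lambda>z. p t x z * p u z y) has_sum p (t + u) x y) X)"

definition has_generator ::
  "'a set \<Rightarrow> (real \<Rightarrow> 'a \<Rightarrow> 'a \<Rightarrow> real) \<Rightarrow> ('a \<Rightarrow> 'a \<Rightarrow> real) \<Rightarrow> bool" where
  "has_generator X p q \<longleftrightarrow>
     (\<forall>x\<in>X. \<forall>y\<in>X. ((\<lambda>t. p t x y) has_real_derivative q x y) (at 0 within {0..}))"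

text \<open>
  A time-homogeneous Markov chain on \<open>X\<close>, in terms of its finite-dimensional distributions, with
  right-continuous paths for the discrete topology on \<open>X\<close>. The negative times are irrelevant.
\<close>

definition continuous_time_markov_chain ::
  "'a set \<Rightarrow> ('a \<Rightarrow> 'a \<Rightarrow> real) \<Rightarrow> 'w measure \<Rightarrow> (real \<Rightarrow> 'w \<Rightarrow> 'a) \<Rightarrow> bool" where
  "continuous_time_markov_chain X q M Z \<longleftrightarrow>
     prob_space M \<and>
     (\<forall>t\<ge>0. Z t \<in> measurable M (count_space X)) \<and>
     (AE \<omega> in M. \<forall>t\<ge>0. eventually (\<lambda>u. Z u \<omega> = Z t \<omega>) (at_right t)) \<and>
     (\<exists>p. transition_function X p \<and> has_generator X p q \<and>
        (\<forall>n \<tau> \<xi>. 0 \<le> \<tau> 0 \<and> (\<forall>i\<le>n. \<tau> i < \<tau> (Suc i)) \<and> (\<forall>i\<le>Suc n. \<xi> i \<in> X) \<longrightarrow>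
           measure M {\<omega> \<in> space M. \<forall>i\<le>Suc n. Z (\<tau> i) \<omega> = \<xi> i} =
           measure M {\<omega> \<in> space M. \<forall>i\<le>n. Z (\<tau> i) \<omega> = \<xi> i} *
             p (\<tau> (Suc n) - \<tau> n) (\<xi> n) (\<xi> (Suc n))))"

text \<open>
  The generator of the walk that multiplies on the right by \<open>s\<close> at rate \<open>r s\<close>: off the diagonal the
  jump rate, on the diagonal minus the total rate of leaving.
\<close>

definition walk_generator ::
  "('a, 'b) monoid_scheme \<Rightarrow> 'a set \<Rightarrow> ('a \<Rightarrow> real) \<Rightarrow> 'a \<Rightarrow> 'a \<Rightarrow> real" where
  "walk_generator G S r x y =
     (\<Sum>s | s \<in> S \<and> x \<otimes>\<^bsub>G\<^esub> s = y. r s) - (if x = y then \<Sum>s\<in>S. r s else 0)"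

definition random_walk ::
  "('a, 'b) monoid_scheme \<Rightarrow> 'a set \<Rightarrow> ('a \<Rightarrow> real) \<Rightarrow> 'w measure \<Rightarrow> (real \<Rightarrow> 'w \<Rightarrow> 'a) \<Rightarrow> bool"
  where
  "random_walk G S r M Z \<longleftrightarrow>
     continuous_time_markov_chain (carrier G) (walk_generator G S r) M Z \<and>
     (AE \<omega> in M. Z 0 \<omega> = \<one>\<^bsub>G\<^esub>)"

definition limiting_speed ::
  "('a, 'b) monoid_scheme \<Rightarrow> 'a set \<Rightarrow> 'w measure \<Rightarrow> (real \<Rightarrow> 'w \<Rightarrow> 'a) \<Rightarrow> real" where
  "limiting_speed G S M Z =
     Lim at_top (\<lambda>t. (\<integral>\<omega>. real (cayley_dist G S \<one>\<^bsub>G\<^esub> (Z t \<omega>)) \<partial>M) / t)"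

end

theory Submission
  imports Defs
begin

text \<open>
  For \<open>t\<close> a reflection let \<open>bias t n\<close> be the probability that the \<open>n\<close>-step (lazy, discrete-time) walk is
  on the side of \<open>\<one>\<close> of the wall of \<open>t\<close> minus the probability that it is on the other side. By reflection
  it is nonnegative and decreasing in \<open>n\<close>, and the expected length grows by \<open>\<Sum>\<^sub>s w s * bias s n\<close> in the
  next step, so the speed exists. Raising the rate of \<open>s\<close> inserts letters \<open>s\<close>; folding both factors of
  \<open>x s y\<close> along the wall of \<open>s\<close> shows that inserting \<open>s\<close> between \<open>i\<close> and \<open>j\<close> independent steps lengthens the
  product by at least \<open>bias s i * bias s j\<close> on average. This gives monotonicity, and strictness as soon as
  \<open>bias s n\<close> is bounded away from \<open>0\<close>.

  If \<open>bias s n \<rightarrow> 0\<close>, the functions \<open>1 - bias t n\<close> of \<open>t\<close> in the conjugacy class \<open>C\<close> of \<open>s\<close> are finitely supported,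
  tend to \<open>1\<close>, and have Dirichlet energy tending to \<open>0\<close>: the conjugation walk on \<open>C\<close> would be recurrent. But
  irreducibility makes \<open>C\<close> infinite, and in a hyperbolic group that is not virtually cyclic one finds
  \<open>b\<^sub>1, b\<^sub>2, b\<^sub>3 \<in> C\<close> pointing in three different directions. Every long \<open>t \<in> C\<close> points in the direction of at
  most one \<open>b\<^sub>i\<close>, so at least two of the \<open>b\<^sub>i t b\<^sub>i\<close> are longer than \<open>t\<close>; these form a forest with two-fold
  branching inside \<open>C\<close>, which forces a Hardy inequality.
\<close>

section \<open>The word metric\<close>

text \<open>The continuous-time walks are given only through \<open>has_generator\<close>, so their
  laws have to be identified: both are Poisson mixtures of discrete walks run by one common clock of
  rate \<open>l\<close>, which turns \<open>r \<le> r'\<close> into \<open>w \<le> w'\<close> at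
  equal numbers of steps. Strictness does not follow from non-amenability of \<Gamma>: the walk on
  \<open>C\<close> lives on \<Gamma> modulo the centraliser of \<open>s\<close>, and such a quotient
  of a non-amenable group may be recurrent. So hyperbolicity is applied to \<open>C\<close> itself.
  Three is the least number of directions that works: with one possibly lost at each element, two
  would guarantee a single child only, hence no growth. The energy is fed only by the finitely many
  simple reflections in \<open>C\<close>, and their biases tend to \<open>0\<close>; the Hardy
  inequality bounds \<open>1 - bias\<close> at one fixed \<open>t0\<close> by this energy, although
  that value tends to \<open>1\<close>. Hyperbolicity refers to some generating set \<open>T\<close>
  that may differ from \<open>S\<close>, so the three elements are arbitrary words in
  \<open>S\<close> and the energy along them has to be compared with the energy along
  \<open>S\<close>.\<close>

locale cayley = group G for G :: "('a, 'b) monoid_scheme" (structure) +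
  fixes T :: "'a set"
  assumes T_subset: "T \<subseteq> carrier G" and generate_T: "generate G T = carrier G"
begin

abbreviation edges :: "('a \<times> 'a) set" where "edges \<equiv> cayley_edges G T"
abbreviation dist_T :: "'a \<Rightarrow> 'a \<Rightarrow> nat" where "dist_T \<equiv> cayley_dist G T"

lemma edges_carrier: "(x, y) \<in> edges \<Longrightarrow> x \<in> carrier G \<and> y \<in> carrier G"
  using T_subset by (auto simp: cayley_edges_def)

lemma edges_sym: "(x, y) \<in> edges \<Longrightarrow> (y, x) \<in> edges"
  by (auto simp: cayley_edges_def)

lemma edges_left_mult:
  assumes g: "g \<in> carrier G" and "(x, y) \<in> edges"
  shows "(g \<otimes> x, g \<otimes> y) \<in> edges"
proof -
  have 1: "(g \<otimes> x, g \<otimes> (x \<otimes> s)) \<in> edges \<and> (g \<otimes> (x \<otimes> s), g \<otimes> x) \<in> edges"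
    if "x \<in> carrier G" "s \<in> T" for x s
  proof -
    have "g \<otimes> (x \<otimes> s) = g \<otimes> x \<otimes> s" using that g T_subset by (intro m_assoc[symmetric]) auto
    moreover have "g \<otimes> x \<in> carrier G" using that g by simp
    ultimately show ?thesis using that unfolding cayley_edges_def by blast
  qed
  show ?thesis using assms(2) 1 unfolding cayley_edges_def by blast
qed

lemma relpow_carrier: "(x, y) \<in> edges ^^ n \<Longrightarrow> x \<in> carrier G \<Longrightarrow> y \<in> carrier G"
  by (induction n arbitrary: y) (auto dest: edges_carrier)

lemma relpow_left_mult: 
  "g \<in> carrier G \<Longrightarrow> (x, y) \<in> edges ^^ n \<Longrightarrow> (g \<otimes> x, g \<otimes> y) \<in> edges ^^ n"
  by (induction n arbitrary: y) (auto intro: edges_left_mult)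

lemma relpow_sym: "(x, y) \<in> edges ^^ n \<Longrightarrow> (y, x) \<in> edges ^^ n"
proof (induction n arbitrary: y)
  case (Suc n)
  then obtain z where "(x, z) \<in> edges ^^ n" "(z, y) \<in> edges" by auto
  then show ?case using Suc.IH edges_sym relpow_Suc_I2 by metis
qed simp

lemma reachable_one: 
  assumes "x \<in> carrier G" shows "\<exists>n. (\<one>, x) \<in> edges ^^ n"
proof -
  have "x \<in> generate G T" using assms generate_T by simp
  then show ?thesis
  proof induction
    case one
    show ?case by (rule exI[of _ 0]) simp
  next
    case (incl h)
    have "(\<one>, \<one> \<otimes> h) \<in> edges" using incl unfolding cayley_edges_def by blast
    then show ?case using incl T_subset by (intro exI[of _ 1]) auto
  next
    case (inv h)
    then have "h \<in> carrier G" using T_subset by auto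
    then have "(inv h \<otimes> h, inv h) \<in> edges" using inv unfolding cayley_edges_def by blast
    then show ?case using \<open>h \<in> carrier G\<close> by (intro exI[of _ 1]) simp
  next
    case (eng h1 h2)
    then obtain i j where ij: "(\<one>, h1) \<in> edges ^^ i" "(\<one>, h2) \<in> edges ^^ j" by blast
    then have "h1 \<in> carrier G" "h2 \<in> carrier G" using relpow_carrier by blast+
    then have "(h1, h1 \<otimes> h2) \<in> edges ^^ j" using relpow_left_mult[OF _ ij(2), of h1] by simp
    then have "(\<one>, h1 \<otimes> h2) \<in> edges ^^ (i + j)" using ij(1) by (auto simp: relpow_add)
    then show ?case by blast
  qed
qed

lemma dist_le: "(x, y) \<in> edges ^^ n \<Longrightarrow> dist_T x y \<le> n"
  unfolding cayley_dist_def by (rule Least_le)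

lemma dist_path:
  assumes "x \<in> carrier G" "y \<in> carrier G" shows "(x, y) \<in> edges ^^ dist_T x y"
proof -
  obtain n where "(\<one>, inv x \<otimes> y) \<in> edges ^^ n" using reachable_one assms by blast
  from relpow_left_mult[OF assms(1) this] assms have "(x, y) \<in> edges ^^ n"
    by (simp add: m_assoc[symmetric])
  then show ?thesis unfolding cayley_dist_def by (rule LeastI)
qed

lemma dist_self [simp]: "dist_T x x = 0"
  using dist_le[of x x 0] by simp

lemma dist_commute: "x \<in> carrier G \<Longrightarrow> y \<in> carrier G \<Longrightarrow> dist_T x y = dist_T y x"
  by (rule antisym; rule dist_le, rule relpow_sym, rule dist_path)

lemma dist_triangle:
  assumes "x \<in> carrier G" "y \<in> carrier G" "z \<in> carrier G"
  shows "dist_T x z \<le> dist_T x y + dist_T y z"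
  using dist_path[OF assms(1,2)] dist_path[OF assms(2,3)]
  by (intro dist_le) (auto simp: relpow_add)

lemma dist_left_mult:
  assumes "g \<in> carrier G" "x \<in> carrier G" "y \<in> carrier G"
  shows "dist_T (g \<otimes> x) (g \<otimes> y) = dist_T x y"
proof (rule antisym)
  show "dist_T (g \<otimes> x) (g \<otimes> y) \<le> dist_T x y"
    using assms by (intro dist_le relpow_left_mult dist_path)
  have "(inv g \<otimes> (g \<otimes> x), inv g \<otimes> (g \<otimes> y)) \<in> edges ^^ dist_T (g \<otimes> x) (g \<otimes> y)"
    using assms by (intro relpow_left_mult dist_path) auto
  then show "dist_T x y \<le> dist_T (g \<otimes> x) (g \<otimes> y)"
    using assms by (intro dist_le) (simp add: m_assoc[symmetric])
qed

lemma dist_one: "x \<in> carrier G \<Longrightarrow> y \<in> carrier G \<Longrightarrow> dist_T x y = dist_T \<one> (inv x \<otimes> y)"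
  using dist_left_mult[of "inv x" x y] by simp

lemma dist_split:
  assumes "x \<in> carrier G" "y \<in> carrier G" "k \<le> dist_T x y"
  shows "\<exists>z\<in>carrier G. dist_T x z = k \<and> dist_T z y = dist_T x y - k"
proof -
  have "(x, y) \<in> edges ^^ (k + (dist_T x y - k))" using assms dist_path by simp
  then obtain z where z: "(x, z) \<in> edges ^^ k" "(z, y) \<in> edges ^^ (dist_T x y - k)"
    by (auto simp: relpow_add)
  then have "z \<in> carrier G" using relpow_carrier assms by blast
  moreover have "dist_T x z \<le> k" "dist_T z y \<le> dist_T x y - k" using z dist_le by blast+
  moreover have "dist_T x y \<le> dist_T x z + dist_T z y" using assms \<open>z \<in> carrier G\<close> dist_triangle by blast
  ultimately show ?thesis using assms(3) by (intro bexI[of _ z]) auto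
qed

lemma finite_ball:
  assumes "finite T" shows "finite {x \<in> carrier G. dist_T \<one> x \<le> n}"
proof -
  have nb: "finite {y. (x, y) \<in> edges}" for x
  proof -
    have "{y. (x, y) \<in> edges} \<subseteq> (\<lambda>s. x \<otimes> s) ` T \<union> (\<lambda>s. x \<otimes> inv s) ` T"
    proof
      fix y assume "y \<in> {y. (x, y) \<in> edges}"
      then consider s where "y = x \<otimes> s" "s \<in> T" | s where "x = y \<otimes> s" "y \<in> carrier G" "s \<in> T"
        unfolding cayley_edges_def by blast
      then show "y \<in> (\<lambda>s. x \<otimes> s) ` T \<union> (\<lambda>s. x \<otimes> inv s) ` T"
      proof cases
        case 2
        then have "y = x \<otimes> inv s" using T_subset by (simp add: m_assoc subset_iff)
        then show ?thesis using 2 by blast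
      qed blast
    qed
    then show ?thesis using assms finite_subset by blast
  qed
  have f: "finite {x. (\<one>, x) \<in> edges ^^ k}" for k
  proof (induction k)
    case (Suc k)
    have "{x. (\<one>, x) \<in> edges ^^ Suc k} = (\<Union>z\<in>{x. (\<one>, x) \<in> edges ^^ k}. {y. (z, y) \<in> edges})"
      by auto
    then show ?case using Suc nb by auto
  qed simp
  have "{x \<in> carrier G. dist_T \<one> x \<le> n} \<subseteq> (\<Union>k\<le>n. {x. (\<one>, x) \<in> edges ^^ k})"
    using dist_path[of \<one>] by blast
  then show ?thesis using f finite_subset by blast
qed

end

section \<open>Walls of a Coxeter system\<close>

locale coxeter = group G for G :: "('a, 'b) monoid_scheme" (structure) +
  fixes S :: "'a set" and m :: "'a \<Rightarrow> 'a \<Rightarrow> enat"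
  assumes cox: "coxeter_system G S m"
begin

section \<open>Conjugation, and generators as involutions\<close>

definition conj_by :: "'a \<Rightarrow> 'a \<Rightarrow> 'a" where
  "conj_by x t = inv x \<otimes> t \<otimes> x"

lemma inv_cancel_left [simp]:
  "x \<in> carrier G \<Longrightarrow> y \<in> carrier G \<Longrightarrow> inv x \<otimes> (x \<otimes> y) = y"
  "x \<in> carrier G \<Longrightarrow> y \<in> carrier G \<Longrightarrow> x \<otimes> (inv x \<otimes> y) = y"
  by (simp_all add: m_assoc[symmetric])

lemma conj_by_closed [simp, intro]: "x \<in> carrier G \<Longrightarrow> t \<in> carrier G \<Longrightarrow> conj_by x t \<in> carrier G"
  by (simp add: conj_by_def)

lemma conj_by_one [simp]: "t \<in> carrier G \<Longrightarrow> conj_by \<one> t = t"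
  by (simp add: conj_by_def)

lemma conj_by_self [simp]: "t \<in> carrier G \<Longrightarrow> conj_by t t = t"
  by (simp add: conj_by_def)

lemma conj_by_comp:
  "x \<in> carrier G \<Longrightarrow> y \<in> carrier G \<Longrightarrow> t \<in> carrier G \<Longrightarrow> conj_by (x \<otimes> y) t = conj_by y (conj_by x t)"
  by (simp add: conj_by_def inv_mult_group m_assoc)

lemma mult_conj_by: "x \<in> carrier G \<Longrightarrow> t \<in> carrier G \<Longrightarrow> x \<otimes> conj_by x t = t \<otimes> x"
  by (simp add: conj_by_def m_assoc[symmetric])

lemma conj_by_eq_iff:
  "x \<in> carrier G \<Longrightarrow> t \<in> carrier G \<Longrightarrow> u \<in> carrier G \<Longrightarrow> conj_by x t = u \<longleftrightarrow> t \<otimes> x = x \<otimes> u"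
  by (metis Units_eq Units_l_cancel conj_by_closed mult_conj_by)

lemma conj_by_inv_cancel [simp]:
  "x \<in> carrier G \<Longrightarrow> t \<in> carrier G \<Longrightarrow> conj_by x (conj_by (inv x) t) = t"
  "x \<in> carrier G \<Longrightarrow> t \<in> carrier G \<Longrightarrow> conj_by (inv x) (conj_by x t) = t"
  using conj_by_comp[of "inv x" x t] conj_by_comp[of x "inv x" t] by simp_all

lemma conj_by_hom:
  "x \<in> carrier G \<Longrightarrow> t \<in> carrier G \<Longrightarrow> u \<in> carrier G \<Longrightarrow> conj_by x (t \<otimes> u) = conj_by x t \<otimes> conj_by x u"
  by (simp add: conj_by_def m_assoc)

lemma conj_by_inj: "x \<in> carrier G \<Longrightarrow> t \<in> carrier G \<Longrightarrow> u \<in> carrier G \<Longrightarrow> conj_by x t = conj_by x u \<longleftrightarrow> t = u"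
  by (metis conj_by_inv_cancel(2))

lemma presentation: "group_presentation G S (coxeter_relators S m)"
  using cox by (simp add: coxeter_system_def)

lemma S_subset: "S \<subseteq> carrier G" and generate_S: "generate G S = carrier G"
  using presentation by (simp_all add: group_presentation_def)

lemma S_closed [simp, intro]: "s \<in> S \<Longrightarrow> s \<in> carrier G"
  using S_subset by blast

lemma relator_val:
  assumes "\<rho> \<in> coxeter_relators S m"
  shows "word_val G \<rho> = \<one>"
proof -
  have "deletion S (coxeter_relators S m) ([] @ \<rho> @ []) ([] @ [])"
    using assms by (rule deletion.relator)
  then have "equivclp (deletion S (coxeter_relators S m)) \<rho> []"
    by auto
  moreover have "\<rho> \<in> lists (S \<times> UNIV)"
    using assms by (auto simp: coxeter_relators_def split: if_splits)
  ultimately show ?thesis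
    using presentation by (auto simp: group_presentation_def)
qed

lemma trivial_word:
  assumes "set w \<subseteq> S \<times> UNIV" "word_val G w = \<one>"
  shows "equivclp (deletion S (coxeter_relators S m)) w []"
proof -
  have "w \<in> lists (S \<times> UNIV)" using assms(1) by auto
  then show ?thesis using assms(2) presentation unfolding group_presentation_def by blast
qed

lemma S_square [simp]: "s \<in> S \<Longrightarrow> s \<otimes> s = \<one>"
proof -
  assume s: "s \<in> S"
  then have "m s s = enat 1"
    using cox by (simp add: coxeter_system_def one_enat_def)
  then have "concat (replicate 1 [(s, True), (s, True)]) \<in> coxeter_relators S m"
    using s unfolding coxeter_relators_def by blast
  from relator_val[OF this] s show ?thesis
    by (simp add: word_val_def letter_val_def)
qed

lemma inv_S [simp]: "s \<in> S \<Longrightarrow> inv s = s"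
  by (simp add: inv_equality)

lemma S_cancel [simp]: "s \<in> S \<Longrightarrow> x \<in> carrier G \<Longrightarrow> s \<otimes> (s \<otimes> x) = x"
  by (simp add: m_assoc[symmetric])

lemma S_cancel_right [simp]: "s \<in> S \<Longrightarrow> x \<in> carrier G \<Longrightarrow> x \<otimes> s \<otimes> s = x"
  by (simp add: m_assoc)

lemma conj_by_S_cancel [simp]: "s \<in> S \<Longrightarrow> t \<in> carrier G \<Longrightarrow> conj_by s (conj_by s t) = t"
  by (simp add: conj_by_comp[symmetric])

lemma conj_by_S_eq [simp]: "s \<in> S \<Longrightarrow> t \<in> carrier G \<Longrightarrow> conj_by s t = s \<longleftrightarrow> t = s"
  by (metis S_closed conj_by_S_cancel S_cancel_right conj_by_def inv_S)

section \<open>Words and the parity with which they cross walls\<close>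

primrec wprod :: "'a list \<Rightarrow> 'a" where
  "wprod [] = \<one>"
| "wprod (s # w) = s \<otimes> wprod w"

lemma wprod_closed [simp, intro]: "set w \<subseteq> S \<Longrightarrow> wprod w \<in> carrier G"
  by (induction w) auto

lemma wprod_append: "set u \<subseteq> S \<Longrightarrow> set v \<subseteq> S \<Longrightarrow> wprod (u @ v) = wprod u \<otimes> wprod v"
  by (induction u) (auto simp: m_assoc)

lemma wprod_rev: "set w \<subseteq> S \<Longrightarrow> wprod (rev w) = inv (wprod w)"
  by (induction w) (auto simp: wprod_append inv_mult_group)

lemma word_val_eq_wprod: "set w \<subseteq> S \<times> UNIV \<Longrightarrow> word_val G w = wprod (map fst w)"
  by (induction w) (auto simp: word_val_def letter_val_def)

lemma word_exists:
  assumes "x \<in> carrier G" shows "\<exists>w. set w \<subseteq> S \<and> wprod w = x"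
proof -
  have "x \<in> generate G S" using assms generate_S by simp
  then show ?thesis
  proof induction
    case one
    then show ?case by (intro exI[of _ "[]"]) simp
  next
    case (incl h)
    then show ?case by (intro exI[of _ "[h]"]) simp
  next
    case (inv h)
    then show ?case by (intro exI[of _ "[h]"]) simp
  next
    case (eng h1 h2)
    then obtain u v where "set u \<subseteq> S" "wprod u = h1" "set v \<subseteq> S" "wprod v = h2" by blast
    then show ?case by (intro exI[of _ "u @ v"]) (simp add: wprod_append)
  qed
qed

text \<open>
  \<open>par w t\<close> is the parity of the number of times the path from \<open>\<one>\<close> labelled \<open>w\<close> crosses the
  wall of \<open>t\<close>, i.e. traverses an edge \<open>{x, xs}\<close> with \<open>x s x\<^sup>-\<^sup>1 = t\<close>.
\<close>

primrec par :: "'a list \<Rightarrow> 'a \<Rightarrow> bool" where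
  "par [] t = False"
| "par (s # w) t = ((t = s) \<noteq> par w (conj_by s t))"

lemma par_append:
  "set u \<subseteq> S \<Longrightarrow> set v \<subseteq> S \<Longrightarrow> t \<in> carrier G \<Longrightarrow>
    par (u @ v) t = (par u t \<noteq> par v (conj_by (wprod u) t))"
  by (induction u arbitrary: t) (auto simp: conj_by_comp)

text \<open>The edges of the path labelled \<open>(s s')^k\<close> cross in turn the walls of
  \<open>(s s')^j s\<close> for \<open>j < 2 k\<close>. The second conjunct is carried along because
  \<open>par_append\<close> needs the endpoint of the prefix.\<close>

lemma par_pair_power:
  assumes s: "s \<in> S" "s' \<in> S" and t: "t \<in> carrier G"
  shows "(par (concat (replicate k [s, s'])) t \<longleftrightarrow>
           odd (\<Sum>j<2*k. of_bool (t = (s \<otimes> s') [^] j \<otimes> s) :: nat)) \<and>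
         wprod (concat (replicate k [s, s'])) = (s \<otimes> s') [^] k"
proof (induction k)
  case 0
  then show ?case by simp
next
  case (Suc k)
  define z where "z = s \<otimes> s'"
  have z: "z \<in> carrier G" using s by (simp add: z_def)
  have zs: "s \<otimes> z [^] j = inv (z [^] j) \<otimes> s" for j :: nat
  proof (induction j)
    case (Suc j)
    have "s \<otimes> z [^] Suc j = inv (z [^] j) \<otimes> s \<otimes> z"
      using Suc z s by (simp add: m_assoc[symmetric])
    also have "s \<otimes> z = inv z \<otimes> s"
      using s by (simp add: z_def inv_mult_group m_assoc)
    then have "inv (z [^] j) \<otimes> s \<otimes> z = inv (z [^] j) \<otimes> inv z \<otimes> s"
      using z s by (simp add: m_assoc)
    also have "inv (z [^] j) \<otimes> inv z = inv (z [^] Suc j)"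
      using z by (metis inv_mult_group nat_pow_Suc2 nat_pow_closed)
    finally show ?case .
  qed (use s in simp)
  have zk: "z [^] k \<otimes> (z [^] k) = z [^] (2 * k)"
    using z by (simp add: nat_pow_mult mult_2)
  have inv_zs: "z [^] k \<otimes> s = s \<otimes> inv (z [^] k)"
  proof -
    have "z [^] k \<otimes> s = s \<otimes> (s \<otimes> z [^] k) \<otimes> s"
      using z s by (simp add: m_assoc)
    also have "\<dots> = s \<otimes> inv (z [^] k)"
      unfolding zs using z s by (simp add: m_assoc)
    finally show ?thesis .
  qed
  have 1: "conj_by (z [^] k) t = s \<longleftrightarrow> t = z [^] (2 * k) \<otimes> s"
  proof -
    have "conj_by (z [^] k) t = s \<longleftrightarrow> t \<otimes> z [^] k = z [^] k \<otimes> s"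
      using z s t by (simp add: conj_by_eq_iff)
    also have "\<dots> \<longleftrightarrow> t = z [^] k \<otimes> s \<otimes> inv (z [^] k)"
      using z s t by (metis S_closed inv_solve_right' m_closed nat_pow_closed)
    also have "z [^] k \<otimes> s \<otimes> inv (z [^] k) = z [^] k \<otimes> (z [^] k \<otimes> s)"
      using z s by (simp add: m_assoc inv_zs[symmetric])
    also have "\<dots> = z [^] (2 * k) \<otimes> s"
      using z s zk by (simp add: m_assoc[symmetric])
    finally show ?thesis .
  qed
  have 2: "conj_by s (conj_by (z [^] k) t) = s' \<longleftrightarrow> t = z [^] (Suc (2 * k)) \<otimes> s"
  proof -
    have "conj_by s (conj_by (z [^] k) t) = conj_by (z [^] k \<otimes> s) t"
      using z s t by (simp add: conj_by_comp)
    also have "\<dots> = s' \<longleftrightarrow> t \<otimes> (z [^] k \<otimes> s) = z [^] k \<otimes> s \<otimes> s'"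
      using z s t by (simp add: conj_by_eq_iff)
    also have "\<dots> \<longleftrightarrow> t = z [^] k \<otimes> s \<otimes> s' \<otimes> inv (z [^] k \<otimes> s)"
      using z s t by (metis S_closed inv_solve_right' m_closed nat_pow_closed)
    also have "inv (z [^] k \<otimes> s) = z [^] k \<otimes> s"
      using z s inv_zs by (simp add: inv_mult_group)
    also have "z [^] k \<otimes> s \<otimes> s' \<otimes> (z [^] k \<otimes> s) = z [^] k \<otimes> z \<otimes> (z [^] k \<otimes> s)"
      using z s by (simp add: z_def m_assoc)
    also have "z [^] k \<otimes> z = z [^] Suc k" by simp
    also have "z [^] Suc k \<otimes> (z [^] k \<otimes> s) = z [^] Suc k \<otimes> z [^] k \<otimes> s"
      using z s by (intro m_assoc[symmetric]) auto
    also have "z [^] Suc k \<otimes> z [^] k = z [^] (Suc (2 * k))"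
      using z by (subst nat_pow_mult) (simp_all add: mult_2 del: nat_pow_Suc)
    finally show ?thesis .
  qed
  have rep: "concat (replicate (Suc k) [s, s']) = concat (replicate k [s, s']) @ [s, s']"
    by (metis append_Nil2 concat.simps(1) concat.simps(2) concat_append replicate_Suc replicate_append_same)
  have sub: "set (concat (replicate k [s, s'])) \<subseteq> S"
    using s by (induction k) auto
  have IHw: "wprod (concat (replicate k [s, s'])) = z [^] k"
    and IHp: "par (concat (replicate k [s, s'])) t \<longleftrightarrow>
      odd (\<Sum>j<2*k. of_bool (t = z [^] j \<otimes> s) :: nat)"
    using Suc by (auto simp: z_def)
  have "par (concat (replicate (Suc k) [s, s'])) t \<longleftrightarrow>
     (odd (\<Sum>j<2*k. of_bool (t = z [^] j \<otimes> s) :: nat) \<noteq>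
       ((t = z [^] (2*k) \<otimes> s) \<noteq> (t = z [^] (Suc (2*k)) \<otimes> s)))"
    unfolding rep using sub s t by (simp add: par_append IHw IHp 1 2)
  also have "\<dots> \<longleftrightarrow> odd (\<Sum>j<2*Suc k. of_bool (t = z [^] j \<otimes> s) :: nat)"
    by (simp del: nat_pow_Suc)
  finally have "par (concat (replicate (Suc k) [s, s'])) t \<longleftrightarrow>
    odd (\<Sum>j<2*Suc k. of_bool (t = z [^] j \<otimes> s) :: nat)" .
  moreover have "wprod (concat (replicate (Suc k) [s, s'])) = z [^] Suc k"
    unfolding rep using sub s z by (simp add: wprod_append IHw) (simp add: z_def)
  ultimately show ?case by (simp only: z_def)
qed

text \<open>Since \<open>(s s')^k = \<one>\<close>, the walls met at positions \<open>j\<close> and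
  \<open>j + k\<close> coincide, so each wall is met an even number of times, whether or not
  \<open>k\<close> is the true order of \<open>s s'\<close>.\<close>

lemma par_relator:
  assumes \<rho>: "\<rho> \<in> coxeter_relators S m" and t: "t \<in> carrier G"
  shows "\<not> par (map fst \<rho>) t" "wprod (map fst \<rho>) = \<one>" "set (map fst \<rho>) \<subseteq> S"
    and "set \<rho> \<subseteq> S \<times> UNIV"
proof -
  obtain s s' k where s: "s \<in> S" "s' \<in> S" and
    \<rho>_eq: "\<rho> = concat (replicate k [(s, True), (s', True)])"
    using \<rho> by (auto simp: coxeter_relators_def)
  have map: "map fst \<rho> = concat (replicate k [s, s'])"
    by (simp add: \<rho>_eq map_concat)
  show sub: "set (map fst \<rho>) \<subseteq> S" and sub': "set \<rho> \<subseteq> S \<times> UNIV"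
    using s by (auto simp: \<rho>_eq split: if_splits)
  define z where "z = s \<otimes> s'"
  have z: "z \<in> carrier G" using s by (simp add: z_def)
  show 1: "wprod (map fst \<rho>) = \<one>"
    using relator_val[OF \<rho>] sub' by (simp add: word_val_eq_wprod)
  then have zk: "z [^] k = \<one>"
    using conjunct2[OF par_pair_power[OF s t, of k]] by (simp add: map z_def)
  have "(\<Sum>j<2*k. of_bool (t = z [^] j \<otimes> s) :: nat) =
    (\<Sum>j<k. of_bool (t = z [^] j \<otimes> s)) + (\<Sum>j\<in>{k..<2*k}. of_bool (t = z [^] j \<otimes> s))"
    by (subst sum.union_disjoint[symmetric]) (auto simp: ivl_disj_un_one intro!: sum.cong)
  also have "(\<Sum>j\<in>{k..<2*k}. of_bool (t = z [^] j \<otimes> s) :: nat) =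
      (\<Sum>j<k. of_bool (t = z [^] (j + k) \<otimes> s))"
    using sum.shift_bounds_nat_ivl[of "\<lambda>j. of_bool (t = z [^] j \<otimes> s) :: nat" 0 k k]
    by (simp add: mult_2 atLeast0LessThan)
  also have "\<dots> = (\<Sum>j<k. of_bool (t = z [^] j \<otimes> s))"
    using z zk by (simp add: nat_pow_mult[symmetric])
  finally have "even (\<Sum>j<2*k. of_bool (t = z [^] j \<otimes> s) :: nat)" by simp
  then show "\<not> par (map fst \<rho>) t"
    using par_pair_power[OF s t, of k] by (simp add: map z_def)
qed

lemma par_deletion:
  assumes "deletion S (coxeter_relators S m) w w'"
  shows "set w \<subseteq> S \<times> UNIV \<longleftrightarrow> set w' \<subseteq> S \<times> UNIV"
    and "set w \<subseteq> S \<times> UNIV \<Longrightarrow> t \<in> carrier G \<Longrightarrow> par (map fst w) t = par (map fst w') t"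
proof -
  have "(set w \<subseteq> S \<times> UNIV \<longleftrightarrow> set w' \<subseteq> S \<times> UNIV) \<and>
    (set w \<subseteq> S \<times> UNIV \<longrightarrow> t \<in> carrier G \<longrightarrow> par (map fst w) t = par (map fst w') t)"
    using assms
  proof cases
    case (cancel s u e v)
    have f: "fst ` A \<subseteq> S \<longleftrightarrow> A \<subseteq> S \<times> UNIV" for A :: "('a \<times> bool) set" by auto
    show ?thesis
      using cancel by (auto simp: f par_append)
  next
    case (relator \<rho> u v)
    have f: "fst ` A \<subseteq> S \<longleftrightarrow> A \<subseteq> S \<times> UNIV" for A :: "('a \<times> bool) set" by auto
    show ?thesis
      using relator(1,2) par_relator[OF relator(3)]
      by (auto simp: f par_append)
  qed
  then show "set w \<subseteq> S \<times> UNIV \<longleftrightarrow> set w' \<subseteq> S \<times> UNIV"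
    and "set w \<subseteq> S \<times> UNIV \<Longrightarrow> t \<in> carrier G \<Longrightarrow> par (map fst w) t = par (map fst w') t"
    by auto
qed

text \<open>Here the presentation enters in its essential direction: a word of value
  \<open>\<one>\<close> is a consequence of the relators, and no elementary move changes the
  parity.\<close>

lemma par_trivial:
  assumes w: "set w \<subseteq> S" and "wprod w = \<one>" and t: "t \<in> carrier G"
  shows "\<not> par w t"
proof -
  define v where "v = map (\<lambda>s. (s, True)) w"
  have v: "set v \<subseteq> S \<times> UNIV" "map fst v = w"
    using w by (auto simp: v_def comp_def)
  then have "word_val G v = \<one>"
    using assms by (simp add: word_val_eq_wprod)
  then have "equivclp (deletion S (coxeter_relators S m)) v []"
    using v by (intro trivial_word) auto
  then have "set v \<subseteq> S \<times> UNIV \<longrightarrow> par (map fst v) t = par (map fst []) t"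
  proof (induction rule: converse_equivclp_induct)
    case (step y z)
    then show ?case
      using par_deletion(1)[of y z] par_deletion(1)[of z y] par_deletion(2)[of y z t] par_deletion(2)[of z y t] t by blast
  qed simp
  then show ?thesis using v by simp
qed

lemma par_eq:
  assumes w: "set w \<subseteq> S" "set w' \<subseteq> S" and eq: "wprod w = wprod w'" and t: "t \<in> carrier G"
  shows "par w t = par w' t"
proof -
  have "\<not> par (w @ rev w') t" "\<not> par (w' @ rev w') t"
    using w t eq par_trivial[of "w @ rev w'" t] par_trivial[of "w' @ rev w'" t]
    by (simp_all add: wprod_append wprod_rev)
  then show ?thesis
    using w t eq by (auto simp: par_append)
qed

text \<open>
  The contragredient of the geometric representation. It is needed only to see that two generators
  with \<open>m s s' \<ge> 3\<close> do not commute.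
\<close>

definition cform :: "'a \<Rightarrow> 'a \<Rightarrow> real" where
  "cform s t = (case m s t of enat k \<Rightarrow> - cos (pi / k) | \<infinity> \<Rightarrow> -1)"

definition act :: "'a \<Rightarrow> ('a \<Rightarrow> real) \<Rightarrow> 'a \<Rightarrow> real" where
  "act s f = (\<lambda>t. f t - 2 * f s * cform s t)"

lemma cform_self [simp]: "s \<in> S \<Longrightarrow> cform s s = 1"
  using cox by (simp add: coxeter_system_def cform_def one_enat_def)

lemma cform_sym: "s \<in> S \<Longrightarrow> t \<in> S \<Longrightarrow> cform s t = cform t s"
  using cox by (simp add: coxeter_system_def cform_def)

lemma act_act [simp]: "s \<in> S \<Longrightarrow> act s (act s f) = f"
  by (simp add: act_def)

text \<open>For \<open>s \<noteq> s'\<close> the values at \<open>s\<close> and \<open>s'\<close>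
  evolve like a rotation by \<open>2 * pi / k\<close>, hence with period \<open>k\<close>; every
  other coordinate only accumulates multiples of the sums of these values over a period, and those
  sums vanish.\<close>

lemma act_power:
  assumes s: "s \<in> S" "s' \<in> S" and k: "m s s' = enat k"
  shows "((\<lambda>f. act s (act s' f)) ^^ k) f = f"
proof (cases "s = s'")
  case True
  have "((\<lambda>f. f) ^^ k) f = f" for f :: "'a \<Rightarrow> real" by (induction k) auto
  then show ?thesis using True s by simp
next
  case False
  then have "2 \<le> m s s'" using cox s by (simp add: coxeter_system_def)
  then have k2: "2 \<le> k" using k by (simp add: numeral_eq_enat)
  define \<theta> where "\<theta> = pi / k"
  define b where "b = cform s s'"
  have b: "b = - cos \<theta>" "cform s' s = b"
    using k cform_sym[OF s] by (simp_all add: b_def cform_def \<theta>_def)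
  have \<theta>: "0 < \<theta>" "\<theta> < pi" using k2 by (simp_all add: \<theta>_def field_simps)
  then have sin: "sin \<theta> \<noteq> 0" using sin_gt_zero by fastforce
  define U where "U j = ((\<lambda>f. act s (act s' f)) ^^ j) f" for j
  define p q where "p j = U j s" and "q j = U j s'" for j
  have step: "U (Suc j) t = U j t - 2 * (p j - 2 * q j * b) * cform s t - 2 * q j * cform s' t"
    for j t
    using b(2) by (simp add: U_def p_def q_def act_def algebra_simps)
  have p: "p (Suc j) = - p j + 2 * b * q j" and
    q: "q (Suc j) = - q j - 2 * b * p j + 4 * b\<^sup>2 * q j" for j
    using step[of j s] step[of j s'] s b(2)
    by (simp_all add: p_def[symmetric] q_def[symmetric] b_def[symmetric] algebra_simps power2_eq_square)
  have rec: "sin (x + 2 * \<theta>) = 2 * cos \<theta> * sin (x + \<theta>) - sin x" for x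
  proof -
    have "sin (x + 2 * \<theta>) = sin ((x + \<theta>) + \<theta>)" "sin x = sin ((x + \<theta>) - \<theta>)"
      by (simp_all add: algebra_simps)
    then show ?thesis by (simp only: sin_add[of "x + \<theta>"] sin_diff[of "x + \<theta>"]) simp
  qed
  \<comment> \<open>The Chebyshev form of the recursion, multiplied by \<open>sin \<theta>\<close>
    to avoid division; \<open>k \<ge> 2\<close> keeps \<theta> strictly between \<open>0\<close> and
    \<open>pi\<close>, so the factor can be cancelled at the end.\<close>
  have closed: "q j * sin \<theta> = sin ((2 * real j + 1) * \<theta>) * q 0 + sin (2 * real j * \<theta>) * p 0 \<and>
    p j * sin \<theta> = - sin (2 * real j * \<theta>) * q 0 - sin ((2 * real j - 1) * \<theta>) * p 0" for j :: nat
  proof (induction j)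
    case (Suc j)
    define x where "x = (2 * real j - 1) * \<theta>"
    have 1: "sin (2 * real j * \<theta>) = sin (x + \<theta>)" "sin ((2 * real j + 1) * \<theta>) = sin (x + 2 * \<theta>)"
      "sin ((2 * real j - 1) * \<theta>) = sin x"
      "sin (2 * real (Suc j) * \<theta>) = sin ((x + \<theta>) + 2 * \<theta>)"
      "sin ((2 * real (Suc j) - 1) * \<theta>) = sin (x + 2 * \<theta>)"
      "sin ((2 * real (Suc j) + 1) * \<theta>) = sin ((x + 2 * \<theta>) + 2 * \<theta>)"
      by (simp_all add: x_def algebra_simps)
    have r1: "sin (x + \<theta> + 2 * \<theta>) = 2 * cos \<theta> * sin (x + 2 * \<theta>) - sin (x + \<theta>)"
      using rec[of "x + \<theta>"] by (simp add: algebra_simps)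
    have r2: "sin (x + 2 * \<theta> + 2 * \<theta>) = 2 * cos \<theta> * sin (x + \<theta> + 2 * \<theta>) - sin (x + 2 * \<theta>)"
      using rec[of "x + 2 * \<theta>"] by (simp add: algebra_simps)
    have IH: "q j * sin \<theta> = sin (x + 2 * \<theta>) * q 0 + sin (x + \<theta>) * p 0"
      "p j * sin \<theta> = - sin (x + \<theta>) * q 0 - sin x * p 0"
      using Suc 1 by auto
    have pS: "p (Suc j) * sin \<theta> = - (p j * sin \<theta>) - 2 * cos \<theta> * (q j * sin \<theta>)"
      unfolding p b by (simp add: algebra_simps)
    also have "\<dots> = - sin (x + \<theta> + 2 * \<theta>) * q 0 - sin (x + 2 * \<theta>) * p 0"
      unfolding IH r1 using rec[of x] by algebra
    finally have P: "p (Suc j) * sin \<theta> = - sin (x + \<theta> + 2 * \<theta>) * q 0 - sin (x + 2 * \<theta>) * p 0" .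
    have "q (Suc j) = - q j - 2 * b * (p j - 2 * b * q j)"
      unfolding q by (simp add: algebra_simps power2_eq_square)
    also have "p j - 2 * b * q j = - p (Suc j)" unfolding p by simp
    finally have "q (Suc j) * sin \<theta> = - (q j * sin \<theta>) - 2 * cos \<theta> * (p (Suc j) * sin \<theta>)"
      unfolding b by algebra
    also have "\<dots> = sin (x + 2 * \<theta> + 2 * \<theta>) * q 0 + sin (x + \<theta> + 2 * \<theta>) * p 0"
      unfolding IH P r2 using r1 by algebra
    finally show ?case using P 1 by (simp only:)
  qed simp
  have k\<theta>: "2 * real k * \<theta> = 2 * pi" using k2 by (simp add: \<theta>_def)
  have "q k * sin \<theta> = q 0 * sin \<theta>" "p k * sin \<theta> = p 0 * sin \<theta>"
    using closed[of k] by (simp_all add: k\<theta> distrib_right left_diff_distrib sin_add sin_diff)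
  then have per: "q k = q 0" "p k = p 0" using sin by auto
  define P where "P = (\<Sum>j<k. p j)"
  define Q where "Q = (\<Sum>j<k. q j)"
  have shift: "(\<Sum>j<k. h (Suc j)) = (\<Sum>j<k. h j)" if "h k = h 0" for h :: "nat \<Rightarrow> real"
    using that sum.lessThan_Suc_shift[of h k] by simp
  \<comment> \<open>Sums over a full period are fixed by the product, and
    \<open>b\<^sup>2 \<noteq> 1\<close> excludes a nonzero fixed vector.\<close>
  have "P = - P + 2 * b * Q"
    using shift[of p] per by (simp add: p P_def Q_def sum.distrib sum_subtractf sum_negf sum_distrib_left)
  moreover have "Q = - Q - 2 * b * P + 4 * b\<^sup>2 * Q"
    using shift[of q] per by (simp add: q P_def Q_def sum.distrib sum_subtractf sum_negf sum_distrib_left)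
  ultimately have "P = b * Q" "Q = b\<^sup>2 * Q" by (simp_all add: algebra_simps power2_eq_square)
  moreover have "b\<^sup>2 \<noteq> 1"
    using sin by (simp add: b cos_squared_eq)
  ultimately have "Q = 0" "P = 0" by auto
  have "U n t = f t - 2 * (\<Sum>j<n. p j - 2 * q j * b) * cform s t - 2 * (\<Sum>j<n. q j) * cform s' t"
    for n t
    by (induction n) (simp add: U_def, simp add: step algebra_simps)
  then have "U k t = f t - 2 * (P - 2 * b * Q) * cform s t - 2 * Q * cform s' t" for t
    by (simp add: P_def Q_def sum_subtractf sum_distrib_left mult_ac)
  then show ?thesis using \<open>Q = 0\<close> \<open>P = 0\<close> by (auto simp: U_def)
qed

lemma act_deletion:
  assumes "deletion S (coxeter_relators S m) w w'"
  shows "foldr act (map fst w) f = foldr act (map fst w') f"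
  using assms
proof cases
  case (relator \<rho> u v)
  then obtain s s' k where s: "s \<in> S" "s' \<in> S" "m s s' = enat k" and
    \<rho>_eq: "\<rho> = concat (replicate k [(s, True), (s', True)])"
    by (auto simp: coxeter_relators_def)
  have "foldr act (map fst (concat (replicate n [(s, True), (s', True)]))) h =
      ((\<lambda>f. act s (act s' f)) ^^ n) h" for n h
    by (induction n) auto
  then show ?thesis using relator act_power[OF s] by (simp add: \<rho>_eq)
qed simp

text \<open>Otherwise \<open>(s s')^2\<close> would be trivial, the two actions would commute, and
  \<open>cform s s'\<close> would be \<open>0\<close>, the value of a right angle. This turns an
  edge of the diagram into an obstruction to commuting.\<close>

lemma not_commute:
  assumes s: "s \<in> S" "s' \<in> S" and m: "3 \<le> m s s'"
  shows "s \<otimes> s' \<noteq> s' \<otimes> s"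
proof
  assume eq: "s \<otimes> s' = s' \<otimes> s"
  define v where "v = [(s, True), (s', True), (s, True), (s', True)]"
  have "word_val G v = s \<otimes> s' \<otimes> (s \<otimes> s')"
    using s by (simp add: v_def word_val_def letter_val_def m_assoc)
  also have "\<dots> = \<one>"
    by (subst (2) eq) (use s in \<open>simp add: m_assoc\<close>)
  finally have 1: "word_val G v = \<one>" .
  have "set v \<subseteq> S \<times> UNIV" using s unfolding v_def by simp
  from trivial_word[OF this 1] have "equivclp (deletion S (coxeter_relators S m)) v []" .
  then have "foldr act (map fst v) f = foldr act (map fst []) f" for f
  proof (induction rule: converse_equivclp_induct)
    case (step y z)
    then show ?case by (metis act_deletion)
  qed simp
  then have act1: "act s (act s' (act s (act s' f))) = f" for f by (simp add: v_def)
  have ne: "s \<noteq> s'" 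
    using m cox s by (auto simp: coxeter_system_def one_enat_def numeral_eq_enat)
  define b where "b = cform s s'"
  \<comment> \<open>The indicator of \<open>s'\<close> is fixed by \<open>s\<close>; comparing the
    two orders of action at the coordinate \<open>s\<close> gives
    \<open>2 * b = - 2 * b\<close>.\<close>
  define f where "f = (\<lambda>t. if t = s' then 1 else 0 :: real)"
  have "act s (act s' f) = act s' (act s (act s (act s' (act s (act s' f)))))"
    using s by simp
  also have "\<dots> = act s' (act s f)" unfolding act1 ..
  finally have "act s (act s' f) s = act s' (act s f) s" by simp
  then have "b = 0" using s ne cform_sym[OF s] by (simp add: act_def f_def b_def)
  then show False
  proof (cases "m s s'")
    case (enat k)
    then have k: "3 \<le> k" using m by (simp add: numeral_eq_enat)
    then have "0 < cos (pi / k)" 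
      by (intro cos_gt_zero) (auto simp: field_simps)
    then show ?thesis using \<open>b = 0\<close> enat by (simp add: b_def cform_def)
  qed (simp add: b_def cform_def)
qed

section \<open>Sides of a wall and the exchange condition\<close>

definition crosses :: "'a \<Rightarrow> 'a \<Rightarrow> bool" where
  "crosses x t = par (SOME w. set w \<subseteq> S \<and> wprod w = x) t"

lemma crosses_wprod: "set w \<subseteq> S \<Longrightarrow> t \<in> carrier G \<Longrightarrow> crosses (wprod w) t = par w t"
  unfolding crosses_def
  by (rule someI2[of "\<lambda>v. set v \<subseteq> S \<and> wprod v = wprod w" w]) (use par_eq in blast)+

lemma crosses_one [simp]: "t \<in> carrier G \<Longrightarrow> \<not> crosses \<one> t"
  using crosses_wprod[of "[]" t] by simp

lemma crosses_S [simp]: "s \<in> S \<Longrightarrow> t \<in> carrier G \<Longrightarrow> crosses s t \<longleftrightarrow> t = s"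
  using crosses_wprod[of "[s]" t] by simp

text \<open>The cocycle identity: \<open>x\<close> carries the wall of \<open>conj_by x t\<close> to
  the wall of \<open>t\<close>, so the second stretch of the path is judged as seen from
  \<open>x\<close>.\<close>

lemma crosses_mult:
  assumes "x \<in> carrier G" "y \<in> carrier G" "t \<in> carrier G"
  shows "crosses (x \<otimes> y) t \<longleftrightarrow> crosses x t \<noteq> crosses y (conj_by x t)"
proof -
  obtain u v where u: "set u \<subseteq> S" "x = wprod u" and v: "set v \<subseteq> S" "y = wprod v"
    using word_exists[OF assms(1)] word_exists[OF assms(2)] by auto
  have "crosses (wprod (u @ v)) t \<longleftrightarrow> par (u @ v) t"
    using u v assms by (intro crosses_wprod) auto
  then show ?thesis
    using u v assms by (simp add: wprod_append par_append crosses_wprod)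
qed

lemma crosses_inv:
  assumes "x \<in> carrier G" "t \<in> carrier G"
  shows "crosses (inv x) t \<longleftrightarrow> crosses x (conj_by (inv x) t)"
proof -
  have "crosses (inv x \<otimes> x) t \<longleftrightarrow> crosses (inv x) t \<noteq> crosses x (conj_by (inv x) t)"
    using assms by (intro crosses_mult) auto
  then show ?thesis using assms by auto
qed

definition reflections :: "'a set" where
  "reflections = {conj_by x s | x s. x \<in> carrier G \<and> s \<in> S}"

lemma reflectionsE:
  assumes "t \<in> reflections"
  obtains x s where "x \<in> carrier G" "s \<in> S" "t = conj_by x s"
  using assms unfolding reflections_def by blast

lemma reflections_closed [simp]: "t \<in> reflections \<Longrightarrow> t \<in> carrier G"
  by (elim reflectionsE) simp

lemma S_reflections [simp]: "s \<in> S \<Longrightarrow> s \<in> reflections"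
proof -
  assume "s \<in> S"
  then have "s = conj_by \<one> s \<and> \<one> \<in> carrier G \<and> s \<in> S" by simp
  then show ?thesis unfolding reflections_def by blast
qed

lemma conj_by_reflections [simp]:
  assumes x: "x \<in> carrier G" and t: "t \<in> reflections" shows "conj_by x t \<in> reflections"
proof -
  obtain y s where ys: "y \<in> carrier G" "s \<in> S" "t = conj_by y s"
    using t by (rule reflectionsE)
  have "conj_by x t = conj_by (y \<otimes> x) s" unfolding ys(3) using x ys(1,2) by (subst conj_by_comp) auto
  moreover have "y \<otimes> x \<in> carrier G" using x ys(1) by simp
  ultimately show ?thesis
    using ys(2) unfolding reflections_def by blast
qed

lemma reflection_square [simp]:
  assumes "t \<in> reflections" shows "t \<otimes> t = \<one>"
proof -
  obtain y s where y: "y \<in> carrier G" "s \<in> S" "t = conj_by y s"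
    using assms by (rule reflectionsE)
  then have "t \<otimes> t = conj_by y (s \<otimes> s)" by (subst conj_by_hom) auto
  also have "\<dots> = \<one>" using y(1,2) by (simp add: conj_by_def)
  finally show ?thesis .
qed

lemma inv_reflection [simp]: "t \<in> reflections \<Longrightarrow> inv t = t"
  by (simp add: inv_equality)

lemma reflection_cancel [simp]: "t \<in> reflections \<Longrightarrow> x \<in> carrier G \<Longrightarrow> t \<otimes> (t \<otimes> x) = x"
  by (simp add: m_assoc[symmetric])

text \<open>In \<open>t = x^-1 s x\<close> the contributions of \<open>x^-1\<close> and
  \<open>x\<close> cancel, and the single crossing by \<open>s\<close> remains.\<close>

lemma crosses_self: 
  assumes "t \<in> reflections" shows "crosses t t"
proof -
  obtain x s where x: "x \<in> carrier G" "s \<in> S" and t: "t = conj_by x s"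
    using assms by (rule reflectionsE)
  have "t = inv x \<otimes> (s \<otimes> x)" using x by (simp add: t conj_by_def m_assoc)
  then have "crosses t t \<longleftrightarrow> crosses (inv x) t \<noteq> crosses (s \<otimes> x) (conj_by (inv x) t)"
    using x crosses_mult[of "inv x" "s \<otimes> x" t] by (simp add: t)
  also have "conj_by (inv x) t = s" using x by (simp add: t)
  also have "crosses (s \<otimes> x) s \<longleftrightarrow> \<not> crosses x s"
    using x by (simp add: crosses_mult)
  also have "crosses (inv x) t \<longleftrightarrow> crosses x s"
    using x by (simp add: crosses_inv t)
  finally show ?thesis by simp
qed

lemma crosses_reflect:
  assumes "t \<in> reflections" "x \<in> carrier G"
  shows "crosses (t \<otimes> x) t \<longleftrightarrow> \<not> crosses x t"
proof -
  have "conj_by t t = t" using assms by (simp add: conj_by_def)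
  then show ?thesis using assms by (simp add: crosses_mult crosses_self)
qed

lemma par_split:
  "set w \<subseteq> S \<Longrightarrow> t \<in> carrier G \<Longrightarrow> par w t \<Longrightarrow>
    \<exists>u a v. w = u @ a # v \<and> t \<otimes> wprod u = wprod u \<otimes> a"
proof (induction w arbitrary: t)
  case (Cons s w)
  show ?case
  proof (cases "t = s")
    case True
    then show ?thesis using Cons.prems by (intro exI[of _ "[]"]) auto
  next
    case False
    with Cons.prems have "par w (conj_by s t)" by simp
    moreover have "set w \<subseteq> S" "conj_by s t \<in> carrier G" using Cons.prems by auto
    ultimately obtain u a v where w: "w = u @ a # v" and eq: "conj_by s t \<otimes> wprod u = wprod u \<otimes> a"
      using Cons.IH by blast
    have u: "set u \<subseteq> S" "a \<in> S" using w Cons.prems by auto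
    have "t \<otimes> (s \<otimes> wprod u) = s \<otimes> conj_by s t \<otimes> wprod u"
      using Cons.prems u by (simp add: mult_conj_by m_assoc)
    also have "\<dots> = s \<otimes> wprod u \<otimes> a"
      using Cons.prems u eq by (simp add: m_assoc)
    finally show ?thesis using w by (intro exI[of _ "s # u"]) auto
  qed
qed simp

text \<open>An odd parity forces a crossing, say at the letter \<open>a\<close> after the prefix
  \<open>u\<close>. There \<open>t u a = u\<close>, so dropping \<open>a\<close> has the effect of
  multiplying by \<open>t\<close>.\<close>

lemma par_exchange:
  assumes "set w \<subseteq> S" "t \<in> carrier G" "par w t"
  shows "\<exists>w'. set w' \<subseteq> set w \<and> length w' < length w \<and> wprod w' = t \<otimes> wprod w"
proof -
  obtain u a v where w: "w = u @ a # v" and eq: "t \<otimes> wprod u = wprod u \<otimes> a"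
    using par_split[OF assms] by blast
  have u: "set u \<subseteq> S" "a \<in> S" "set v \<subseteq> S" using w assms by auto
  have "t \<otimes> wprod w = (t \<otimes> wprod u) \<otimes> a \<otimes> wprod v"
    using u assms(2) by (simp add: w wprod_append m_assoc)
  also have "\<dots> = wprod u \<otimes> wprod v"
    using u by (simp add: eq)
  finally have "wprod (u @ v) = t \<otimes> wprod w"
    using u by (simp add: wprod_append)
  moreover have "set (u @ v) \<subseteq> set w" "length (u @ v) < length w" by (auto simp: w)
  ultimately show ?thesis by blast
qed

end

sublocale coxeter \<subseteq> cayley G S
  by unfold_locales (simp_all add: S_subset generate_S)

context coxeter
begin

section \<open>Length and the two sides of a wall\<close>

abbreviation len :: "'a \<Rightarrow> nat" where "len \<equiv> cayley_dist G S \<one>"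

lemma edges_iff: "(x, y) \<in> cayley_edges G S \<longleftrightarrow> x \<in> carrier G \<and> (\<exists>s\<in>S. y = x \<otimes> s)"
proof
  assume "(x, y) \<in> cayley_edges G S"
  then consider s where "y = x \<otimes> s" "x \<in> carrier G" "s \<in> S" | s where "x = y \<otimes> s" "y \<in> carrier G" "s \<in> S"
    unfolding cayley_edges_def by blast
  then show "x \<in> carrier G \<and> (\<exists>s\<in>S. y = x \<otimes> s)"
  proof cases
    case 2
    then have "y = x \<otimes> s" by simp
    moreover have "x \<in> carrier G" using 2 by simp
    ultimately show ?thesis using 2 by blast
  qed blast
qed (unfold cayley_edges_def, blast)

lemma relpow_iff_word:
  "(\<one>, x) \<in> cayley_edges G S ^^ n \<longleftrightarrow> (\<exists>w. set w \<subseteq> S \<and> length w = n \<and> wprod w = x)"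
proof (induction n arbitrary: x)
  case 0
  then show ?case by auto
next
  case (Suc n)
  show ?case
  proof
    assume "(\<one>, x) \<in> cayley_edges G S ^^ Suc n"
    then obtain y s where y: "(\<one>, y) \<in> cayley_edges G S ^^ n" "s \<in> S" "x = y \<otimes> s"
      by (auto simp: edges_iff)
    then obtain w where "set w \<subseteq> S" "length w = n" "wprod w = y" using Suc.IH by blast
    then show "\<exists>w. set w \<subseteq> S \<and> length w = Suc n \<and> wprod w = x"
      using y by (intro exI[of _ "w @ [s]"]) (simp add: wprod_append)
  next
    assume "\<exists>w. set w \<subseteq> S \<and> length w = Suc n \<and> wprod w = x"
    then obtain w where w: "set w \<subseteq> S" "length w = Suc n" "wprod w = x" by blast
    then obtain u s where u: "w = u @ [s]" by (metis append_butlast_last_id length_0_conv nat.distinct(1))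
    then have "(\<one>, wprod u) \<in> cayley_edges G S ^^ n" using Suc.IH w by auto
    moreover have "x = wprod u \<otimes> s" "s \<in> S" "wprod u \<in> carrier G" using u w by (auto simp: wprod_append)
    ultimately show "(\<one>, x) \<in> cayley_edges G S ^^ Suc n"
      by (auto simp: edges_iff)
  qed
qed

lemma len_le: "set w \<subseteq> S \<Longrightarrow> len (wprod w) \<le> length w"
  using relpow_iff_word dist_le by blast

definition reduced :: "'a list \<Rightarrow> bool" where
  "reduced w \<longleftrightarrow> set w \<subseteq> S \<and> length w = len (wprod w)"

lemma reduced_exists: 
  assumes "x \<in> carrier G" shows "\<exists>w. reduced w \<and> wprod w = x"
  using dist_path[OF one_closed assms] unfolding relpow_iff_word reduced_def by metis

lemma len_reflect_less:
  assumes "x \<in> carrier G" "t \<in> carrier G" "crosses x t"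
  shows "len (t \<otimes> x) < len x"
proof -
  obtain w where w: "reduced w" "wprod w = x" using reduced_exists assms by blast
  then have "set w \<subseteq> S" "par w t" using crosses_wprod assms by (auto simp: reduced_def)
  then obtain w' where "set w' \<subseteq> set w" "length w' < length w" "wprod w' = t \<otimes> wprod w"
    using par_exchange assms by blast
  moreover from this have "len (wprod w') \<le> length w'" using \<open>set w \<subseteq> S\<close> by (intro len_le) auto
  ultimately show ?thesis using w by (auto simp: reduced_def)
qed

lemma len_reflect_greater:
  assumes x: "x \<in> carrier G" and t: "t \<in> reflections" and "\<not> crosses x t"
  shows "len x < len (t \<otimes> x)"
proof -
  have "crosses (t \<otimes> x) t" using crosses_reflect[OF t x] assms by simp
  then have "len (t \<otimes> (t \<otimes> x)) < len (t \<otimes> x)"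
    using x t by (intro len_reflect_less) auto
  then show ?thesis using x t by simp
qed

lemma len_inv: "x \<in> carrier G \<Longrightarrow> len (inv x) = len x"
  using dist_one[of x \<one>] dist_commute[of x \<one>] by simp

lemma len_mult_le: "x \<in> carrier G \<Longrightarrow> y \<in> carrier G \<Longrightarrow> len (x \<otimes> y) \<le> len x + len y"
  using dist_triangle[of \<one> x "x \<otimes> y"] dist_left_mult[of x \<one> y] by simp

lemma len_S: "s \<in> S \<Longrightarrow> len s \<le> 1"
  using len_le[of "[s]"] by simp

lemma len_S_mult:
  assumes "s \<in> S" "x \<in> carrier G"
  shows "crosses x s \<Longrightarrow> Suc (len (s \<otimes> x)) = len x"
    and "\<not> crosses x s \<Longrightarrow> len (s \<otimes> x) = Suc (len x)"
proof -
  have 1: "len (s \<otimes> x) \<le> 1 + len x" using len_mult_le[of s x] len_S[of s] assms by simp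
  have "len (s \<otimes> (s \<otimes> x)) \<le> 1 + len (s \<otimes> x)"
    using len_mult_le[of s "s \<otimes> x"] len_S[of s] assms by simp
  then have 2: "len x \<le> 1 + len (s \<otimes> x)" using assms by simp
  show "crosses x s \<Longrightarrow> Suc (len (s \<otimes> x)) = len x"
    using 2 len_reflect_less[of x s] assms by simp
  show "\<not> crosses x s \<Longrightarrow> len (s \<otimes> x) = Suc (len x)"
    using 1 len_reflect_greater[of x s] assms by simp
qed

lemma len_mult_S:
  assumes "s \<in> S" "x \<in> carrier G"
  shows "real (len (x \<otimes> s)) = real (len x) + (if crosses (inv x) s then -1 else 1)"
proof -
  have "len (x \<otimes> s) = len (s \<otimes> inv x)"
    using len_inv[of "x \<otimes> s"] assms by (simp add: inv_mult_group)
  then show ?thesis using len_S_mult[of s "inv x"] len_inv[of x] assms by auto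
qed

text \<open>Translated by \<open>x^-1\<close> this says that a point on the side of
  \<open>\<one>\<close> gets longer when reflected in the wall. It is the folding step behind
  \<open>insertion\<close>.\<close>

lemma dist_reflect_less:
  assumes x: "x \<in> carrier G" and y: "y \<in> carrier G" and t: "t \<in> reflections"
    and "\<not> crosses x t" "\<not> crosses y t"
  shows "cayley_dist G S x y < cayley_dist G S x (t \<otimes> y)"
proof -
  define z where "z = inv x \<otimes> y"
  have z: "z \<in> carrier G" "y = x \<otimes> z" using x y by (simp_all add: z_def)
  have "\<not> crosses z (conj_by x t)"
    using assms z(1) crosses_mult[of x z t] by (simp flip: z(2))
  then have "len z < len (conj_by x t \<otimes> z)"
    using x t z by (intro len_reflect_greater) auto
  moreover have "conj_by x t \<otimes> z = inv x \<otimes> (t \<otimes> y)"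
    using x y t by (simp add: conj_by_def z_def m_assoc)
  ultimately show ?thesis
    using x y t dist_one[of x y] dist_one[of x "t \<otimes> y"] by (simp add: z_def)
qed

section \<open>Deletion condition and standard parabolic subgroups\<close>

lemma deletion_condition:
  "set w \<subseteq> S \<Longrightarrow> \<exists>v. set v \<subseteq> set w \<and> wprod v = wprod w \<and> reduced v"
proof (induction w)
  case Nil
  show ?case by (intro exI[of _ "[]"]) (simp add: reduced_def)
next
  case (Cons a w)
  then obtain v where v: "set v \<subseteq> set w" "wprod v = wprod w" "reduced v" by auto
  have a: "a \<in> S" "set w \<subseteq> S" "set v \<subseteq> S" using Cons.prems v by auto
  then have w: "wprod w \<in> carrier G" by simp
  show ?case
  proof (cases "crosses (wprod w) a")
    case True
    then have "par v a" using crosses_wprod[of v a] v a by simp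
    then obtain v' where v': "set v' \<subseteq> set v" "length v' < length v" "wprod v' = a \<otimes> wprod v"
      using par_exchange[of v a] a by auto
    have "Suc (len (a \<otimes> wprod w)) = len (wprod w)" using len_S_mult(1)[OF a(1) w True] .
    moreover have "len (wprod v') \<le> length v'" using v' a by (intro len_le) auto
    ultimately have "length v' = len (wprod v')" using v v' by (simp add: reduced_def)
    then show ?thesis using v v' a by (intro exI[of _ v']) (auto simp: reduced_def)
  next
    case False
    then have "len (a \<otimes> wprod w) = Suc (len (wprod w))" using len_S_mult(2)[OF a(1) w] by simp
    then show ?thesis using v a by (intro exI[of _ "a # v"]) (auto simp: reduced_def)
  qed
qed

lemma reduced_appendD:
  assumes "reduced (u @ v)" shows "reduced u" "reduced v"
proof -
  have s: "set u \<subseteq> S" "set v \<subseteq> S" using assms by (auto simp: reduced_def)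
  have "len (wprod (u @ v)) \<le> len (wprod u) + len (wprod v)"
    using s len_mult_le[of "wprod u" "wprod v"] by (simp add: wprod_append)
  moreover have "length (u @ v) = len (wprod (u @ v))" using assms by (simp add: reduced_def)
  ultimately show "reduced u" "reduced v" using s len_le[of u] len_le[of v] by (auto simp: reduced_def)
qed

lemma reduced_Cons_crosses:
  assumes "reduced (a # w)" shows "\<not> crosses (wprod w) a" "crosses (wprod (a # w)) a"
proof -
  have s: "a \<in> S" "set w \<subseteq> S" "reduced w" using assms reduced_appendD(2)[of "[a]" w] by (auto simp: reduced_def)
  have "len (a \<otimes> wprod w) = Suc (len (wprod w))" using assms s by (simp add: reduced_def)
  then show "\<not> crosses (wprod w) a" using len_S_mult(1)[of a "wprod w"] s by auto
  then show "crosses (wprod (a # w)) a" using s by (simp add: crosses_mult)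
qed

lemma reduced_rev: "reduced w \<Longrightarrow> reduced (rev w)"
  by (simp add: reduced_def wprod_rev len_inv)

text \<open>The prefix \<open>u\<close> has even parity at this wall, while the remaining path
  \<open>a # v\<close> has odd parity there. Hence every letter of a reduced word is conjugate to a
  reflection whose wall the element crosses.\<close>

lemma reduced_crosses:
  assumes "reduced (u @ a # v)" shows "crosses (wprod (u @ a # v)) (conj_by (inv (wprod u)) a)"
proof -
  have s: "set u \<subseteq> S" "a \<in> S" "set v \<subseteq> S" using assms by (auto simp: reduced_def)
  define t where "t = conj_by (inv (wprod u)) a"
  have t: "t \<in> carrier G" "conj_by (wprod u) t = a" using s by (simp_all add: t_def)
  have av: "crosses (wprod (a # v)) a"
    using reduced_appendD(2)[OF assms] by (rule reduced_Cons_crosses(2))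
  have "reduced ((u @ [a]) @ v)" using assms by simp
  then have "reduced (u @ [a])" by (rule reduced_appendD(1))
  then have "reduced (a # rev u)" using reduced_rev[of "u @ [a]"] by simp
  then have "\<not> crosses (inv (wprod u)) a" using reduced_Cons_crosses(1) s by (fastforce simp: wprod_rev)
  then have "\<not> crosses (wprod u) t" using crosses_inv[of "wprod u" a] s by (simp add: t_def)
  then have "crosses (wprod u \<otimes> wprod (a # v)) t"
    using av s t by (subst crosses_mult) auto
  then show ?thesis using s by (simp add: wprod_append t_def)
qed

lemma S_parabolic:
  assumes "K \<subseteq> S" "set w \<subseteq> K" "wprod w \<in> S" shows "wprod w \<in> K"
proof -
  obtain v where v: "set v \<subseteq> set w" "wprod v = wprod w" "reduced v"
    using deletion_condition[of w] assms by auto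
  have "length v \<le> 1" using v len_S assms by (simp add: reduced_def)
  moreover have "v \<noteq> []"
    using v(2) S_closed[OF assms(3)] crosses_S[OF assms(3), of "wprod w"] crosses_one[of \<one>] by fastforce
  ultimately obtain b where b: "v = [b]" by (cases v) auto
  then have "b \<in> K" using v assms by auto
  then show ?thesis using v(2) b assms(1) by auto
qed

text \<open>A crossing at the letter \<open>a\<close> after the prefix \<open>u\<close> means
  \<open>t = u a u^-1\<close>, a word in \<open>K\<close> again.\<close>

lemma crosses_parabolic:
  assumes K: "K \<subseteq> S" and w: "set w \<subseteq> K" and t: "t \<in> carrier G" and "crosses (wprod w) t"
  obtains v where "set v \<subseteq> K" "wprod v = t"
proof -
  have "par w t" using crosses_wprod[of w t] assms by auto
  then obtain u a v where uv: "w = u @ a # v" "t \<otimes> wprod u = wprod u \<otimes> a"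
    using par_split[of w t] assms by blast
  then have s: "set u \<subseteq> S" "a \<in> S" "set (rev u) \<subseteq> S" using K w by auto
  have "t = wprod u \<otimes> a \<otimes> inv (wprod u)" using uv(2) s t by (metis S_closed inv_solve_right' m_closed wprod_closed)
  then have "wprod (u @ a # rev u) = t" using s by (simp add: wprod_append wprod_rev m_assoc)
  moreover have "set (u @ a # rev u) \<subseteq> K" using uv(1) w by auto
  ultimately show ?thesis using that by blast
qed

lemma reduced_parabolic:
  assumes K: "K \<subseteq> S"
  shows "set w \<subseteq> K \<Longrightarrow> reduced v \<Longrightarrow> wprod v = wprod w \<Longrightarrow> set v \<subseteq> K"
proof (induction v arbitrary: w)
  case (Cons a v)
  have a: "a \<in> S" "set v \<subseteq> S" "set w \<subseteq> S" using Cons.prems K by (auto simp: reduced_def)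
  have "crosses (wprod w) a" using reduced_Cons_crosses(2)[OF Cons.prems(2)] Cons.prems(3) by simp
  then obtain u where "set u \<subseteq> K" "wprod u = a" using crosses_parabolic[OF K Cons.prems(1)] a by blast
  then have aK: "a \<in> K" using S_parabolic[OF K] a by blast
  have "wprod v = wprod (a # w)" using Cons.prems(3) a by (metis S_cancel wprod.simps(2) wprod_closed)
  moreover have "reduced v" using reduced_appendD(2)[of "[a]" v] Cons.prems(2) by simp
  ultimately show ?case using Cons.IH[of "a # w"] aK Cons.prems(1) by simp
qed simp

text \<open>Compare the parities of \<open>t n\<close> and \<open>n t\<close> at the wall of the
  first letter \<open>a\<close>: commuting forces \<open>n\<close> to cross the wall of
  \<open>t a t\<close>, so \<open>t a t\<close> lies in the subgroup generated by \<open>J\<close>.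
  As \<open>t \<notin> J\<close>, its reduced word can only be \<open>a\<close>; then
  \<open>a\<close> is cancelled.\<close>

lemma commute_letters:
  assumes J: "J \<subseteq> S" and t: "t \<in> S" "t \<notin> J"
  shows "set w \<subseteq> J \<Longrightarrow> reduced w \<Longrightarrow> t \<otimes> wprod w = wprod w \<otimes> t \<Longrightarrow> j \<in> set w \<Longrightarrow> t \<otimes> j = j \<otimes> t"
proof (induction w)
  case (Cons a w)
  define n where "n = wprod (a # w)"
  have s: "a \<in> S" "a \<in> J" "a \<noteq> t" "set w \<subseteq> S" "set (a # w) \<subseteq> S" using Cons.prems J t by auto
  then have n: "n \<in> carrier G" by (auto simp: n_def)
  have nt: "t \<otimes> n = n \<otimes> t" using Cons.prems by (simp add: n_def)
  have "conj_by n t = t" using nt n t by (simp add: conj_by_eq_iff)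
  then have "conj_by n a \<noteq> t" using n s t conj_by_inj[of n a t] by auto
  moreover have "crosses (t \<otimes> n) a = crosses (n \<otimes> t) a" using nt by simp
  moreover have "crosses n a" unfolding n_def by (rule reduced_Cons_crosses(2)[OF Cons.prems(2)])
  ultimately have "crosses n (conj_by t a)" using n s t by (simp add: crosses_mult)
  then obtain u where u: "set u \<subseteq> J" "wprod u = conj_by t a"
    using crosses_parabolic[OF J, of "a # w" "conj_by t a"] Cons.prems(1) s t by (auto simp: n_def)
  obtain v where v: "set v \<subseteq> set [t, a, t]" "wprod v = wprod [t, a, t]" "reduced v"
    using deletion_condition[of "[t, a, t]"] s t by auto
  have vu: "wprod v = wprod u" using u v t s by (simp add: conj_by_def m_assoc)
  have "set v \<subseteq> J" using reduced_parabolic[OF J u(1) v(3) vu] .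
  then have va: "set v \<subseteq> {a}" using v(1) t by auto
  have "wprod v \<in> {\<one>, a}" using va s by (induction v) auto
  moreover have "wprod v \<noteq> \<one>"
  proof
    assume "wprod v = \<one>"
    then have "conj_by t a = conj_by t \<one>" using vu u t by (simp add: conj_by_def)
    then have "a = \<one>" using s t conj_by_inj[of t a \<one>] by simp
    then show False using crosses_self[of a] s by simp
  qed
  ultimately have "conj_by t a = a" using vu u by auto
  then have ta: "t \<otimes> a = a \<otimes> t" using s t conj_by_eq_iff[of t a a] by simp
  have wc: "wprod w \<in> carrier G" using s by blast
  have "a \<otimes> (t \<otimes> wprod w) = t \<otimes> a \<otimes> wprod w" using ta s(1) t(1) wc by (simp add: m_assoc[symmetric])
  also have "\<dots> = t \<otimes> n" using s(1) t(1) wc by (simp add: n_def m_assoc)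
  also have "\<dots> = a \<otimes> (wprod w \<otimes> t)" unfolding nt using s(1) t(1) wc by (simp add: n_def m_assoc)
  finally have "a \<otimes> (a \<otimes> (t \<otimes> wprod w)) = a \<otimes> (a \<otimes> (wprod w \<otimes> t))" by simp
  then have "t \<otimes> wprod w = wprod w \<otimes> t"
    unfolding S_cancel[OF s(1) m_closed[OF S_closed[OF t(1)] wc]]
      S_cancel[OF s(1) m_closed[OF wc S_closed[OF t(1)]]] .
  moreover have "reduced w" using reduced_appendD(2)[of "[a]" w] Cons.prems(2) by simp
  ultimately show ?case using Cons.IH Cons.prems ta by auto
qed simp

section \<open>Infinite conjugacy classes in infinite irreducible systems\<close>

definition conj_class :: "'a \<Rightarrow> 'a set" where
  "conj_class s = (\<lambda>x. conj_by x s) ` carrier G"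

lemma conj_class_self: "s \<in> S \<Longrightarrow> s \<in> conj_class s"
  unfolding conj_class_def using conj_by_one[of s] by (metis S_closed image_eqI one_closed)

lemma conj_class_reflections: "s \<in> S \<Longrightarrow> t \<in> conj_class s \<Longrightarrow> t \<in> reflections"
  by (auto simp: conj_class_def)

lemma conj_class_conj_by: "s \<in> S \<Longrightarrow> t \<in> conj_class s \<Longrightarrow> x \<in> carrier G \<Longrightarrow> conj_by x t \<in> conj_class s"
  unfolding conj_class_def by (auto simp: conj_by_comp[symmetric])

text \<open>If the class \<open>C\<close> were finite, some \<open>n \<noteq> \<one>\<close> would
  centralise it and cross none of its walls. The letters of all such elements form a nonempty set
  that misses \<open>C\<close> and is closed under edges of the diagram, against
  irreducibility.\<close>

theorem infinite_conj_class:
  assumes irr: "irreducible_coxeter S m" and inf: "infinite (carrier G)" and s0: "s0 \<in> S"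
  shows "infinite (conj_class s0)"
proof
  define C where "C = conj_class s0"
  assume "finite (conj_class s0)"
  then have fin: "finite C" by (simp add: C_def)
  have C: "t \<in> carrier G" "t \<in> reflections" "\<And>x. x \<in> carrier G \<Longrightarrow> conj_by x t \<in> C" if "t \<in> C" for t
    using that s0 conj_class_reflections conj_class_conj_by by (auto simp: C_def)
  define J where "J = S - C"
  have J: "J \<subseteq> S" by (auto simp: J_def)
  define N where "N = {wprod w | w. set w \<subseteq> J \<and> (\<forall>t\<in>C. conj_by (wprod w) t = t)}"
  \<comment> \<open>The walls in \<open>C\<close> separating \<open>x\<close> from
    \<open>\<one>\<close> and the permutation of \<open>C\<close> induced by \<open>x\<close>: an
    infinite group must repeat a value, and the quotient of two elements with the same value is the
    desired \<open>n\<close>.\<close>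
  define F where "F x = ({t \<in> C. crosses x t}, restrict (conj_by x) C)" for x
  have "F ` carrier G \<subseteq> Pow C \<times> (C \<rightarrow>\<^sub>E C)" using C by (auto simp: F_def)
  then have "finite (F ` carrier G)" using fin by (meson finite_PiE finite_Pow_iff finite_SigmaI finite_subset)
  then have "\<not> inj_on F (carrier G)" using inf finite_image_iff by blast
  then obtain x y where xy: "x \<in> carrier G" "y \<in> carrier G" "x \<noteq> y" "F x = F y"
    by (auto simp: inj_on_def)
  have F1: "crosses x t = crosses y t" and F2: "conj_by x t = conj_by y t" if "t \<in> C" for t
    using xy(4) that unfolding F_def by (auto simp: set_eq_iff restrict_def fun_eq_iff split: if_splits)
  define n where "n = inv x \<otimes> y"
  have n: "n \<in> carrier G" "n \<noteq> \<one>" using xy by (auto simp: n_def) (metis inv_closed inv_equality inv_inv)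
  have n1: "conj_by n t = t" if "t \<in> C" for t
    using F2[of "conj_by (inv x) t"] C[OF that] xy by (simp add: n_def conj_by_comp)
  have n2: "\<not> crosses n t" if "t \<in> C" for t
  proof -
    have t: "t \<in> carrier G" "conj_by (inv x) t \<in> C" using C[OF that] xy by auto
    have "crosses n t \<longleftrightarrow> crosses (inv x) t \<noteq> crosses y (conj_by (inv x) t)"
      unfolding n_def using t xy by (intro crosses_mult) auto
    also have "crosses (inv x) t \<longleftrightarrow> crosses x (conj_by (inv x) t)"
      using t xy by (intro crosses_inv) auto
    finally show ?thesis using F1[OF t(2)] by simp
  qed
  obtain w where w: "reduced w" "wprod w = n" using reduced_exists n by blast
  have "set w \<subseteq> J"
  proof
    fix a assume a: "a \<in> set w"
    then obtain u v where uv: "w = u @ a # v" by (meson split_list)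
    have s: "a \<in> S" "set u \<subseteq> S" using a uv w by (auto simp: reduced_def)
    have "crosses n (conj_by (inv (wprod u)) a)" using reduced_crosses[of u a v] w uv by simp
    then have "conj_by (inv (wprod u)) a \<notin> C" using n2 by blast
    then show "a \<in> J" using C(3)[of a "inv (wprod u)"] s by (auto simp: J_def)
  qed
  then have nN: "n \<in> N" using n1 w unfolding N_def by blast
  define J' where "J' = {j. \<exists>w. reduced w \<and> wprod w \<in> N \<and> j \<in> set w}"
  have J'_sub: "J' \<subseteq> J"
    using reduced_parabolic[OF J] unfolding J'_def N_def by blast
  have "w \<noteq> []" using w n by auto
  then obtain j0 where j0: "j0 \<in> J'" using w nN unfolding J'_def by (metis (mono_tags, lifting) list.set_sel(1) mem_Collect_eq)
  have N_carrier: "x \<in> carrier G" if "x \<in> N" for x using that J unfolding N_def by auto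
  have reduced_J': "set v \<subseteq> J'" if "reduced v" "wprod v \<in> N" for v using that unfolding J'_def by blast
  \<comment> \<open>For \<open>t \<in> C\<close> the elements of \<open>N\<close> centralise
    \<open>t\<close> by definition. For \<open>t \<in> J - J'\<close>, conjugation by
    \<open>t\<close> preserves \<open>N\<close>, and no element of \<open>N\<close> crosses the wall
    of \<open>t\<close>; comparing parities in \<open>t n = n' t\<close> makes \<open>n'\<close>
    commute with \<open>t\<close>, so that \<open>n' = n\<close>.\<close>
  have comm: "t \<otimes> j = j \<otimes> t" if t: "t \<in> S - J'" and j: "j \<in> J'" for t j
  proof -
    obtain v where v: "reduced v" "wprod v \<in> N" "j \<in> set v" using j unfolding J'_def by blast
    have vc: "wprod v \<in> carrier G" using N_carrier v by blast
    show ?thesis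
    proof (cases "t \<in> C")
      case True
      then have "conj_by (wprod v) t = t" using v unfolding N_def by auto
      then have "t \<otimes> wprod v = wprod v \<otimes> t" using conj_by_eq_iff[OF vc, of t t] t by auto
      moreover have "set v \<subseteq> J" using reduced_J' v J'_sub by blast
      ultimately show ?thesis using commute_letters[OF J, of t v j] v t True by (auto simp: J_def)
    next
      case False
      then have tJ: "t \<in> J" "t \<in> S" "t \<notin> J'" using t by (auto simp: J_def)
      define n' where "n' = conj_by t (wprod v)"
      have n'c: "n' \<in> carrier G" using vc tJ by (simp add: n'_def)
      obtain w where w: "set w \<subseteq> J" "wprod w = wprod v" "\<And>c. c \<in> C \<Longrightarrow> conj_by (wprod v) c = c" 
        using v(2) unfolding N_def by auto
      have "wprod (t # w @ [t]) = n'" using w(1,2) tJ J vc by (auto simp: n'_def conj_by_def wprod_append m_assoc)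
      moreover have "conj_by n' c = c" if c: "c \<in> C" for c
      proof -
        have "n' = t \<otimes> (wprod v \<otimes> t)" using tJ vc by (simp add: n'_def conj_by_def m_assoc)
        then have "conj_by n' c = conj_by t (conj_by (wprod v) (conj_by t c))"
          using tJ vc C(1)[OF c] by (simp add: conj_by_comp)
        then show ?thesis using w(3)[OF C(3)[OF c, of t]] tJ C(1)[OF c] by simp
      qed
      moreover have "set (t # w @ [t]) \<subseteq> J" using w tJ by simp
      ultimately have n'N: "n' \<in> N" unfolding N_def by blast
      obtain w' where w': "reduced w'" "wprod w' = n'" using reduced_exists n'c by blast
      have J'S: "J' \<subseteq> S" using J'_sub J by blast
      have nocross: "\<not> crosses (wprod u) t" if "reduced u" "wprod u \<in> N" for u
      proof
        assume c: "crosses (wprod u) t"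
        have u: "set u \<subseteq> J'" using that by (rule reduced_J')
        obtain z where "set z \<subseteq> J'" "wprod z = t"
          using crosses_parabolic[OF J'S u _ c] tJ by blast
        then show False using S_parabolic[OF J'S] tJ by blast
      qed
      have tn: "t \<otimes> wprod v = n' \<otimes> t" using tJ vc by (simp add: n'_def conj_by_def m_assoc)
      have "crosses (t \<otimes> wprod v) t" using nocross[OF v(1,2)] tJ vc by (simp add: crosses_mult)
      then have "crosses n' t \<noteq> (conj_by n' t = t)" unfolding tn using n'c tJ by (simp add: crosses_mult)
      then have "conj_by n' t = t" using nocross[OF w'(1)] w'(2) n'N by simp
      then have "t \<otimes> n' = n' \<otimes> t" using conj_by_eq_iff[OF n'c, of t t] tJ by auto
      then have "t \<otimes> n' = t \<otimes> wprod v" using tn by simp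
      then have "t \<otimes> (t \<otimes> n') = t \<otimes> (t \<otimes> wprod v)" by simp
      then have "n' = wprod v" using tJ(2) vc n'c by (subst (asm) (1 2) S_cancel) auto
      then have "t \<otimes> wprod v = wprod v \<otimes> t" using tn by simp
      then show ?thesis using commute_letters[OF J'S tJ(2,3) reduced_J'[OF v(1,2)] v(1) _ v(3)] by blast
    qed
  qed
  have closed: "(a, b) \<in> (coxeter_diagram S m)\<^sup>* \<Longrightarrow> a \<in> J' \<Longrightarrow> b \<in> J'" for a b
  proof (induction rule: rtrancl_induct)
    case (step b c)
    then have bc: "b \<in> S" "c \<in> S" "3 \<le> m b c" by (auto simp: coxeter_diagram_def)
    then have "b \<otimes> c \<noteq> c \<otimes> b" using not_commute by blast
    then show ?case using comm[of c b] step bc by auto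
  qed
  have "s0 \<in> J'" using closed irr j0 s0 J'_sub J unfolding irreducible_coxeter_def by blast
  then show False using J'_sub conj_class_self[OF s0] by (auto simp: J_def C_def)
qed

end

section \<open>Conjugacy classes of involutions in hyperbolic groups\<close>

text \<open>Expanding the Gromov products removes the distinguished base point and leaves a form
  that applies directly to quadrilaterals with known sides.\<close>

lemma gromov_hyperbolic_four_point:
  assumes "gromov_hyperbolic X d" and sym: "\<And>x y. x \<in> X \<Longrightarrow> y \<in> X \<Longrightarrow> d x y = d y x"
  obtains \<delta> where "0 \<le> \<delta>" and
    "\<And>x y z w. x \<in> X \<Longrightarrow> y \<in> X \<Longrightarrow> z \<in> X \<Longrightarrow> w \<in> X \<Longrightarrow>
      d x y + d z w \<le> max (d x z + d y w) (d x w + d y z) + 2 * \<delta>"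
proof -
  obtain \<delta> where \<delta>: "0 \<le> \<delta>" and h: "\<And>w x y z. w \<in> X \<Longrightarrow> x \<in> X \<Longrightarrow> y \<in> X \<Longrightarrow> z \<in> X \<Longrightarrow>
      min (gromov_product d w x y) (gromov_product d w y z) - \<delta> \<le> gromov_product d w x z"
    using assms(1) unfolding gromov_hyperbolic_def by blast
  have "d x y + d z w \<le> max (d x z + d y w) (d x w + d y z) + 2 * \<delta>"
    if "x \<in> X" "y \<in> X" "z \<in> X" "w \<in> X" for x y z w
    using h[OF that(4,1,3,2)] sym[OF that(3,2)] unfolding gromov_product_def
    by (simp add: min_def max_def split: if_splits; argo)
  then show ?thesis using that \<delta> by blast
qed

locale hyperbolic_involutions = cayley +
  fixes \<delta> :: real and C :: "'a set"
  assumes finite_T: "finite T" and \<delta>_nonneg: "0 \<le> \<delta>"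
    and four_point: "\<And>x y z w. x \<in> carrier G \<Longrightarrow> y \<in> carrier G \<Longrightarrow> z \<in> carrier G \<Longrightarrow> w \<in> carrier G \<Longrightarrow>
      real (dist_T x y) + real (dist_T z w) \<le>
        max (real (dist_T x z) + real (dist_T y w)) (real (dist_T x w) + real (dist_T y z)) + 2 * \<delta>"
    and C_subset: "C \<subseteq> carrier G" and C_square: "\<And>t. t \<in> C \<Longrightarrow> t \<otimes> t = \<one>"
    and C_conj: "\<And>t x. t \<in> C \<Longrightarrow> x \<in> carrier G \<Longrightarrow> inv x \<otimes> t \<otimes> x \<in> C"
    and C_infinite: "infinite C" and not_virtually_cyclic: "\<not> virtually_cyclic G"
begin

lemma C_carrier [simp]: "t \<in> C \<Longrightarrow> t \<in> carrier G"
  using C_subset by blast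

lemma inv_C [simp]: "t \<in> C \<Longrightarrow> inv t = t"
  using C_square by (simp add: inv_equality)

lemma C_conj_self: "t \<in> C \<Longrightarrow> u \<in> C \<Longrightarrow> u \<otimes> t \<otimes> u \<in> C"
  using C_conj[of t u] by simp

section \<open>Gromov products at the identity and conjugates of involutions\<close>

definition nrm :: "'a \<Rightarrow> real" where "nrm x = real (dist_T \<one> x)"

definition gp :: "'a \<Rightarrow> 'a \<Rightarrow> real" where "gp x y = (nrm x + nrm y - nrm (inv x \<otimes> y)) / 2"

lemma dist_nrm: "x \<in> carrier G \<Longrightarrow> y \<in> carrier G \<Longrightarrow> real (dist_T x y) = nrm (inv x \<otimes> y)"
  unfolding nrm_def using dist_one[of x y] by presburger

lemma nrm_nonneg [simp]: "0 \<le> nrm x" by (simp add: nrm_def)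

lemma nrm_inv [simp]: "x \<in> carrier G \<Longrightarrow> nrm (inv x) = nrm x"
  unfolding nrm_def using dist_one[of x \<one>] dist_commute[of x \<one>] by simp

lemma nrm_mult_le: "x \<in> carrier G \<Longrightarrow> y \<in> carrier G \<Longrightarrow> nrm (x \<otimes> y) \<le> nrm x + nrm y"
  unfolding nrm_def using dist_triangle[of \<one> x "x \<otimes> y"] dist_left_mult[of x \<one> y] by simp

lemma gp_commute: 
  assumes "x \<in> carrier G" "y \<in> carrier G" shows "gp x y = gp y x"
proof -
  have "nrm (inv x \<otimes> y) = nrm (inv y \<otimes> x)"
    using nrm_inv[of "inv x \<otimes> y"] assms by (simp add: inv_mult_group)
  then show ?thesis by (simp add: gp_def)
qed

lemma gp_ineq:
  assumes "x \<in> carrier G" "y \<in> carrier G" "z \<in> carrier G"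
  shows "min (gp x y) (gp y z) - \<delta> \<le> gp x z"
proof -
  have "real (dist_T w \<one>) = nrm w" if "w \<in> carrier G" for w
    using that dist_commute[of \<one> w] by (simp add: nrm_def)
  moreover have "nrm (inv z \<otimes> y) = nrm (inv y \<otimes> z)"
    using assms dist_nrm[of y z] dist_nrm[of z y] dist_commute[of y z] by simp
  moreover have "nrm (inv z \<otimes> \<one>) = nrm z" "nrm (inv y \<otimes> \<one>) = nrm y" "nrm (inv x \<otimes> \<one>) = nrm x"
    using assms by simp_all
  ultimately show ?thesis
    using four_point[OF assms(1,3,2) one_closed] unfolding gp_def
    by (simp only: dist_nrm assms one_closed) (simp add: min_def max_def split: if_splits; argo)
qed

text \<open>The quadrilateral \<open>\<one>\<close>, \<open>b\<close>, \<open>t \<otimes> b\<close>,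
  \<open>t\<close> has sides \<open>nrm b\<close>, \<open>nrm t'\<close>, \<open>nrm b\<close>,
  \<open>nrm t\<close>, and since \<open>t\<close> is an involution both diagonals equal
  \<open>nrm (inv b \<otimes> t)\<close>. The last identity measures how far \<open>t'\<close>
  points towards \<open>inv b\<close> by its gain in length.\<close>

lemma conj_bounds:
  assumes t: "t \<in> C" and b: "b \<in> carrier G"
  defines "t' \<equiv> inv b \<otimes> t \<otimes> b"
  shows "nrm t > 2 * gp b t + \<delta> \<Longrightarrow> nrm t + 2 * nrm b - 4 * gp b t - 2 * \<delta> \<le> nrm t'"
    and "nrm t' \<le> max (nrm t + 2 * nrm b - 4 * gp b t) (2 * nrm b - nrm t) + 2 * \<delta>"
    and "gp t' (inv b) = (nrm t' - nrm t + 2 * gp b t) / 2"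
proof -
  have tc: "t \<in> carrier G" using t by simp
  define q where "q = nrm (inv b \<otimes> t)"
  have q: "q = nrm t + nrm b - 2 * gp b t" by (simp add: q_def gp_def field_simps)
  have tb: "t \<otimes> b \<in> carrier G" using tc b by simp
  have "inv b \<otimes> (t \<otimes> b) = t'" using tc b by (simp add: t'_def m_assoc)
  then have "real (dist_T b (t \<otimes> b)) = nrm t'" using dist_nrm[OF b tb] by simp
  moreover have "real (dist_T t (t \<otimes> b)) = nrm b"
    using dist_left_mult[OF tc one_closed b] tc by (simp add: nrm_def)
  moreover have "real (dist_T b t) = q" unfolding q_def by (rule dist_nrm[OF b tc])
  ultimately have d1: "real (dist_T \<one> b) = nrm b" "real (dist_T \<one> t) = nrm t" "real (dist_T b t) = q"
    "real (dist_T t (t \<otimes> b)) = nrm b" "real (dist_T b (t \<otimes> b)) = nrm t'"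
    by (auto simp: nrm_def)
  have "nrm (t \<otimes> b) = nrm (inv (t \<otimes> b))" using tb by simp
  also have "\<dots> = q" using t tc b by (simp add: inv_mult_group q_def)
  finally have d2: "real (dist_T \<one> (t \<otimes> b)) = q" by (simp add: nrm_def)
  have sy: "dist_T b \<one> = dist_T \<one> b" "dist_T (t \<otimes> b) t = dist_T t (t \<otimes> b)"
    "dist_T (t \<otimes> b) \<one> = dist_T \<one> (t \<otimes> b)" "dist_T t \<one> = dist_T \<one> t"
    by (rule dist_commute; use tc b tb in simp)+
  have 1: "2 * q \<le> max (2 * nrm b) (nrm t' + nrm t) + 2 * \<delta>"
    using four_point[OF b tc one_closed tb] unfolding sy d1 d2 by linarith
  have 2: "nrm t' + nrm t \<le> max (2 * nrm b) (2 * q) + 2 * \<delta>"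
    using four_point[OF b tb one_closed tc] unfolding sy d1 d2 by linarith
  show "nrm t > 2 * gp b t + \<delta> \<Longrightarrow> nrm t + 2 * nrm b - 4 * gp b t - 2 * \<delta> \<le> nrm t'"
    using 1 q by (simp add: max_def split: if_splits)
  show "nrm t' \<le> max (nrm t + 2 * nrm b - 4 * gp b t) (2 * nrm b - nrm t) + 2 * \<delta>"
    using 2 q by (simp add: max_def split: if_splits)
  have "t' \<in> C" using C_conj t b by (simp add: t'_def)
  then have "inv t' \<otimes> inv b = inv b \<otimes> t" using tc b by (simp add: t'_def m_assoc)
  then show "gp t' (inv b) = (nrm t' - nrm t + 2 * gp b t) / 2"
    using b q by (simp add: gp_def[of t'] q_def[symmetric])
qed

lemma conj_mult: 
  "x \<in> carrier G \<Longrightarrow> y \<in> carrier G \<Longrightarrow> t \<in> carrier G \<Longrightarrow>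
    inv (x \<otimes> y) \<otimes> t \<otimes> (x \<otimes> y) = inv y \<otimes> (inv x \<otimes> t \<otimes> x) \<otimes> y"
  by (simp add: inv_mult_group m_assoc)

lemma conj_inj:
  assumes "x \<in> carrier G" "t \<in> carrier G" "u \<in> carrier G" "inv x \<otimes> t \<otimes> x = inv x \<otimes> u \<otimes> x"
  shows "t = u"
proof -
  have "v = x \<otimes> (inv x \<otimes> v \<otimes> x) \<otimes> inv x" if "v \<in> carrier G" for v
    using that assms(1) by (simp add: m_assoc) (simp add: m_assoc[symmetric])
  then show ?thesis using assms by metis
qed

lemma geodesic_point:
  assumes "t \<in> carrier G" "real k \<le> nrm t"
  obtains b where "b \<in> carrier G" "nrm b = k" "gp b t = k"
proof -
  obtain b where b: "b \<in> carrier G" "dist_T \<one> b = k" "dist_T b t = dist_T \<one> t - k"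
    using dist_split[of \<one> t k] assms by (auto simp: nrm_def)
  have "nrm (inv b \<otimes> t) = nrm t - k"
    using dist_nrm[of b t] b assms by (simp add: nrm_def of_nat_diff)
  then show ?thesis using that b by (simp add: gp_def nrm_def)
qed

text \<open>
  Minimising the largest displacement of a large finite part of the class: if the two longest
  elements pointed in the same direction, a small step in that direction would shorten both.
\<close>

lemma two_directions:
  obtains k :: nat where "\<And>L. \<exists>t\<in>C. \<exists>u\<in>C. L \<le> nrm t \<and> L \<le> nrm u \<and> gp t u < k"
proof -
  \<comment> \<open>Conjugating an element of \<open>F'\<close> by \<open>b\<close>, with Gromov
    product at least \<open>k - \<delta>\<close>, changes its length by at most \<open>2 * k - 4 *
    (k - \<delta>) + 2 * \<delta> = 6 * \<delta> - 2 * k\<close>, which must be negative.\<close>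
  define k where "k = nat \<lceil>3 * \<delta>\<rceil> + 1"
  have k: "3 * \<delta> < k" unfolding k_def by linarith
  have "\<exists>t\<in>C. \<exists>u\<in>C. L \<le> nrm t \<and> L \<le> nrm u \<and> gp t u < k" for L
  proof -
    \<comment> \<open>The first bound keeps \<open>u\<close>, which may be \<open>2 * k\<close>
      shorter than the maximum, longer than \<open>L\<close>; the second disposes of the other
      alternative in \<open>conj_bounds(2)\<close>.\<close>
    define M0 where "M0 = nat \<lceil>max (L + 2 * k) (4 * k + 2 * \<delta>)\<rceil>"
    have M0: "L + 2 * k \<le> M0" "4 * k + 2 * \<delta> \<le> M0" unfolding M0_def by linarith+
    define Ball where "Ball = {x \<in> carrier G. dist_T \<one> x \<le> M0}"
    have finB: "finite Ball" unfolding Ball_def by (rule finite_ball[OF finite_T])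
    \<comment> \<open>One element more than the ball can hold: no conjugate of \<open>F\<close> fits
      into the ball, so the minimised maximum still exceeds \<open>M0\<close>.\<close>
    obtain F where F: "F \<subseteq> C" "finite F" "card F = Suc (card Ball)"
      using infinite_arbitrarily_large[OF C_infinite] by metis
    define f where "f z = Max ((\<lambda>t. dist_T \<one> (inv z \<otimes> t \<otimes> z)) ` F)" for z
    have Fne: "F \<noteq> {}" using F by auto
    obtain z where z: "z \<in> carrier G" "\<And>y. y \<in> carrier G \<Longrightarrow> f z \<le> f y"
      using ex_has_least_nat[of "\<lambda>z. z \<in> carrier G" \<one> f] by auto
    define F' where "F' = (\<lambda>t. inv z \<otimes> t \<otimes> z) ` F"
    have F'C: "F' \<subseteq> C" using F C_conj z by (auto simp: F'_def)
    have "inj_on (\<lambda>t. inv z \<otimes> t \<otimes> z) F"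
      using conj_inj[OF z(1)] F C_subset by (intro inj_onI) blast
    then have cardF': "card F' = Suc (card Ball)" using F by (simp add: F'_def card_image)
    have attain: "\<exists>t\<in>F'. f z \<le> dist_T \<one> (inv b \<otimes> t \<otimes> b)" if b: "b \<in> carrier G" for b
    proof -
      have "f (z \<otimes> b) \<in> (\<lambda>t. dist_T \<one> (inv (z \<otimes> b) \<otimes> t \<otimes> (z \<otimes> b))) ` F"
        unfolding f_def using F(2) Fne by (intro Max_in) auto
      then obtain t where t: "t \<in> F" "f (z \<otimes> b) = dist_T \<one> (inv (z \<otimes> b) \<otimes> t \<otimes> (z \<otimes> b))" by blast
      moreover have "t \<in> carrier G" using t F by auto
      ultimately show ?thesis
        using z b conj_mult[OF z(1) b, of t] unfolding F'_def by (metis image_eqI m_closed)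
    qed
    have upper: "nrm t \<le> f z" if "t \<in> F'" for t
      using that F unfolding nrm_def f_def F'_def by (auto intro!: Max_ge)
    obtain t where t: "t \<in> F'" "f z \<le> dist_T \<one> t"
      using attain[of \<one>] F'C C_subset by auto
    have tM: "nrm t = f z" using t upper[of t] by (simp add: nrm_def)
    have "\<not> F' \<subseteq> Ball" using card_mono[OF finB, of F'] cardF' by auto
    then obtain v where v: "v \<in> F'" "v \<notin> Ball" by blast
    moreover have "v \<in> carrier G" using v(1) F'C C_subset by blast
    ultimately have "M0 < dist_T \<one> v" by (simp add: Ball_def)
    then have M: "M0 < f z" using upper[OF v(1)] by (simp add: nrm_def)
    have tc: "t \<in> C" using t F'C by blast
    obtain b where b: "b \<in> carrier G" "nrm b = k" "gp b t = k"
      using geodesic_point[of t k] tc tM M M0 \<delta>_nonneg by auto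
    obtain u where u: "u \<in> F'" "f z \<le> dist_T \<one> (inv b \<otimes> u \<otimes> b)" using attain[OF b(1)] by blast
    have uC: "u \<in> C" "u \<in> carrier G" using u F'C C_subset by auto
    have "nrm (inv b \<otimes> u \<otimes> b) \<le> nrm b + nrm u + nrm b"
      using nrm_mult_le[of "inv b \<otimes> u" b] nrm_mult_le[of "inv b" u] b uC by simp
    then have uM: "f z - 2 * k \<le> nrm u" using u(2) b by (simp add: nrm_def)
    have "gp t u < k"
    proof (rule ccontr)
      assume "\<not> gp t u < k"
      then have "k - \<delta> \<le> gp b u" using gp_ineq[of b t u] b tc uC by simp
      then have "nrm (inv b \<otimes> u \<otimes> b) < f z"
        using conj_bounds(2)[OF uC(1) b(1)] upper[OF u(1)] uM k M M0 b(2) by (auto simp: max_def split: if_splits)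
      then show False using u(2) by (simp add: nrm_def)
    qed
    moreover have "L \<le> nrm t" "L \<le> nrm u" using tM uM M M0 by linarith+
    ultimately show ?thesis using tc uC by blast
  qed
  then show ?thesis using that by blast
qed

text \<open>
  Otherwise left multiplication by \<open>t\<close> and \<open>u\<close> would bring every element into a ball, and the
  cyclic group generated by \<open>t u\<close> would have finite index.
\<close>

lemma far_from_dihedral:
  assumes t: "t \<in> C" and u: "u \<in> C"
  shows "\<exists>x\<in>carrier G. R < nrm x \<and> nrm x \<le> nrm (t \<otimes> x) \<and> nrm x \<le> nrm (u \<otimes> x)"
proof (rule ccontr)
  assume neg: "\<not> ?thesis"
  define g where "g = t \<otimes> u"
  have tc: "t \<in> carrier G" "u \<in> carrier G" using t u by auto
  then have g: "g \<in> carrier G" by (simp add: g_def)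
  have ginv: "inv g = u \<otimes> t" unfolding g_def inv_mult_group[OF tc] inv_C[OF t] inv_C[OF u] ..
  define H where "H = carrier (subgroup_generated G {g})"
  have H: "H = range (\<lambda>n::int. g [^] n)"
    unfolding H_def using carrier_subgroup_generated_by_singleton[OF g] by simp
  have Hsub: "subgroup H G" unfolding H_def by (rule subgroup_subgroup_generated)
  then have Hc: "H \<subseteq> carrier G" by (rule subgroup.subset)
  \<comment> \<open>\<open>t\<close> inverts \<open>g = t u\<close>. Hence the powers of
    \<open>g\<close> and their products with \<open>t\<close> exhaust the group generated by
    \<open>t\<close> and \<open>u\<close>.\<close>
  have tg: "t \<otimes> g [^] n = g [^] (- n) \<otimes> t" for n :: int
  proof -
    have "t \<otimes> g \<otimes> t = t \<otimes> t \<otimes> u \<otimes> t" using tc by (simp only: g_def m_assoc m_closed)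
    then have 1: "t \<otimes> g \<otimes> t = inv g" unfolding ginv C_square[OF t] using tc by simp
    define h where "h = (\<lambda>x. t \<otimes> x \<otimes> t)"
    have "h \<in> hom G G"
    proof (rule homI)
      fix x y assume "x \<in> carrier G" "y \<in> carrier G"
      then have "t \<otimes> x \<otimes> t \<otimes> (t \<otimes> y \<otimes> t) = t \<otimes> x \<otimes> (t \<otimes> t) \<otimes> y \<otimes> t"
        using tc(1) by (simp only: m_assoc m_closed)
      then show "h (x \<otimes> y) = h x \<otimes> h y"
        using \<open>x \<in> carrier G\<close> \<open>y \<in> carrier G\<close> tc(1) C_square[OF t] by (simp add: h_def m_assoc)
    qed (use tc in \<open>simp add: h_def\<close>)
    then have "h (g [^] n) = h g [^] n"
      using g by (intro hom_int_pow group_axioms)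
    also have "h g = inv g" using 1 by (simp add: h_def)
    also have "inv g [^] n = g [^] (- n)" using g by (simp add: int_pow_neg int_pow_inv)
    finally have "t \<otimes> g [^] n \<otimes> t \<otimes> t = g [^] (- n) \<otimes> t" by (simp add: h_def)
    then show ?thesis using tc g C_square[OF t] by (simp add: m_assoc)
  qed
  define D where "D = H \<union> (\<lambda>h. h \<otimes> t) ` H"
  have tD: "t \<otimes> d \<in> D" if d: "d \<in> D" for d
  proof -
    consider n :: int where "d = g [^] n" | n :: int where "d = g [^] n \<otimes> t" using d unfolding D_def H by auto
    then show ?thesis
    proof cases
      case 1 then show ?thesis using tg[of n] by (auto simp: D_def H)
    next
      case 2
      then have "t \<otimes> d = (t \<otimes> g [^] n) \<otimes> t" using tc g by (simp add: m_assoc)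
      also have "\<dots> = g [^] (-n)" unfolding tg using tc g C_square[OF t] by (simp add: m_assoc)
      finally show ?thesis by (auto simp: D_def H)
    qed
  qed
  have gD: "inv g \<otimes> d \<in> D" if "d \<in> D" for d
  proof -
    have "inv g \<in> H" using Hsub g unfolding H by (metis int_pow_1 int_pow_neg rangeI)
    then have 1: "inv g \<otimes> h \<in> H" if "h \<in> H" for h using Hsub that by (simp add: subgroup.m_closed)
    show ?thesis using \<open>d \<in> D\<close> unfolding D_def
    proof
      assume "d \<in> (\<lambda>h. h \<otimes> t) ` H"
      then obtain h where h: "h \<in> H" "d = h \<otimes> t" by blast
      then have "inv g \<otimes> d = (inv g \<otimes> h) \<otimes> t" using Hc tc g by (auto simp: m_assoc subset_iff)
      then show "inv g \<otimes> d \<in> H \<union> (\<lambda>h. h \<otimes> t) ` H" using 1[OF h(1)] by blast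
    qed (use 1 in blast)
  qed
  have Dc: "D \<subseteq> carrier G" using Hc tc by (auto simp: D_def)
  have uD: "u \<otimes> d \<in> D" if "d \<in> D" for d
  proof -
    have dc: "d \<in> carrier G" using that Dc by blast
    have "u \<otimes> d = inv g \<otimes> (t \<otimes> d)"
    proof -
      have "inv g \<otimes> (t \<otimes> d) = u \<otimes> (t \<otimes> t) \<otimes> d" unfolding ginv using tc dc by (simp only: m_assoc m_closed)
      then show ?thesis using C_square[OF t] tc dc by simp
    qed
    then show ?thesis using gD tD that by simp
  qed
  define B where "B = {x \<in> carrier G. nrm x \<le> R}"
  have "B \<subseteq> {x \<in> carrier G. dist_T \<one> x \<le> nat \<lceil>R\<rceil>}" unfolding B_def nrm_def by auto linarith
  then have finB: "finite B" using finite_ball[OF finite_T] finite_subset by blast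
  have one: "\<one> \<in> D" using Hsub by (simp add: D_def subgroup.one_closed)
  have "y \<in> carrier G \<Longrightarrow> \<exists>d\<in>D. \<exists>x\<in>B. y = d \<otimes> x" for y
  proof (induction "dist_T \<one> y" arbitrary: y rule: less_induct)
    case less
    show ?case
    proof (cases "nrm y \<le> R")
      case True
      then show ?thesis using less.prems one by (intro bexI[of _ \<one>] bexI[of _ y]) (auto simp: B_def)
    next
      case False
      then consider "nrm (t \<otimes> y) < nrm y" | "nrm (u \<otimes> y) < nrm y" using neg less.prems by force
      then show ?thesis
      proof cases
        case 1
        then obtain d x where dx: "d \<in> D" "x \<in> B" "t \<otimes> y = d \<otimes> x"
          using less.hyps[of "t \<otimes> y"] less.prems tc by (auto simp: nrm_def)
        have "y = t \<otimes> (t \<otimes> y)" using C_square[OF t] tc less.prems by (simp add: m_assoc[symmetric])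
        also have "\<dots> = (t \<otimes> d) \<otimes> x" unfolding dx(3) using dx Dc tc by (auto simp: m_assoc B_def)
        finally show ?thesis using tD dx by blast
      next
        case 2
        then obtain d x where dx: "d \<in> D" "x \<in> B" "u \<otimes> y = d \<otimes> x"
          using less.hyps[of "u \<otimes> y"] less.prems tc by (auto simp: nrm_def)
        have "y = u \<otimes> (u \<otimes> y)" using C_square[OF u] tc less.prems by (simp add: m_assoc[symmetric])
        also have "\<dots> = (u \<otimes> d) \<otimes> x" unfolding dx(3) using dx Dc tc by (auto simp: m_assoc B_def)
        finally show ?thesis using uD dx by blast
      qed
    qed
  qed
  then have cover: "\<exists>d\<in>D. \<exists>x\<in>B. y = d \<otimes> x" if "y \<in> carrier G" for y using that by blast
  have "rcosets\<^bsub>G\<^esub> H \<subseteq> (\<lambda>x. H #> x) ` (B \<union> (\<lambda>x. t \<otimes> x) ` B)"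
  proof
    fix Y assume "Y \<in> rcosets\<^bsub>G\<^esub> H"
    then obtain y where y: "y \<in> carrier G" "Y = H #> y" unfolding RCOSETS_def by blast
    obtain d x where dx: "d \<in> D" "x \<in> B" "y = d \<otimes> x" using cover y by blast
    have xc: "x \<in> carrier G" using dx by (simp add: B_def)
    have shift: "H #> (h \<otimes> z) = H #> z" if "h \<in> H" "z \<in> carrier G" for h z
      using that Hsub Hc coset_mult_assoc[of H h z] coset_join2[of h H] by auto
    show "Y \<in> (\<lambda>x. H #> x) ` (B \<union> (\<lambda>x. t \<otimes> x) ` B)"
      using dx(1) unfolding D_def
    proof
      assume "d \<in> H"
      then show ?thesis using shift[of d x] xc dx y by blast
    next
      assume "d \<in> (\<lambda>h. h \<otimes> t) ` H"
      then obtain h where "h \<in> H" "d = h \<otimes> t" by blast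
      then have "y = h \<otimes> (t \<otimes> x)" using dx xc tc Hc by (auto simp: m_assoc subset_iff)
      then show ?thesis using shift[of h "t \<otimes> x"] xc tc dx y \<open>h \<in> H\<close> by auto
    qed
  qed
  then have "finite (rcosets\<^bsub>G\<^esub> H)" using finB finite_subset by blast
  moreover have "cyclic_group (subgroup_generated G H)"
  proof -
    have carr: "carrier (subgroup_generated G H) = H"
      by (rule subgroup.carrier_subgroup_generated_subgroup[OF Hsub])
    have "g \<in> H" unfolding H using g by (metis int_pow_1 rangeI)
    then have "g [^]\<^bsub>subgroup_generated G H\<^esub> n = g [^] n" for n :: int
      by (simp add: int_pow_subgroup_generated carr)
    then have "carrier (subgroup_generated G H) = range (\<lambda>n::int. g [^]\<^bsub>subgroup_generated G H\<^esub> n)"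
      unfolding carr using H by simp
    then show ?thesis
      unfolding group.cyclic_group[OF group_subgroup_generated] using \<open>g \<in> H\<close> carr by blast
  qed
  ultimately show False using not_virtually_cyclic Hsub unfolding virtually_cyclic_def by blast
qed

text \<open>Two directions are those of the diverging \<open>t\<close> and \<open>u\<close>; the
  third is that of a long \<open>x\<close> shortened by neither, which means
  \<open>gp x t \<le> nrm t / 2\<close> and likewise for \<open>u\<close>. The elements are
  conjugates that start like \<open>t\<close>, \<open>u\<close> and \<open>x\<close>.\<close>

lemma three_directions:
  obtains c :: real and b :: "nat \<Rightarrow> 'a" where "\<And>i. i < 3 \<Longrightarrow> b i \<in> C"
    and "\<And>i. i < 3 \<Longrightarrow> 2 * c + 3 * \<delta> < nrm (b i)"
    and "\<And>i j. i < 3 \<Longrightarrow> j < 3 \<Longrightarrow> i \<noteq> j \<Longrightarrow> gp (b i) (b j) \<le> c" and "0 \<le> c"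
proof -
  obtain k :: nat where k: "\<And>L. \<exists>t\<in>C. \<exists>u\<in>C. L \<le> nrm t \<and> L \<le> nrm u \<and> gp t u < k"
    using two_directions by blast
  obtain t u where t: "t \<in> C" "6 * k + 12 * \<delta> + 1 \<le> nrm t" and u: "u \<in> C" "6 * k + 12 * \<delta> + 1 \<le> nrm u"
    and tu: "gp t u < k" using k[of "6 * k + 12 * \<delta> + 1"] by blast
  note carr = C_carrier[OF t(1)] C_carrier[OF u(1)]
  have ut: "gp u t < k" using tu gp_commute[OF carr] by simp
  define A where "A = max (nrm t) (nrm u)"
  have A0: "0 \<le> A" using nrm_nonneg[of t] by (simp add: A_def max_def)
  define c where "c = A / 2 + 2 * \<delta> + k"
  obtain x where x: "x \<in> carrier G" "A + 10 * k + 20 * \<delta> < nrm x"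
    "nrm x \<le> nrm (t \<otimes> x)" "nrm x \<le> nrm (u \<otimes> x)"
    using far_from_dihedral[OF t(1) u(1)] by blast
  \<comment> \<open>\<open>t\<close> and \<open>u\<close> themselves are too short: the third
    direction is separated from theirs only up to about \<open>A / 2\<close>, so lengths above
    \<open>2 * c \<ge> A\<close> are required.\<close>
  define h1 where "h1 = t \<otimes> u \<otimes> t"
  define h2 where "h2 = u \<otimes> t \<otimes> u"
  have h1: "h1 \<in> C" "nrm u + 2 * nrm t - 4 * k - 2 * \<delta> \<le> nrm h1" "nrm t - k - \<delta> \<le> gp h1 t"
    using conj_bounds(1,3)[OF u(1) carr(1)] C_conj_self[OF u(1) t(1)] t u tu \<delta>_nonneg by (simp_all add: h1_def)
  have h2: "h2 \<in> C" "nrm t + 2 * nrm u - 4 * k - 2 * \<delta> \<le> nrm h2" "nrm u - k - \<delta> \<le> gp h2 u"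
    using conj_bounds(1,3)[OF t(1) carr(2)] C_conj_self[OF t(1) u(1)] t u ut \<delta>_nonneg by (simp_all add: h2_def)
  have xi: "inv x \<in> carrier G" using x by simp
  \<comment> \<open>\<open>inv x\<close> is aligned with at most one of \<open>t\<close> and
    \<open>u\<close>; conjugating the other one by \<open>inv x\<close> gains length, so the result
    points towards \<open>x\<close>.\<close>
  have "min (gp t (inv x)) (gp (inv x) u) - \<delta> < k"
    using gp_ineq[OF carr(1) xi carr(2)] tu by simp
  then consider "gp (inv x) t < k + \<delta>" | "gp (inv x) u < k + \<delta>"
    using gp_commute[OF carr(1) xi] by (auto simp: min_def split: if_splits)
  then obtain f where f: "f \<in> C" "6 * k + 12 * \<delta> + 1 \<le> nrm f" "gp (inv x) f < k + \<delta>"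
    using t u by metis
  define h3 where "h3 = x \<otimes> f \<otimes> inv x"
  have h3: "h3 \<in> C" "nrm f + 2 * nrm x - 4 * k - 6 * \<delta> \<le> nrm h3" "nrm x - k - 2 * \<delta> \<le> gp h3 x"
    using conj_bounds(1,3)[OF f(1) xi] C_conj[OF f(1) xi] f x(1) \<delta>_nonneg by (simp_all add: h3_def)
  note hc = C_carrier[OF h1(1)] C_carrier[OF h2(1)] C_carrier[OF h3(1)]
  have h12: "gp h1 h2 \<le> k + 2 * \<delta>"
    using gp_ineq[OF carr(1) hc(1) hc(2)] gp_ineq[OF carr(1) hc(2) carr(2)] h1(3) h2(3) t(2) u(2) tu \<delta>_nonneg
      gp_commute[OF carr(1) hc(1)] by (auto simp: min_def split: if_splits)
  have side: "gp h3 h \<le> nrm v / 2 + 2 * \<delta>"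
    if v: "v \<in> C" "6 * k + 12 * \<delta> + 1 \<le> nrm v" "nrm v \<le> A" "nrm x \<le> nrm (v \<otimes> x)"
      and h: "h \<in> C" "nrm v - k - \<delta> \<le> gp h v" for h v
  proof -
    note vc = C_carrier[OF v(1)] and hc' = C_carrier[OF h(1)]
    have "gp x v = gp v x" using gp_commute[OF x(1) vc] .
    also have "\<dots> \<le> nrm v / 2" using v(1,4) by (simp add: gp_def)
    finally have "gp x h \<le> nrm v / 2 + \<delta>"
      using gp_ineq[OF x(1) hc' vc] h(2) v(2) \<delta>_nonneg by (auto simp: min_def split: if_splits)
    then show ?thesis
      using gp_ineq[OF x(1) hc(3) hc'] h3(3) gp_commute[OF x(1) hc(3)] x(2) v(3) \<delta>_nonneg A0
      by (auto simp: min_def split: if_splits)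
  qed
  have tuA: "nrm t \<le> A" "nrm u \<le> A" by (simp_all add: A_def)
  have h31: "gp h3 h1 \<le> c" and h32: "gp h3 h2 \<le> c"
    using side[OF t tuA(1) x(3) h1(1,3)] side[OF u tuA(2) x(4) h2(1,3)] tuA by (simp_all add: c_def)
  have A: "A + (6 * k + 12 * \<delta> + 1) \<le> nrm t + nrm u" using t(2) u(2) by (simp add: A_def max_def)
  define b where "b i = (if i = 0 then h1 else if i = 1 then h2 else h3)" for i :: nat
  have b3: "i = 0 \<or> i = 1 \<or> i = 2" if "i < 3" for i :: nat using that by auto
  show ?thesis
  proof (rule that[of b c])
    show "b i \<in> C" for i using h1 h2 h3 by (simp add: b_def)
    show "2 * c + 3 * \<delta> < nrm (b i)" for i
      using h1(2) h2(2) h3(2) A A0 x(2) t(2) u(2) f(2) \<delta>_nonneg by (auto simp: b_def c_def)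
    show "gp (b i) (b j) \<le> c" if "i < 3" "j < 3" "i \<noteq> j" for i j
      using b3[OF that(1)] b3[OF that(2)] that(3) h12 h31 h32 A0 \<delta>_nonneg
        gp_commute[OF hc(1,2)] gp_commute[OF hc(1,3)] gp_commute[OF hc(2,3)]
      by (auto simp: b_def c_def)
    show "0 \<le> c" using A0 \<delta>_nonneg by (simp add: c_def)
  qed
qed

text \<open>
  Since \<open>b\<^sub>i t b\<^sub>i\<close> points in the direction of \<open>b\<^sub>i\<close>, it determines \<open>i\<close> and \<open>t\<close>. Hence the sum of \<open>g\<^sup>2\<close> over
  children is at most the sum over all long elements, which themselves are counted at least twice as parents.
\<close>

theorem conj_class_inequality:
  obtains t0 and b :: "nat \<Rightarrow> 'a" where "t0 \<in> C" and "\<And>i. i < 3 \<Longrightarrow> b i \<in> C"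
    and "\<And>(g :: 'a \<Rightarrow> real) A. finite A \<Longrightarrow> {t \<in> C. g t \<noteq> 0} \<subseteq> A \<Longrightarrow> A \<subseteq> C \<Longrightarrow>
      (g t0)\<^sup>2 \<le> 6 * (\<Sum>i<3. \<Sum>t\<in>A. (g t - g (inv (b i) \<otimes> t \<otimes> b i))\<^sup>2)"
proof -
  obtain c :: real and b :: "nat \<Rightarrow> 'a" where bC: "\<And>i. i < 3 \<Longrightarrow> b i \<in> C"
    and bl: "\<And>i. i < 3 \<Longrightarrow> 2 * c + 3 * \<delta> < nrm (b i)"
    and bg: "\<And>i j. i < 3 \<Longrightarrow> j < 3 \<Longrightarrow> i \<noteq> j \<Longrightarrow> gp (b i) (b j) \<le> c" and c: "0 \<le> c"
    by (rule three_directions) blast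
  \<comment> \<open>The threshold is exactly what \<open>conj_bounds(1)\<close> asks for when
    \<open>gp (b i) t \<le> c + \<delta>\<close>; the same bound on \<open>nrm (b i)\<close> makes
    the children longer than \<open>t\<close> and aligned with \<open>b i\<close> beyond
    \<open>c + \<delta>\<close>.\<close>
  define N where "N = {t \<in> C. 2 * c + 3 * \<delta> < nrm t}"
  define I where "I t = {i. i < 3 \<and> gp (b i) t \<le> c + \<delta>}" for t
  define ch where "ch t i = inv (b i) \<otimes> t \<otimes> b i" for t i
  have finI: "finite (I t)" for t by (simp add: I_def)
  have card: "2 \<le> card (I t)" if "t \<in> C" for t
  proof -
    have tc: "t \<in> carrier G" using that by simp
    have *: "i = j" if "i < 3" "j < 3" "i \<notin> I t" "j \<notin> I t" for i j
    proof (rule ccontr)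
      assume "i \<noteq> j"
      have "min (gp (b i) t) (gp t (b j)) - \<delta> \<le> gp (b i) (b j)"
        using gp_ineq bC that tc by simp
      moreover have "gp t (b j) = gp (b j) t" using gp_commute bC that tc by simp
      ultimately show False using that bg[OF that(1,2) \<open>i \<noteq> j\<close>] by (auto simp: I_def min_def split: if_splits)
    qed
    have "card ({..<3} - I t) \<le> 1"
      by (rule card_le_Suc0_iff_eq[THEN iffD2, folded One_nat_def]) (use * in auto)
    moreover have "card ({..<3} - I t) = 3 - card (I t)"
      by (subst card_Diff_subset) (auto simp: I_def)
    ultimately show ?thesis by linarith
  qed
  have child: "ch t i \<in> N \<and> c + \<delta> < gp (ch t i) (b i)" if t: "t \<in> N" and i: "i \<in> I t" for t i
  proof -
    have tC: "t \<in> C" and tl: "2 * c + 3 * \<delta> < nrm t" using t by (auto simp: N_def)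
    have i3: "i < 3" "gp (b i) t \<le> c + \<delta>" using i by (auto simp: I_def)
    note bi = bC[OF i3(1)] and bic = C_carrier[OF bC[OF i3(1)]]
    have 1: "nrm t + 2 * nrm (b i) - 4 * gp (b i) t - 2 * \<delta> \<le> nrm (ch t i)"
      unfolding ch_def using tl i3 \<delta>_nonneg by (intro conj_bounds(1)[OF tC bic]) linarith
    have "gp (ch t i) (b i) = (nrm (ch t i) - nrm t + 2 * gp (b i) t) / 2"
      using conj_bounds(3)[OF tC bic] inv_C[OF bi] by (simp add: ch_def)
    then show ?thesis
      using 1 bl[OF i3(1)] i3 tl \<delta>_nonneg C_conj[OF tC bic] by (auto simp: N_def ch_def)
  qed
  have inj: "inj_on (\<lambda>(t, i). ch t i) (SIGMA t:N. I t)"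
  proof (rule inj_onI, clarify)
    fix t i u j assume t: "t \<in> N" "i \<in> I t" and u: "u \<in> N" "j \<in> I u" and eq: "ch t i = ch u j"
    have i3: "i < 3" "j < 3" using t u by (auto simp: I_def)
    have cc: "ch t i \<in> carrier G" "b i \<in> carrier G" "b j \<in> carrier G" using child[OF t] bC i3 by (auto simp: N_def)
    have "min (gp (b i) (ch t i)) (gp (ch t i) (b j)) - \<delta> \<le> gp (b i) (b j)"
      using gp_ineq cc by blast
    then have "c < gp (b i) (b j)"
      using child[OF t] child[OF u] eq gp_commute[OF cc(1,2)] by (auto simp: min_def split: if_splits)
    then have "i = j" using bg i3 by force
    moreover have "t \<in> carrier G" "u \<in> carrier G" using t u by (auto simp: N_def)
    ultimately show "t = u \<and> i = j" using conj_inj[OF cc(2)] eq by (auto simp: ch_def)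
  qed
  have ineq: "(g (b 0))\<^sup>2 \<le> 6 * (\<Sum>i<3. \<Sum>t\<in>A. (g t - g (inv (b i) \<otimes> t \<otimes> b i))\<^sup>2)"
    if A: "finite A" "{t \<in> C. g t \<noteq> 0} \<subseteq> A" "A \<subseteq> C" for g :: "'a \<Rightarrow> real" and A
  proof -
    define B where "B = A \<inter> N"
    have finB: "finite B" using A by (simp add: B_def)
    define E where "E = (\<Sum>t\<in>B. (g t)\<^sup>2)"
    define D where "D = (\<Sum>i<3. \<Sum>t\<in>A. (g t - g (ch t i))\<^sup>2)"
    have "2 * E = (\<Sum>t\<in>B. 2 * (g t)\<^sup>2)" by (simp add: E_def sum_distrib_left)
    also have "\<dots> \<le> (\<Sum>t\<in>B. \<Sum>i\<in>I t. (g t)\<^sup>2)"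
    proof (rule sum_mono)
      fix t assume "t \<in> B"
      then have "2 \<le> card (I t)" using card A by (auto simp: B_def)
      then show "2 * (g t)\<^sup>2 \<le> (\<Sum>i\<in>I t. (g t)\<^sup>2)" by (simp add: mult_right_mono)
    qed
    \<comment> \<open>Any coefficient strictly between \<open>1\<close> and \<open>2\<close> in
      front of the children's term would serve, as it has to be beaten by the two children of each
      parent. With \<open>3 / 2\<close> one gets \<open>2 * E \<le> 3 * D + 3 / 2 * E\<close>, hence
      the constant \<open>6\<close>.\<close>
    also have "\<dots> \<le> (\<Sum>t\<in>B. \<Sum>i\<in>I t. 3 * (g t - g (ch t i))\<^sup>2 + 3 / 2 * (g (ch t i))\<^sup>2)"
    proof (intro sum_mono)
      fix t i
      have "0 \<le> (2 * (g t - g (ch t i)) - g (ch t i))\<^sup>2" by simp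
      then show "(g t)\<^sup>2 \<le> 3 * (g t - g (ch t i))\<^sup>2 + 3 / 2 * (g (ch t i))\<^sup>2"
        by (simp add: power2_eq_square algebra_simps)
    qed
    also have "\<dots> = 3 * (\<Sum>t\<in>B. \<Sum>i\<in>I t. (g t - g (ch t i))\<^sup>2) + 3 / 2 * (\<Sum>t\<in>B. \<Sum>i\<in>I t. (g (ch t i))\<^sup>2)"
      by (simp add: sum.distrib sum_distrib_left)
    also have "(\<Sum>t\<in>B. \<Sum>i\<in>I t. (g t - g (ch t i))\<^sup>2) \<le> (\<Sum>t\<in>A. \<Sum>i<3. (g t - g (ch t i))\<^sup>2)"
    proof -
      have "(\<Sum>t\<in>B. \<Sum>i\<in>I t. (g t - g (ch t i))\<^sup>2) \<le> (\<Sum>t\<in>B. \<Sum>i<3. (g t - g (ch t i))\<^sup>2)"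
        by (intro sum_mono sum_mono2) (auto simp: I_def)
      also have "\<dots> \<le> (\<Sum>t\<in>A. \<Sum>i<3. (g t - g (ch t i))\<^sup>2)"
        using A by (intro sum_mono2) (auto simp: B_def intro!: sum_nonneg)
      finally show ?thesis .
    qed
    also have "(\<Sum>t\<in>A. \<Sum>i<3. (g t - g (ch t i))\<^sup>2) = D" unfolding D_def by (rule sum.swap)
    also have "(\<Sum>t\<in>B. \<Sum>i\<in>I t. (g (ch t i))\<^sup>2) \<le> E"
    proof -
      define X where "X = (\<lambda>(t, i). ch t i) ` (SIGMA t:B. I t)"
      have finX: "finite X" using finB finI by (simp add: X_def)
      have XN: "X \<subseteq> N" using child by (auto simp: X_def B_def)
      have "inj_on (\<lambda>(t, i). ch t i) (SIGMA t:B. I t)"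
        by (rule inj_on_subset[OF inj]) (auto simp: B_def)
      then have "(\<Sum>t\<in>B. \<Sum>i\<in>I t. (g (ch t i))\<^sup>2) = (\<Sum>v\<in>X. (g v)\<^sup>2)"
        unfolding X_def using finB finI
        by (subst sum.reindex) (auto simp: sum.Sigma case_prod_unfold comp_def)
      also have "\<dots> = (\<Sum>v\<in>X \<inter> B. (g v)\<^sup>2)"
        using finX XN A(2) by (intro sum.mono_neutral_right) (auto simp: B_def N_def)
      also have "\<dots> \<le> E" unfolding E_def using finB by (intro sum_mono2) auto
      finally show ?thesis .
    qed
    finally have "2 * E \<le> 3 * D + 3 / 2 * E" by simp
    then have "E \<le> 6 * D" by simp
    moreover have "(g (b 0))\<^sup>2 \<le> E"
    proof (cases "g (b 0) = 0")
      case True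
      then show ?thesis by (simp add: E_def sum_nonneg)
    next
      case False
      then have "b 0 \<in> B" using A(2) bC[of 0] bl[of 0] by (auto simp: B_def N_def)
      then show ?thesis unfolding E_def using finB by (intro member_le_sum) auto
    qed
    ultimately show ?thesis by (simp add: D_def ch_def)
  qed
  show ?thesis by (rule that[of "b 0" b]) (use bC ineq in auto)
qed

end

section \<open>Discrete-time walks\<close>

locale finite_coxeter = coxeter +
  assumes finite_S: "finite S"
begin

section \<open>The lazy walk as an operator on functions\<close>

definition lazy_weights :: "('a \<Rightarrow> real) \<Rightarrow> bool" where
  "lazy_weights w \<longleftrightarrow> (\<forall>s\<in>S. 0 \<le> w s) \<and> sum w S \<le> 1/2"

text \<open>The expectation of \<open>f\<close> after one step from \<open>x\<close>. With operators
  in place of processes the discrete walk needs no probability space.\<close>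

definition step :: "('a \<Rightarrow> real) \<Rightarrow> ('a \<Rightarrow> real) \<Rightarrow> 'a \<Rightarrow> real" where
  "step w f x = f x + (\<Sum>s\<in>S. w s * (f (x \<otimes> s) - f x))"

abbreviation steps :: "('a \<Rightarrow> real) \<Rightarrow> nat \<Rightarrow> ('a \<Rightarrow> real) \<Rightarrow> 'a \<Rightarrow> real" where
  "steps w n \<equiv> step w ^^ n"

lemma step_alt: "step w f x = (1 - sum w S) * f x + (\<Sum>s\<in>S. w s * f (x \<otimes> s))"
  by (simp add: step_def algebra_simps sum_subtractf sum_distrib_left)

lemma step_cong:
  "(\<And>y. y \<in> carrier G \<Longrightarrow> f y = g y) \<Longrightarrow> x \<in> carrier G \<Longrightarrow> step w f x = step w g x"
  unfolding step_def by (simp cong: sum.cong)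

lemma steps_cong:
  "(\<And>y. y \<in> carrier G \<Longrightarrow> f y = g y) \<Longrightarrow> x \<in> carrier G \<Longrightarrow> steps w n f x = steps w n g x"
  by (induction n arbitrary: x) (auto intro!: step_cong)

lemma step_add: "step w (\<lambda>x. f x + g x) x = step w f x + step w g x"
  by (simp add: step_alt distrib_left sum.distrib)

lemma step_cmult: "step w (\<lambda>x. c * f x) x = c * step w f x"
  by (simp add: step_alt distrib_left sum_distrib_left mult_ac)

lemma step_const: "step w (\<lambda>x. c) x = c"
  by (simp add: step_def)

lemma steps_add: "steps w n (\<lambda>x. f x + g x) x = steps w n f x + steps w n g x"
proof (induction n arbitrary: x)
  case (Suc n)
  have "steps w n (\<lambda>x. f x + g x) = (\<lambda>x. steps w n f x + steps w n g x)" using Suc by blast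
  then show ?case by (simp add: step_add)
qed simp

lemma steps_cmult: "steps w n (\<lambda>x. c * f x) x = c * steps w n f x"
proof (induction n arbitrary: x)
  case (Suc n)
  have "steps w n (\<lambda>x. c * f x) = (\<lambda>x. c * steps w n f x)" using Suc by blast
  then show ?case by (simp add: step_cmult)
qed simp

lemma steps_const: "steps w n (\<lambda>x. c) x = c"
proof (induction n arbitrary: x)
  case (Suc n)
  have "steps w n (\<lambda>x. c) = (\<lambda>x. c)" using Suc by blast
  then show ?case by (simp add: step_const)
qed simp

lemma steps_diff: "steps w n (\<lambda>x. f x - g x) x = steps w n f x - steps w n g x"
  using steps_add[of n w f "\<lambda>x. (-1) * g x" x] steps_cmult[of n w "-1" g x] by simp

lemma steps_sum: "finite I \<Longrightarrow> steps w n (\<lambda>x. \<Sum>i\<in>I. f i x) x = (\<Sum>i\<in>I. steps w n (f i) x)"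
  by (induction I rule: finite_induct) (simp_all add: steps_const steps_add)

lemma step_mono:
  assumes "lazy_weights w" "\<And>y. y \<in> carrier G \<Longrightarrow> f y \<le> g y" "x \<in> carrier G"
  shows "step w f x \<le> step w g x"
  unfolding step_alt using assms
  by (intro add_mono mult_left_mono sum_mono) (auto simp: lazy_weights_def)

lemma steps_mono:
  assumes "lazy_weights w" "\<And>y. y \<in> carrier G \<Longrightarrow> f y \<le> g y"
  shows "x \<in> carrier G \<Longrightarrow> steps w n f x \<le> steps w n g x"
  by (induction n arbitrary: x) (auto intro!: step_mono assms)

lemma steps_left_mult:
  assumes "g \<in> carrier G"
  shows "x \<in> carrier G \<Longrightarrow> steps w n (\<lambda>y. f (g \<otimes> y)) x = steps w n f (g \<otimes> x)"
proof (induction n arbitrary: x)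
  case (Suc n)
  have "step w (steps w n (\<lambda>y. f (g \<otimes> y))) x = step w (\<lambda>y. steps w n f (g \<otimes> y)) x"
    using Suc by (intro step_cong) auto
  also have "\<dots> = step w (steps w n f) (g \<otimes> x)"
    unfolding step_def using assms Suc.prems by (simp add: m_assoc cong: sum.cong)
  finally show ?case by simp
qed simp

section \<open>Left steps and symmetry under inversion\<close>

definition lstep :: "('a \<Rightarrow> real) \<Rightarrow> ('a \<Rightarrow> real) \<Rightarrow> 'a \<Rightarrow> real" where
  "lstep w f x = f x + (\<Sum>s\<in>S. w s * (f (s \<otimes> x) - f x))"

lemma steps_lstep:
  assumes "x \<in> carrier G" shows "steps w n (lstep v f) x = lstep v (steps w n f) x"
proof -
  have "steps w n (lstep v f) x = steps w n f x + steps w n (\<lambda>x. \<Sum>s\<in>S. v s * (f (s \<otimes> x) - f x)) x"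
    using steps_add[of n w f "\<lambda>x. \<Sum>s\<in>S. v s * (f (s \<otimes> x) - f x)" x] by (simp add: lstep_def[abs_def])
  also have "steps w n (\<lambda>x. \<Sum>s\<in>S. v s * (f (s \<otimes> x) - f x)) x =
      (\<Sum>s\<in>S. v s * (steps w n (\<lambda>x. f (s \<otimes> x)) x - steps w n f x))"
    by (simp add: steps_sum[OF finite_S] steps_cmult steps_diff)
  also have "\<dots> = (\<Sum>s\<in>S. v s * (steps w n f (s \<otimes> x) - steps w n f x))"
    using assms by (intro sum.cong refl) (simp add: steps_left_mult)
  finally show ?thesis by (simp only: lstep_def[of v "steps w n f" x])
qed

text \<open>Left and right steps commute and agree at \<open>\<one>\<close>, so independent
  increments may be multiplied in either order.\<close>

lemma steps_eq_lsteps_one: "steps w n f \<one> = (lstep w ^^ n) f \<one>"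
proof (induction n arbitrary: f)
  case (Suc n)
  have "(lstep w ^^ Suc n) f \<one> = (lstep w ^^ n) (lstep w f) \<one>" by (simp add: funpow_swap1)
  also have "\<dots> = lstep w (steps w n f) \<one>" using Suc[of "lstep w f"] by (simp add: steps_lstep)
  also have "\<dots> = step w (steps w n f) \<one>" by (simp add: lstep_def step_def cong: sum.cong)
  finally show ?case by simp
qed simp

lemma steps_inv: "x \<in> carrier G \<Longrightarrow> steps w n (\<lambda>x. f (inv x)) x = (lstep w ^^ n) f (inv x)"
proof (induction n arbitrary: x)
  case (Suc n)
  have "steps w (Suc n) (\<lambda>x. f (inv x)) x = step w (\<lambda>y. (lstep w ^^ n) f (inv y)) x"
    using Suc by (auto intro: step_cong)
  also have "\<dots> = lstep w ((lstep w ^^ n) f) (inv x)"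
    unfolding step_def lstep_def using Suc.prems by (simp add: inv_mult_group cong: sum.cong)
  finally show ?case by simp
qed simp

text \<open>The generators are involutions, so inversion merely reverses the order of the
  increments.\<close>

lemma steps_inv_one: "steps w n (\<lambda>x. f (inv x)) \<one> = steps w n f \<one>"
  using steps_inv[of \<one>] steps_eq_lsteps_one by simp

section \<open>Reflection principle and the bias of a wall\<close>

definition odd_pos :: "'a \<Rightarrow> ('a \<Rightarrow> real) \<Rightarrow> bool" where
  "odd_pos t f \<longleftrightarrow> (\<forall>x\<in>carrier G. f (t \<otimes> x) = - f x \<and> (\<not> crosses x t \<longrightarrow> 0 \<le> f x))"

text \<open>
  The reflection principle: an edge leaving the half-space at \<open>x\<close> leads to the mirror image of \<open>x\<close>,
  so that its contribution \<open>- w s * f x\<close> is outweighed by the laziness of the walk.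
\<close>

lemma step_odd_pos:
  assumes w: "lazy_weights w" and t: "t \<in> reflections" and f: "odd_pos t f"
  shows "odd_pos t (step w f)"
  unfolding odd_pos_def
proof (intro ballI conjI impI)
  fix x assume x: "x \<in> carrier G"
  have tc: "t \<in> carrier G" using t by simp
  have f': "f (t \<otimes> y) = - f y" if "y \<in> carrier G" for y using f that by (simp add: odd_pos_def)
  have "step w f (t \<otimes> x) = step w (\<lambda>y. f (t \<otimes> y)) x"
    using steps_left_mult[OF tc x, of 1 w f] by simp
  also have "\<dots> = step w (\<lambda>y. (-1) * f y) x" using x f' by (intro step_cong) auto
  finally show "step w f (t \<otimes> x) = - step w f x" by (simp only: step_cmult)
  assume nc: "\<not> crosses x t"
  have fx: "0 \<le> f x" using f x nc by (simp add: odd_pos_def)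
  have "- (w s * f x) \<le> w s * f (x \<otimes> s)" if s: "s \<in> S" for s
  proof (cases "crosses (x \<otimes> s) t")
    case False
    then have "0 \<le> f (x \<otimes> s)" using f x s by (simp add: odd_pos_def)
    moreover have "0 \<le> w s" using w s by (simp add: lazy_weights_def)
    ultimately have "0 \<le> w s * f x" "0 \<le> w s * f (x \<otimes> s)" using fx by auto
    then show ?thesis by linarith
  next
    case True
    then have "conj_by x t = s" using nc s x tc by (simp add: crosses_mult)
    then have "x \<otimes> s = t \<otimes> x" using mult_conj_by[OF x tc] by simp
    then show ?thesis using f' x by simp
  qed
  then have "(\<Sum>s\<in>S. - (w s * f x)) \<le> (\<Sum>s\<in>S. w s * f (x \<otimes> s))" by (rule sum_mono)
  moreover have "(\<Sum>s\<in>S. - (w s * f x)) = - (sum w S * f x)"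
    by (simp add: sum_negf sum_distrib_right)
  ultimately have "(1 - 2 * sum w S) * f x \<le> step w f x"
    unfolding step_alt by (simp only: left_diff_distrib)
  moreover have "0 \<le> (1 - 2 * sum w S) * f x" using fx w by (simp add: lazy_weights_def)
  ultimately show "0 \<le> step w f x" by linarith
qed

lemma steps_odd_pos:
  "lazy_weights w \<Longrightarrow> t \<in> reflections \<Longrightarrow> odd_pos t f \<Longrightarrow> odd_pos t (steps w n f)"
  by (induction n) (auto intro: step_odd_pos)

lemma odd_pos_one: "t \<in> reflections \<Longrightarrow> odd_pos t f \<Longrightarrow> 0 \<le> f \<one>"
  by (simp add: odd_pos_def)

definition side :: "'a \<Rightarrow> 'a \<Rightarrow> real" where
  "side t x = (if crosses x t then -1 else 1)"

lemma side_reflect: "t \<in> reflections \<Longrightarrow> x \<in> carrier G \<Longrightarrow> side t (t \<otimes> x) = - side t x"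
  by (simp add: side_def crosses_reflect)

lemma odd_pos_side: "t \<in> reflections \<Longrightarrow> odd_pos t (side t)"
  by (auto simp: odd_pos_def side_reflect) (simp add: side_def)

definition bias :: "('a \<Rightarrow> real) \<Rightarrow> 'a \<Rightarrow> nat \<Rightarrow> real" where
  "bias w t n = steps w n (side t) \<one>"

lemma bias_0 [simp]: "t \<in> reflections \<Longrightarrow> bias w t 0 = 1"
  by (simp add: bias_def side_def)

lemma bias_nonneg: "lazy_weights w \<Longrightarrow> t \<in> reflections \<Longrightarrow> 0 \<le> bias w t n"
  unfolding bias_def by (rule odd_pos_one[OF _ steps_odd_pos[OF _ _ odd_pos_side]])

text \<open>On the side of \<open>\<one>\<close> the function \<open>side t\<close> has its maximal
  value \<open>1\<close>, so a step can only lower it there. The difference is therefore odd and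
  positive, and remains so under further steps.\<close>

lemma bias_Suc_le:
  assumes w: "lazy_weights w" and t: "t \<in> reflections" shows "bias w t (Suc n) \<le> bias w t n"
proof -
  have "odd_pos t (\<lambda>x. side t x - step w (side t) x)"
    unfolding odd_pos_def
  proof (intro ballI conjI impI)
    fix x assume x: "x \<in> carrier G"
    show "side t (t \<otimes> x) - step w (side t) (t \<otimes> x) = - (side t x - step w (side t) x)"
      using step_odd_pos[OF w t odd_pos_side[OF t]] x t by (simp add: odd_pos_def side_reflect)
    assume "\<not> crosses x t"
    moreover have "step w (side t) x \<le> step w (\<lambda>_. 1) x"
      using w x by (intro step_mono) (auto simp: side_def)
    ultimately show "0 \<le> side t x - step w (side t) x" by (simp add: side_def step_const)
  qed
  then have "0 \<le> steps w n (\<lambda>x. side t x - step w (side t) x) \<one>"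
    by (intro odd_pos_one[OF t] steps_odd_pos w t)
  then show ?thesis by (simp add: steps_diff bias_def funpow_swap1)
qed

lemma bias_antimono: "lazy_weights w \<Longrightarrow> t \<in> reflections \<Longrightarrow> i \<le> j \<Longrightarrow> bias w t j \<le> bias w t i"
  by (rule lift_Suc_antimono_le) (auto intro: bias_Suc_le)

lemma bias_le_1: "lazy_weights w \<Longrightarrow> t \<in> reflections \<Longrightarrow> bias w t n \<le> 1"
  using bias_antimono[of w t 0 n] by simp

section \<open>Expected length and its increments\<close>

definition mean_len :: "('a \<Rightarrow> real) \<Rightarrow> nat \<Rightarrow> real" where
  "mean_len w n = steps w n (\<lambda>x. real (len x)) \<one>"

lemma mean_len_0 [simp]: "mean_len w 0 = 0"
  by (simp add: mean_len_def)

text \<open>Whether \<open>x \<otimes> s\<close> is longer than \<open>x\<close> depends on the side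
  of \<open>inv x\<close> at the wall of \<open>s\<close>; symmetry of the law under inversion turns
  this into a bias.\<close>

lemma mean_len_Suc: "mean_len w (Suc n) = mean_len w n + (\<Sum>s\<in>S. w s * bias w s n)"
proof -
  have "mean_len w (Suc n) = steps w n (step w (\<lambda>x. real (len x))) \<one>"
    by (simp add: mean_len_def funpow_swap1)
  also have "\<dots> = steps w n (\<lambda>x. real (len x) + (\<Sum>s\<in>S. w s * side s (inv x))) \<one>"
    by (rule steps_cong) (simp_all add: step_def len_mult_S side_def cong: sum.cong)
  also have "\<dots> = mean_len w n + (\<Sum>s\<in>S. w s * steps w n (\<lambda>x. side s (inv x)) \<one>)"
    by (simp add: steps_add steps_sum[OF finite_S] steps_cmult mean_len_def)
  finally show ?thesis by (simp add: steps_inv_one bias_def)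
qed

text \<open>
  Inserting the letter \<open>s\<close> between independent walks \<open>x\<close> and \<open>y\<close>: the change of length is odd under
  \<open>s\<close> in both \<open>x\<^sup>-\<^sup>1\<close> and \<open>y\<close>, and at least \<open>1\<close> when both stay on the side of \<open>\<one>\<close>.
\<close>

lemma insertion:
  fixes j k :: nat
  assumes w: "lazy_weights w" and v: "lazy_weights v" and s: "s \<in> S"
  defines "F \<equiv> steps w j (\<lambda>x. real (len x))"
  shows "bias v s k * bias w s j \<le> steps v k (\<lambda>x. F (x \<otimes> s) - F x) \<one>"
proof -
  have sr: "s \<in> reflections" and sc: "s \<in> carrier G" using s by auto
  define D where "D x y = real (len (inv x \<otimes> (s \<otimes> y))) - real (len (inv x \<otimes> y))" for x y
  define \<Phi> where "\<Phi> x = steps w j (D x) \<one>" for x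
  have \<Phi>: "F (inv x \<otimes> s) - F (inv x) = \<Phi> x" if x: "x \<in> carrier G" for x
  proof -
    have "steps w j (\<lambda>y. real (len (inv x \<otimes> (s \<otimes> y)))) \<one> = steps w j (\<lambda>y. real (len ((inv x \<otimes> s) \<otimes> y))) \<one>"
      using x sc by (intro steps_cong) (auto simp: m_assoc)
    also have "\<dots> = F (inv x \<otimes> s)"
      unfolding F_def using steps_left_mult[of "inv x \<otimes> s" \<one> j w "\<lambda>y. real (len y)"] x sc by simp
    finally show ?thesis
      using steps_left_mult[of "inv x" \<one> j w "\<lambda>y. real (len y)"] x
      by (simp add: \<Phi>_def D_def[abs_def] steps_diff F_def)
  qed
  have D_odd: "D x (s \<otimes> y) = - D x y" if "x \<in> carrier G" "y \<in> carrier G" for x y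
    using that s by (simp add: D_def)
  have D_odd': "D (s \<otimes> x) y = - D x y" if "x \<in> carrier G" "y \<in> carrier G" for x y
    using that s by (simp add: D_def inv_mult_group m_assoc)
  have D1: "1 \<le> D x y" if "x \<in> carrier G" "y \<in> carrier G" "\<not> crosses x s" "\<not> crosses y s" for x y
  proof -
    have "cayley_dist G S x y < cayley_dist G S x (s \<otimes> y)"
      using dist_reflect_less[OF that(1,2) sr that(3,4)] .
    then have "len (inv x \<otimes> y) < len (inv x \<otimes> (s \<otimes> y))"
      using dist_one[of x y] dist_one[of x "s \<otimes> y"] that sc by simp
    then show ?thesis by (simp add: D_def)
  qed
  \<comment> \<open>Averaging over \<open>y\<close> first compares \<open>D x\<close> with
    \<open>side s\<close>; the average is again odd in \<open>x\<close>, so the comparison can be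
    repeated.\<close>
  have \<Phi>_ge: "bias w s j \<le> \<Phi> x" if x: "x \<in> carrier G" "\<not> crosses x s" for x
  proof -
    have "odd_pos s (\<lambda>y. D x y - side s y)"
      using D_odd D1 x sr by (auto simp: odd_pos_def side_reflect) (simp add: side_def)
    then have "0 \<le> steps w j (\<lambda>y. D x y - side s y) \<one>"
      by (intro odd_pos_one[OF sr] steps_odd_pos w sr)
    then show ?thesis by (simp add: steps_diff \<Phi>_def bias_def)
  qed
  have "odd_pos s (\<lambda>x. \<Phi> x - bias w s j * side s x)"
    unfolding odd_pos_def
  proof (intro ballI conjI impI)
    fix x assume x: "x \<in> carrier G"
    have "\<Phi> (s \<otimes> x) = steps w j (\<lambda>y. (-1) * D x y) \<one>"
      unfolding \<Phi>_def using x D_odd' by (intro steps_cong) auto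
    also have "\<dots> = - \<Phi> x" by (simp only: steps_cmult \<Phi>_def)
    finally show "\<Phi> (s \<otimes> x) - bias w s j * side s (s \<otimes> x) = - (\<Phi> x - bias w s j * side s x)"
      using side_reflect[OF sr x] by simp
    assume "\<not> crosses x s"
    then show "0 \<le> \<Phi> x - bias w s j * side s x" using \<Phi>_ge x by (simp add: side_def)
  qed
  then have "0 \<le> steps v k (\<lambda>x. \<Phi> x - bias w s j * side s x) \<one>"
    by (intro odd_pos_one[OF sr] steps_odd_pos v sr)
  then have "bias w s j * bias v s k \<le> steps v k \<Phi> \<one>"
    by (simp add: steps_diff steps_cmult bias_def)
  also have "steps v k \<Phi> \<one> = steps v k (\<lambda>x. F (inv x \<otimes> s) - F (inv x)) \<one>"
    using \<Phi> by (intro steps_cong) auto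
  also have "\<dots> = steps v k (\<lambda>x. F (x \<otimes> s) - F x) \<one>"
    by (rule steps_inv_one)
  finally show ?thesis by (simp add: mult.commute)
qed

text \<open>Steps are exchanged one at a time: \<open>T k\<close> uses \<open>v\<close> for the
  first \<open>k\<close> steps and \<open>w\<close> for the rest. Passing to \<open>k + 1\<close>
  inserts each \<open>s\<close> with extra weight \<open>v s - w s\<close> between \<open>k\<close>
  steps of \<open>v\<close> and \<open>n - k - 1\<close> steps of \<open>w\<close>.\<close>

lemma mean_len_diff:
  assumes w: "lazy_weights w" and v: "lazy_weights v" and le: "\<And>s. s \<in> S \<Longrightarrow> w s \<le> v s"
  shows "mean_len w n + (\<Sum>k<n. \<Sum>s\<in>S. (v s - w s) * (bias v s k * bias w s (n - Suc k))) \<le> mean_len v n"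
proof -
  define T where "T k = steps v k (steps w (n - k) (\<lambda>x. real (len x))) \<one>" for k
  have "(\<Sum>s\<in>S. (v s - w s) * (bias v s k * bias w s (n - Suc k))) \<le> T (Suc k) - T k" if k: "k < n" for k
  proof -
    define F where "F = steps w (n - Suc k) (\<lambda>x. real (len x))"
    have "n - k = Suc (n - Suc k)" using k by simp
    then have "steps w (n - k) (\<lambda>x. real (len x)) = step w F" by (simp add: F_def)
    then have "T (Suc k) - T k = steps v k (step v F) \<one> - steps v k (step w F) \<one>"
      by (simp add: T_def F_def funpow_swap1)
    also have "\<dots> = steps v k (\<lambda>x. step v F x - step w F x) \<one>" by (simp add: steps_diff)
    also have "(\<lambda>x. step v F x - step w F x) = (\<lambda>x. \<Sum>s\<in>S. (v s - w s) * (F (x \<otimes> s) - F x))"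
      by (simp add: step_def fun_eq_iff sum_subtractf[symmetric] left_diff_distrib)
    also have "steps v k \<dots> \<one> = (\<Sum>s\<in>S. (v s - w s) * steps v k (\<lambda>x. F (x \<otimes> s) - F x) \<one>)"
      by (simp add: steps_sum[OF finite_S] steps_cmult)
    also have "\<dots> \<ge> (\<Sum>s\<in>S. (v s - w s) * (bias v s k * bias w s (n - Suc k)))"
      unfolding F_def using le by (intro sum_mono mult_left_mono insertion w v) (auto simp: field_simps)
    finally show ?thesis .
  qed
  then have "(\<Sum>k<n. \<Sum>s\<in>S. (v s - w s) * (bias v s k * bias w s (n - Suc k))) \<le> (\<Sum>k<n. T (Suc k) - T k)"
    by (intro sum_mono) auto
  also have "\<dots> = T n - T 0" by (rule sum_lessThan_telescope)
  finally show ?thesis by (simp add: T_def mean_len_def)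
qed

section \<open>The bias as a function on a conjugacy class\<close>

lemma bias_Suc:
  assumes t: "t \<in> reflections"
  shows "bias w t (Suc n) = bias w t n + (\<Sum>s\<in>S. w s * (bias w (conj_by s t) n - bias w t n))
    - (if t \<in> S then 2 * w t * bias w t n else 0)"
proof -
  \<comment> \<open>A first step to \<open>s\<close> moves the wall of \<open>t\<close> to that of
    \<open>s t s\<close>, and for \<open>s = t\<close> it also changes the side. So the bias evolves
    by the conjugation walk with a killing term at the simple reflections.\<close>
  have *: "steps w n (side t) s = (if s = t then - bias w t n else bias w (conj_by s t) n)" if s: "s \<in> S" for s
  proof -
    have tc: "t \<in> carrier G" using t by simp
    have "steps w n (side t) s = steps w n (\<lambda>y. side t (s \<otimes> y)) \<one>"
      using s steps_left_mult[of s \<one> n w "side t"] by simp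
    also have "\<dots> = steps w n (\<lambda>y. (if s = t then -1 else 1) * side (conj_by s t) y) \<one>"
      using s tc by (intro steps_cong) (auto simp: side_def crosses_mult)
    also have "\<dots> = (if s = t then -1 else 1) * bias w (conj_by s t) n"
      by (simp only: steps_cmult bias_def)
    finally show ?thesis using s tc by auto
  qed
  have "bias w t (Suc n) = bias w t n + (\<Sum>s\<in>S. w s * (steps w n (side t) (\<one> \<otimes> s) - bias w t n))"
    by (simp add: bias_def step_def)
  also have "(\<Sum>s\<in>S. w s * (steps w n (side t) (\<one> \<otimes> s) - bias w t n)) =
    (\<Sum>s\<in>S. w s * (bias w (conj_by s t) n - bias w t n) - (if t = s then 2 * w t * bias w t n else 0))"
    by (intro sum.cong refl) (auto simp: * algebra_simps)
  also have "\<dots> = (\<Sum>s\<in>S. w s * (bias w (conj_by s t) n - bias w t n)) - (if t \<in> S then 2 * w t * bias w t n else 0)"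
    by (simp add: sum_subtractf finite_S)
  finally show ?thesis by simp
qed

text \<open>A Harnack-type bound between neighbours: it carries convergence to \<open>0\<close> from
  one element of a class to all others.\<close>

lemma bias_conj_le:
  assumes w: "lazy_weights w" and t: "t \<in> reflections" and s: "s \<in> S"
  shows "w s * bias w (conj_by s t) n \<le> bias w t (Suc n) + 2 * bias w t n"
proof -
  have tc: "t \<in> carrier G" using t by simp
  have w0: "0 \<le> w u" if "u \<in> S" for u using w that by (simp add: lazy_weights_def)
  have w1: "w u \<le> 1 / 2" if "u \<in> S" for u
    using member_le_sum[of u S w] w0 that finite_S w by (simp add: lazy_weights_def)
  have "w s * bias w (conj_by s t) n \<le> (\<Sum>u\<in>S. w u * bias w (conj_by u t) n)"
    using w0 bias_nonneg[OF w conj_by_reflections[OF _ t]] s finite_S by (intro member_le_sum) auto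
  also have "\<dots> = bias w t (Suc n) - (1 - sum w S) * bias w t n + (if t \<in> S then 2 * w t * bias w t n else 0)"
    unfolding bias_Suc[OF t] by (simp add: algebra_simps sum_subtractf sum_distrib_left sum_distrib_right)
  also have "\<dots> \<le> bias w t (Suc n) + 2 * bias w t n"
  proof -
    have b: "0 \<le> bias w t n" using bias_nonneg[OF w t] .
    have "0 \<le> (1 - sum w S) * bias w t n" using b w by (simp add: lazy_weights_def)
    moreover have "(if t \<in> S then 2 * w t * bias w t n else 0) \<le> 2 * bias w t n"
      using b w1[of t] mult_right_mono[of "w t" 1 "bias w t n"] by auto
    ultimately show ?thesis by linarith
  qed
  finally show ?thesis .
qed

text \<open>By \<open>bias_Suc\<close>, one step enlarges the set where the bias differs from
  \<open>1\<close> at most by \<open>S\<close> and by its conjugates under generators. This keeps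
  all sums over an infinite class finite.\<close>

lemma bias_finite_support:
  assumes C: "C \<subseteq> reflections"
  shows "finite {t \<in> C. bias w t n \<noteq> 1}"
proof -
  have "finite {t \<in> reflections. bias w t n \<noteq> 1}"
  proof (induction n)
    case 0
    have "{t \<in> reflections. bias w t 0 \<noteq> 1} = {}" by auto
    then show ?case by (metis finite.emptyI)
  next
    case (Suc n)
    define A where "A = {t \<in> reflections. bias w t n \<noteq> 1}"
    have "{t \<in> reflections. bias w t (Suc n) \<noteq> 1} \<subseteq> A \<union> S \<union> (\<Union>s\<in>S. conj_by s ` A)"
    proof (rule ccontr)
      assume "\<not> ?thesis"
      then obtain t where t: "t \<in> reflections" "bias w t (Suc n) \<noteq> 1" "t \<notin> A" "t \<notin> S" "\<And>s. s \<in> S \<Longrightarrow> t \<notin> conj_by s ` A"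
        by blast
      have 1: "bias w t n = 1" using t by (simp add: A_def)
      have "bias w (conj_by s t) n = 1" if s: "s \<in> S" for s
      proof (rule ccontr)
        assume "bias w (conj_by s t) n \<noteq> 1"
        then have "conj_by s t \<in> A" using s t(1) by (simp add: A_def)
        then have "conj_by s (conj_by s t) \<in> conj_by s ` A" by blast
        then show False using t(1,5) s by simp
      qed
      then show False using t 1 bias_Suc[OF t(1), of w n] by simp
    qed
    moreover have "finite (A \<union> S \<union> (\<Union>s\<in>S. conj_by s ` A))"
      using Suc finite_S by (simp add: A_def)
    ultimately show ?case by (rule finite_subset)
  qed
  then show ?thesis by (rule rev_finite_subset) (use C in auto)
qed

text \<open>Telescoping along the word \<open>u\<close> bounds the energy of an arbitrary element by
  that of the generators, with \<open>K\<close> depending on the word alone. Admitting all finite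
  \<open>A\<close> allows the sum to be shifted by \<open>conj_by s\<close>.\<close>

lemma conj_difference_bound:
  assumes C: "C \<subseteq> carrier G" "\<And>t x. t \<in> C \<Longrightarrow> x \<in> carrier G \<Longrightarrow> conj_by x t \<in> C" and b: "set u \<subseteq> S"
  shows "\<exists>K\<ge>0. \<forall>(g :: 'a \<Rightarrow> real) \<epsilon>. (\<forall>s\<in>S. \<forall>A. finite A \<longrightarrow> A \<subseteq> C \<longrightarrow> (\<Sum>t\<in>A. (g t - g (conj_by s t))\<^sup>2) \<le> \<epsilon>) \<longrightarrow>
    (\<forall>A. finite A \<longrightarrow> A \<subseteq> C \<longrightarrow> (\<Sum>t\<in>A. (g t - g (conj_by (wprod u) t))\<^sup>2) \<le> K * \<epsilon>)"
  using b
proof (induction u)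
  case Nil
  have "(\<Sum>t\<in>A. (g t - g (conj_by \<one> t))\<^sup>2) = 0" if "A \<subseteq> C" for A and g :: "'a \<Rightarrow> real"
    using that C(1) by (intro sum.neutral) auto
  then show ?case by (intro exI[of _ 0]) auto
next
  case (Cons s u)
  then obtain K where K: "0 \<le> K" and IH: "\<And>(g :: 'a \<Rightarrow> real) \<epsilon> A. (\<forall>s\<in>S. \<forall>A. finite A \<longrightarrow> A \<subseteq> C \<longrightarrow> (\<Sum>t\<in>A. (g t - g (conj_by s t))\<^sup>2) \<le> \<epsilon>) \<Longrightarrow>
    finite A \<Longrightarrow> A \<subseteq> C \<Longrightarrow> (\<Sum>t\<in>A. (g t - g (conj_by (wprod u) t))\<^sup>2) \<le> K * \<epsilon>" by auto
  have s: "s \<in> S" and u: "wprod u \<in> carrier G" using Cons.prems by auto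
  have "(\<Sum>t\<in>A. (g t - g (conj_by (wprod (s # u)) t))\<^sup>2) \<le> (2 + 2 * K) * \<epsilon>"
    if h: "\<forall>s\<in>S. \<forall>A. finite A \<longrightarrow> A \<subseteq> C \<longrightarrow> (\<Sum>t\<in>A. (g t - g (conj_by s t))\<^sup>2) \<le> \<epsilon>" and A: "finite A" "A \<subseteq> C"
    for g :: "'a \<Rightarrow> real" and \<epsilon> A
  proof -
    have "(\<Sum>t\<in>A. (g t - g (conj_by (wprod (s # u)) t))\<^sup>2) \<le>
       (\<Sum>t\<in>A. 2 * (g t - g (conj_by s t))\<^sup>2 + 2 * (g (conj_by s t) - g (conj_by (wprod u) (conj_by s t)))\<^sup>2)"
    proof (rule sum_mono)
      fix t assume "t \<in> A"
      then have "conj_by (wprod (s # u)) t = conj_by (wprod u) (conj_by s t)"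
        using A(2) C(1) s u by (auto simp: conj_by_comp)
      moreover have "(a - c)\<^sup>2 \<le> 2 * (a - b)\<^sup>2 + 2 * (b - c)\<^sup>2" for a b c :: real
      proof -
        have "0 \<le> (a - 2 * b + c)\<^sup>2" by simp
        then show ?thesis by (simp add: power2_eq_square algebra_simps)
      qed
      ultimately show "(g t - g (conj_by (wprod (s # u)) t))\<^sup>2 \<le> 2 * (g t - g (conj_by s t))\<^sup>2 + 2 * (g (conj_by s t) - g (conj_by (wprod u) (conj_by s t)))\<^sup>2"
        by simp
    qed
    also have "\<dots> = 2 * (\<Sum>t\<in>A. (g t - g (conj_by s t))\<^sup>2) + 2 * (\<Sum>t\<in>A. (g (conj_by s t) - g (conj_by (wprod u) (conj_by s t)))\<^sup>2)"
      by (simp add: sum.distrib sum_distrib_left)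
    also have "(\<Sum>t\<in>A. (g (conj_by s t) - g (conj_by (wprod u) (conj_by s t)))\<^sup>2) = (\<Sum>t\<in>conj_by s ` A. (g t - g (conj_by (wprod u) t))\<^sup>2)"
    proof -
      have "inj_on (conj_by s) A"
        by (rule inj_onI) (use conj_by_inj[OF S_closed[OF s]] A(2) C(1) in blast)
      then show ?thesis by (simp add: sum.reindex)
    qed
    also have "\<dots> \<le> K * \<epsilon>" using A C(2) s by (intro IH h) auto
    also have "(\<Sum>t\<in>A. (g t - g (conj_by s t))\<^sup>2) \<le> \<epsilon>" using h s A by blast
    finally show ?thesis by (simp add: algebra_simps)
  qed
  then show ?case using K by (intro exI[of _ "2 + 2 * K"]) auto
qed

text \<open>
  Summation by parts for \<open>g t = 1 - bias w t n\<close>: as the bias decreases in \<open>n\<close>, \<open>bias_Suc\<close> bounds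
  minus the generator applied to \<open>g\<close> by its killing term, which lives on the simple reflections.
\<close>

lemma energy_bound:
  assumes w: "lazy_weights w" and C: "C \<subseteq> reflections" "\<And>t x. t \<in> C \<Longrightarrow> x \<in> carrier G \<Longrightarrow> conj_by x t \<in> C"
    and s0: "s0 \<in> S" and A: "finite A" "A \<subseteq> C"
  shows "w s0 * (\<Sum>t\<in>A. (bias w t n - bias w (conj_by s0 t) n)\<^sup>2) \<le> 4 * (\<Sum>s\<in>S \<inter> C. w s * bias w s n)"
proof -
  define g where "g t = 1 - bias w t n" for t
  define B where "B = {t \<in> C. g t \<noteq> 0}"
  have finB: "finite B" using bias_finite_support[OF C(1), of w n] by (simp add: B_def g_def)
  have CC: "t \<in> carrier G" if "t \<in> C" for t using that C(1) by auto
  have w0: "0 \<le> w u" if "u \<in> S" for u using w that by (simp add: lazy_weights_def)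
  have g01: "0 \<le> g t" "g t \<le> 1" if "t \<in> C" for t
    using bias_le_1[OF w, of t n] bias_nonneg[OF w, of t n] C(1) that by (auto simp: g_def)
  have dirichlet: "(\<Sum>t\<in>A. (g t - g (conj_by s t))\<^sup>2) \<le> 2 * (\<Sum>t\<in>B. g t * (g t - g (conj_by s t)))"
    if s: "s \<in> S" and A: "finite A" "A \<subseteq> C" for s A
  proof -
    have sc: "s \<in> carrier G" using s by simp
    \<comment> \<open>An enlargement of the support invariant under \<open>conj_by s\<close>, so
      that the sum can be reindexed; off \<open>D\<close> both \<open>g t\<close> and
      \<open>g (conj_by s t)\<close> vanish on \<open>C\<close>.\<close>
    define D where "D = B \<union> conj_by s ` B"
    have D: "finite D" "D \<subseteq> C" "conj_by s ` D = D"
    proof -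
      show "finite D" using finB by (simp add: D_def)
      show "D \<subseteq> C" using C(2) sc by (auto simp: D_def B_def)
      have "conj_by s ` conj_by s ` B = B"
        using s CC by (force simp: B_def image_image)
      then show "conj_by s ` D = D" by (auto simp: D_def image_Un)
    qed
    have inj: "inj_on (conj_by s) D"
      by (rule inj_onI) (use conj_by_inj[OF sc] D(2) CC in blast)
    have zero: "g t - g (conj_by s t) = 0" if "t \<in> C" "t \<notin> D" for t
    proof -
      have "conj_by s t \<notin> B" using that D CC s by (metis D_def UnI2 conj_by_S_cancel imageI)
      then show ?thesis using that C(2) sc by (auto simp: B_def D_def)
    qed
    have "(\<Sum>t\<in>A. (g t - g (conj_by s t))\<^sup>2) = (\<Sum>t\<in>A \<inter> D. (g t - g (conj_by s t))\<^sup>2)"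
      using A zero by (intro sum.mono_neutral_right) auto
    also have "\<dots> \<le> (\<Sum>t\<in>D. (g t - g (conj_by s t))\<^sup>2)"
      using D by (intro sum_mono2) auto
    also have "\<dots> = (\<Sum>t\<in>D. g t * (g t - g (conj_by s t))) - (\<Sum>t\<in>D. g (conj_by s t) * (g t - g (conj_by s t)))"
      by (simp add: sum_subtractf[symmetric] power2_eq_square algebra_simps)
    also have "(\<Sum>t\<in>D. g (conj_by s t) * (g t - g (conj_by s t))) = (\<Sum>t\<in>conj_by s ` D. g t * (g (conj_by s t) - g t))"
      using inj s D(2) CC by (auto simp: sum.reindex intro!: sum.cong)
    also have "\<dots> = - (\<Sum>t\<in>D. g t * (g t - g (conj_by s t)))"
      unfolding D(3) by (simp add: sum_negf[symmetric] algebra_simps)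
    also have "(\<Sum>t\<in>D. g t * (g t - g (conj_by s t))) = (\<Sum>t\<in>B. g t * (g t - g (conj_by s t)))"
      using D by (intro sum.mono_neutral_right) (auto simp: D_def B_def)
    finally show ?thesis by simp
  qed
  have "(\<Sum>s\<in>S. w s * (\<Sum>t\<in>B. g t * (g t - g (conj_by s t)))) = (\<Sum>t\<in>B. g t * (\<Sum>s\<in>S. w s * (g t - g (conj_by s t))))"
    by (simp add: sum_distrib_left sum.swap[of _ S B] mult_ac)
  also have "\<dots> \<le> (\<Sum>t\<in>B. if t \<in> S then 2 * w t * bias w t n else 0)"
  proof (rule sum_mono)
    fix t assume t: "t \<in> B"
    then have tC: "t \<in> C" "t \<in> reflections" using C(1) by (auto simp: B_def)
    have "(\<Sum>s\<in>S. w s * (g t - g (conj_by s t))) \<le> (if t \<in> S then 2 * w t * bias w t n else 0)" (is "?l \<le> ?r")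
      using bias_Suc[OF tC(2), of w n] bias_Suc_le[OF w tC(2), of n]
      by (simp add: g_def)
    moreover have "0 \<le> ?r" using bias_nonneg[OF w tC(2)] w0 by auto
    ultimately have "g t * ?l \<le> g t * ?r" "g t * ?r \<le> 1 * ?r"
      using g01[OF tC(1)] by (intro mult_left_mono mult_right_mono; simp)+
    then show "g t * ?l \<le> ?r" by linarith
  qed
  also have "\<dots> = (\<Sum>t\<in>B \<inter> S. 2 * w t * bias w t n)"
    using finB by (simp add: sum.inter_restrict)
  also have "\<dots> \<le> (\<Sum>t\<in>S \<inter> C. 2 * w t * bias w t n)"
    using finite_S w0 bias_nonneg[OF w] by (intro sum_mono2) (auto simp: B_def)
  finally have total: "(\<Sum>s\<in>S. w s * (\<Sum>t\<in>B. g t * (g t - g (conj_by s t)))) \<le> 2 * (\<Sum>s\<in>S \<inter> C. w s * bias w s n)"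
    by (simp add: sum_distrib_left mult_ac)
  have nonneg: "0 \<le> (\<Sum>t\<in>B. g t * (g t - g (conj_by s t)))" if s: "s \<in> S" for s
    using dirichlet[OF s, of "{}"] by simp
  have "w s0 * (\<Sum>t\<in>A. (g t - g (conj_by s0 t))\<^sup>2) \<le> w s0 * (2 * (\<Sum>t\<in>B. g t * (g t - g (conj_by s0 t))))"
    using dirichlet[OF s0 A] w0[OF s0] by (rule mult_left_mono)
  also have "\<dots> \<le> 2 * (\<Sum>s\<in>S. w s * (\<Sum>t\<in>B. g t * (g t - g (conj_by s t))))"
    using member_le_sum[of s0 S "\<lambda>s. w s * (\<Sum>t\<in>B. g t * (g t - g (conj_by s t)))"] s0 nonneg w0 finite_S
    by simp
  also have "\<dots> \<le> 4 * (\<Sum>s\<in>S \<inter> C. w s * bias w s n)" using total by simp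
  also have "(\<Sum>t\<in>A. (g t - g (conj_by s0 t))\<^sup>2) = (\<Sum>t\<in>A. (bias w t n - bias w (conj_by s0 t) n)\<^sup>2)"
    by (simp add: g_def power2_commute)
  finally show ?thesis .
qed

theorem bias_bounded_below:
  assumes w: "lazy_weights w" "\<And>s. s \<in> S \<Longrightarrow> 0 < w s" and irr: "irreducible_coxeter S m"
    and hyp: "nonelementary_hyperbolic G" and s0: "s0 \<in> S"
  shows "\<exists>c>0. \<forall>n. c \<le> bias w s0 n"
proof (rule ccontr)
  assume neg: "\<not> ?thesis"
  obtain T where T: "T \<subseteq> carrier G" "finite T" "generate G T = carrier G"
    and Th: "gromov_hyperbolic (carrier G) (\<lambda>x y. real (cayley_dist G T x y))"
    using hyp unfolding nonelementary_hyperbolic_def word_hyperbolic_def by blast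
  interpret T: cayley G T by unfold_locales (use T in auto)
  define C where "C = conj_class s0"
  have C: "C \<subseteq> reflections" "\<And>t x. t \<in> C \<Longrightarrow> x \<in> carrier G \<Longrightarrow> conj_by x t \<in> C"
    using conj_class_reflections[OF s0] conj_class_conj_by[OF s0] by (auto simp: C_def)
  have Cc: "C \<subseteq> carrier G" using C(1) by auto
  have infC: "infinite C"
    unfolding C_def using hyp by (intro infinite_conj_class irr s0) (simp add: nonelementary_hyperbolic_def)
  obtain \<delta> where \<delta>: "0 \<le> \<delta>" and four: "\<And>x y z u. x \<in> carrier G \<Longrightarrow> y \<in> carrier G \<Longrightarrow> z \<in> carrier G \<Longrightarrow> u \<in> carrier G \<Longrightarrow>
      real (cayley_dist G T x y) + real (cayley_dist G T z u) \<le>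
        max (real (cayley_dist G T x z) + real (cayley_dist G T y u)) (real (cayley_dist G T x u) + real (cayley_dist G T y z)) + 2 * \<delta>"
    using gromov_hyperbolic_four_point[OF Th] T.dist_commute by auto
  interpret H: hyperbolic_involutions G T \<delta> C
  proof
    show "t \<otimes> t = \<one>" if "t \<in> C" for t using that C(1) by auto
    show "inv x \<otimes> t \<otimes> x \<in> C" if "t \<in> C" "x \<in> carrier G" for t x
      using C(2)[OF that] by (simp add: conj_by_def)
    show "\<not> virtually_cyclic G" using hyp by (simp add: nonelementary_hyperbolic_def)
  qed (use T \<delta> four Cc infC in auto)
  obtain t0 and b :: "nat \<Rightarrow> 'a" where t0: "t0 \<in> C" and bC: "\<And>i. i < 3 \<Longrightarrow> b i \<in> C"
    and ineq: "\<And>(g :: 'a \<Rightarrow> real) A. finite A \<Longrightarrow> {t \<in> C. g t \<noteq> 0} \<subseteq> A \<Longrightarrow> A \<subseteq> C \<Longrightarrow>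
      (g t0)\<^sup>2 \<le> 6 * (\<Sum>i<3. \<Sum>t\<in>A. (g t - g (inv (b i) \<otimes> t \<otimes> b i))\<^sup>2)"
    by (rule H.conj_class_inequality) blast
  define small where "small g \<epsilon> y \<longleftrightarrow> (\<forall>A. finite A \<longrightarrow> A \<subseteq> C \<longrightarrow> (\<Sum>t\<in>A. (g t - g (conj_by y t))\<^sup>2) \<le> \<epsilon>)"
    for g :: "'a \<Rightarrow> real" and \<epsilon> y
  have "\<forall>i\<in>{..<3::nat}. \<exists>K. 0 \<le> K \<and> (\<forall>g \<epsilon>. (\<forall>s\<in>S. small g \<epsilon> s) \<longrightarrow> small g (K * \<epsilon>) (b i))"
  proof
    fix i :: nat assume "i \<in> {..<3}"
    then have "b i \<in> carrier G" using bC[of i] Cc by auto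
    then obtain u where "set u \<subseteq> S" "wprod u = b i" using word_exists by blast
    then show "\<exists>K. 0 \<le> K \<and> (\<forall>g \<epsilon>. (\<forall>s\<in>S. small g \<epsilon> s) \<longrightarrow> small g (K * \<epsilon>) (b i))"
      using conj_difference_bound[OF Cc C(2), of u] unfolding small_def by simp
  qed
  from bchoice[OF this] obtain K where K0: "\<And>i. i < 3 \<Longrightarrow> 0 \<le> K i"
    and K: "\<And>i g \<epsilon>. i < (3::nat) \<Longrightarrow> (\<forall>s\<in>S. small g \<epsilon> s) \<Longrightarrow> small g (K i * \<epsilon>) (b i)"
    by blast
  \<comment> \<open>A decreasing bias that is not bounded away from \<open>0\<close> tends to
    \<open>0\<close>; \<open>bias_conj_le\<close> spreads this over the class letter by letter,
    dividing by \<open>w s > 0\<close>.\<close>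
  have lim0: "bias w t \<longlonglongrightarrow> 0" if tC: "t \<in> C" for t
  proof -
    have "bias w (conj_by (wprod u) s0) \<longlonglongrightarrow> 0" if "set u \<subseteq> S" for u
      using that
    proof (induction u rule: rev_induct)
      case Nil
      have "bias w s0 \<longlonglongrightarrow> 0"
      proof (rule LIMSEQ_I)
        fix e :: real assume "0 < e"
        then obtain N where N: "bias w s0 N < e" using neg not_le by blast
        have "norm (bias w s0 n - 0) < e" if "N \<le> n" for n
          using bias_antimono[OF w(1) S_reflections[OF s0] that] bias_nonneg[OF w(1) S_reflections[OF s0], of n] N by simp
        then show "\<exists>N. \<forall>n\<ge>N. norm (bias w s0 n - 0) < e" by blast
      qed
      then show ?case using s0 by simp
    next
      case (snoc s u)
      then have s: "s \<in> S" and u: "set u \<subseteq> S" by auto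
      define t where "t = conj_by (wprod u) s0"
      have t: "t \<in> reflections" using u s0 by (auto simp: t_def)
      have lim: "bias w t \<longlonglongrightarrow> 0" using snoc u by (simp add: t_def)
      have eq: "conj_by (wprod (u @ [s])) s0 = conj_by s t" using s u s0 by (simp add: t_def wprod_append conj_by_comp)
      have up: "\<forall>n. bias w (conj_by s t) n \<le> (bias w t (Suc n) + 2 * bias w t n) / w s"
        using bias_conj_le[OF w(1) t s] w(2)[OF s] by (simp add: field_simps)
      have "(\<lambda>n. (bias w t (Suc n) + 2 * bias w t n) / w s) \<longlonglongrightarrow> (0 + 2 * 0) / w s"
        by (intro tendsto_intros lim LIMSEQ_Suc) (use w(2)[OF s] in auto)
      then have lim': "(\<lambda>n. (bias w t (Suc n) + 2 * bias w t n) / w s) \<longlonglongrightarrow> 0" by simp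
      have lo: "\<forall>n. 0 \<le> bias w (conj_by s t) n"
        using bias_nonneg[OF w(1)] t s by simp
      show ?case
        unfolding eq
        by (rule tendsto_sandwich[OF always_eventually[OF lo] always_eventually[OF up] tendsto_const lim'])
    qed
    moreover obtain x where "x \<in> carrier G" "t = conj_by x s0"
      using tC unfolding C_def conj_class_def by blast
    ultimately show ?thesis using word_exists[of x] by auto
  qed
  define w0 where "w0 = Min (w ` S)"
  have "S \<noteq> {}" using s0 by blast
  then have w0: "0 < w0" "\<And>s. s \<in> S \<Longrightarrow> w0 \<le> w s"
    using finite_S s0 w(2) Min_gr_iff[of "w ` S" 0] by (auto simp: w0_def)
  define \<epsilon> where "\<epsilon> n = 4 * (\<Sum>s\<in>S \<inter> C. w s * bias w s n) / w0" for n
  have \<epsilon>_lim: "\<epsilon> \<longlonglongrightarrow> 4 * (\<Sum>s\<in>S \<inter> C. w s * 0) / w0"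
    unfolding \<epsilon>_def using w0 by (intro tendsto_intros lim0) auto
  have bound: "(1 - bias w t0 n)\<^sup>2 \<le> 6 * (\<Sum>i<3. K i) * \<epsilon> n" for n
  proof -
    define g where "g t = 1 - bias w t n" for t
    have energy: "\<forall>s\<in>S. small g (\<epsilon> n) s"
      unfolding small_def
    proof (intro ballI allI impI)
      fix s A assume s: "s \<in> S" and A: "finite A" "A \<subseteq> C"
      have eq: "(\<Sum>t\<in>A. (g t - g (conj_by s t))\<^sup>2) = (\<Sum>t\<in>A. (bias w t n - bias w (conj_by s t) n)\<^sup>2)"
        by (simp add: g_def power2_commute)
      have "w0 * (\<Sum>t\<in>A. (g t - g (conj_by s t))\<^sup>2) \<le> w s * (\<Sum>t\<in>A. (g t - g (conj_by s t))\<^sup>2)"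
        using w0(2)[OF s] by (intro mult_right_mono sum_nonneg) auto
      also have "\<dots> \<le> 4 * (\<Sum>s\<in>S \<inter> C. w s * bias w s n)"
        unfolding eq by (rule energy_bound[OF w(1) C s A])
      finally show "(\<Sum>t\<in>A. (g t - g (conj_by s t))\<^sup>2) \<le> \<epsilon> n"
        using w0 by (simp add: \<epsilon>_def field_simps)
    qed
    define A where "A = {t \<in> C. g t \<noteq> 0}"
    have A: "finite A" "A \<subseteq> C"
      using bias_finite_support[OF C(1), of w n] by (auto simp: A_def g_def)
    have "(g t0)\<^sup>2 \<le> 6 * (\<Sum>i<3. \<Sum>t\<in>A. (g t - g (inv (b i) \<otimes> t \<otimes> b i))\<^sup>2)"
      using A by (intro ineq) (auto simp: A_def)
    also have "\<dots> \<le> 6 * (\<Sum>i<3. K i * \<epsilon> n)"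
      using K[OF _ energy] A by (intro mult_left_mono sum_mono) (auto simp: conj_by_def small_def)
    finally show ?thesis by (simp add: g_def sum_distrib_right mult.assoc)
  qed
  \<comment> \<open>In the limit the inequality reads \<open>1 \<le> 0\<close>.\<close>
  have "(\<lambda>n. (1 - bias w t0 n)\<^sup>2) \<longlonglongrightarrow> (1 - 0)\<^sup>2"
    by (intro tendsto_intros lim0 t0)
  moreover have "(\<lambda>n. 6 * (\<Sum>i<3. K i) * \<epsilon> n) \<longlonglongrightarrow> 6 * (\<Sum>i<3. K i) * (4 * (\<Sum>s\<in>S \<inter> C. w s * 0) / w0)"
    by (intro tendsto_intros \<epsilon>_lim)
  ultimately have "(1 - 0)\<^sup>2 \<le> 6 * (\<Sum>i<3. K i) * (4 * (\<Sum>s\<in>S \<inter> C. w s * 0) / w0)"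
    by (rule LIMSEQ_le) (use bound in blast)
  then show False by simp
qed

end

section \<open>Transition functions of bounded generators\<close>

context
  fixes X :: "'a set" and p :: "real \<Rightarrow> 'a \<Rightarrow> 'a \<Rightarrow> real"
  assumes tf: "transition_function X p"
begin

lemma tf_nonneg: "0 \<le> t \<Longrightarrow> x \<in> X \<Longrightarrow> y \<in> X \<Longrightarrow> 0 \<le> p t x y"
  using tf by (simp add: transition_function_def)

lemma tf_has_sum: "0 \<le> t \<Longrightarrow> x \<in> X \<Longrightarrow> (p t x has_sum 1) X"
  using tf by (simp add: transition_function_def)

lemma tf_0: "x \<in> X \<Longrightarrow> y \<in> X \<Longrightarrow> p 0 x y = of_bool (x = y)"
  using tf by (simp add: transition_function_def)

lemma tf_chapman_kolmogorov:
  "0 \<le> t \<Longrightarrow> 0 \<le> u \<Longrightarrow> x \<in> X \<Longrightarrow> y \<in> X \<Longrightarrow> ((\<lambda>z. p t x z * p u z y) has_sum p (t + u) x y) X"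
  using tf by (simp add: transition_function_def)

lemma tf_sum_le_1:
  assumes "0 \<le> t" "x \<in> X" "finite F" "F \<subseteq> X" shows "sum (p t x) F \<le> 1"
  using assms by (intro finite_sum_le_has_sum[OF tf_has_sum]) (auto intro: tf_nonneg)

lemma tf_le_1: "0 \<le> t \<Longrightarrow> x \<in> X \<Longrightarrow> y \<in> X \<Longrightarrow> p t x y \<le> 1"
  using tf_sum_le_1[of t x "{y}"] by simp

text \<open>Chapman-Kolmogorov cut down to a finite \<open>F\<close>: the discarded intermediate
  states carry mass \<open>1 - (\<Sum>z\<in>F. p h x z)\<close> and contribute at most that much,
  since \<open>p \<le> 1\<close>.\<close>

lemma tf_bounds:
  assumes "0 \<le> h" "0 \<le> t" "x \<in> X" "y \<in> X" "finite F" "F \<subseteq> X"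
  shows "(\<Sum>z\<in>F. p h x z * p t z y) \<le> p (h + t) x y"
    and "p (h + t) x y \<le> (\<Sum>z\<in>F. p h x z * p t z y) + (1 - (\<Sum>z\<in>F. p h x z))"
proof -
  show "(\<Sum>z\<in>F. p h x z * p t z y) \<le> p (h + t) x y"
    using assms tf_nonneg by (intro finite_sum_le_has_sum[OF tf_chapman_kolmogorov]) auto
  have "((\<lambda>z. p h x z - p h x z * p t z y) has_sum (1 - p (h + t) x y)) X"
    using has_sum_add[OF tf_has_sum has_sum_cmult_right[OF tf_chapman_kolmogorov, of _ _ _ _ "-1"]] assms
    by simp
  then have "(\<Sum>z\<in>F. p h x z - p h x z * p t z y) \<le> 1 - p (h + t) x y"
  proof (rule finite_sum_le_has_sum)
    fix z assume z: "z \<in> X - F"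
    have "p h x z * p t z y \<le> p h x z * 1"
      using z assms by (intro mult_left_mono tf_le_1 tf_nonneg) auto
    then show "0 \<le> p h x z - p h x z * p t z y" by simp
  qed (use assms in auto)
  then show "p (h + t) x y \<le> (\<Sum>z\<in>F. p h x z * p t z y) + (1 - (\<Sum>z\<in>F. p h x z))"
    by (simp add: sum_subtractf)
qed

text \<open>
  The backward equation. Both one-sided difference quotients are treated at once, by running the chain
  for time \<open>\<bar>s - t\<bar>\<close> first and for time \<open>min s t\<close> afterwards.
\<close>

lemma backward_equation:
  assumes gen: "has_generator X p q" and t: "0 \<le> t" and x: "x \<in> X" and y: "y \<in> X"
    and F: "finite F" "F \<subseteq> X" "x \<in> F" and q: "(\<Sum>z\<in>F. q x z) = 0"
  shows "((\<lambda>s. p s x y) has_real_derivative (\<Sum>z\<in>F. q x z * p t z y)) (at t within {0..})"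
proof -
  define \<psi> where "\<psi> z h = (p h x z - of_bool (x = z)) / h" for z h
  define gap where "gap s = \<bar>s - t\<bar>" for s
  have gap: "filterlim gap (at 0 within {0..}) (at t within {0..})"
    unfolding filterlim_at
  proof
    show "\<forall>\<^sub>F s in at t within {0..}. gap s \<in> {0..} \<and> gap s \<noteq> 0"
      by (auto simp: eventually_at gap_def intro: exI[of _ 1])
    have "((\<lambda>s. \<bar>s - t\<bar>) \<longlongrightarrow> \<bar>t - t\<bar>) (at t within {0..})" by (intro tendsto_intros)
    then show "(gap \<longlongrightarrow> 0) (at t within {0..})" by (simp add: gap_def[abs_def])
  qed
  have \<psi>: "((\<lambda>s. \<psi> z (gap s)) \<longlongrightarrow> q x z) (at t within {0..})" if z: "z \<in> F" for z
  proof -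
    have "((\<lambda>s. p s x z) has_real_derivative q x z) (at 0 within {0..})"
      using gen x z F by (auto simp: has_generator_def)
    then have "(\<psi> z \<longlongrightarrow> q x z) (at 0 within {0..})"
      using tf_0[OF x] z F by (auto simp: has_field_derivative_iff \<psi>_def[abs_def])
    then show ?thesis by (rule filterlim_compose[OF _ gap])
  qed
  \<comment> \<open>A delay by \<open>gap s\<close> changes the transition probability by at most
    the probability of having left \<open>z\<close> at the end of the delay.\<close>
  have cont: "((\<lambda>s. p (min s t) z y) \<longlongrightarrow> p t z y) (at t within {0..})" if z: "z \<in> X" for z
  proof -
    have "((\<lambda>s. p s z z) has_real_derivative q z z) (at 0 within {0..})"
      using gen z by (auto simp: has_generator_def)
    then have "((\<lambda>s. p s z z) \<longlongrightarrow> p 0 z z) (at 0 within {0..})"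
      using DERIV_continuous continuous_within by blast
    then have "((\<lambda>s. p s z z) \<longlongrightarrow> 1) (at 0 within {0..})" using tf_0 z by simp
    then have "((\<lambda>s. p (gap s) z z) \<longlongrightarrow> 1) (at t within {0..})" by (rule filterlim_compose[OF _ gap])
    then have lim: "((\<lambda>s. 1 - p (gap s) z z) \<longlongrightarrow> 1 - 1) (at t within {0..})" by (intro tendsto_intros)
    have "\<bar>p (min s t) z y - p t z y\<bar> \<le> 1 - p (gap s) z z" if s: "0 \<le> s" for s
    proof (cases "s < t")
      case True
      have g: "0 \<le> gap s" "gap s + s = t" using True by (simp_all add: gap_def)
      have b: "p (gap s) z z * p s z y \<le> p t z y" "p t z y \<le> p (gap s) z z * p s z y + (1 - p (gap s) z z)"
        using tf_bounds[OF g(1) s z y, of "{z}"] z g(2) by simp_all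
      have c: "0 \<le> p s z y" "p s z y \<le> 1" "0 \<le> p (gap s) z z" "p (gap s) z z \<le> 1"
        using tf_nonneg tf_le_1 s g(1) z y by auto
      have "(1 - p (gap s) z z) * p s z y \<le> (1 - p (gap s) z z) * 1"
        using c by (intro mult_left_mono) auto
      moreover have "0 \<le> (1 - p (gap s) z z) * p s z y" using c by simp
      ultimately have "\<bar>p s z y - p t z y\<bar> \<le> 1 - p (gap s) z z"
        using b by (simp add: algebra_simps abs_le_iff)
      then show ?thesis using True by simp
    next
      case False
      then show ?thesis using tf_le_1[of "gap s" z z] z by (simp add: gap_def)
    qed
    then have "\<forall>\<^sub>F s in at t within {0..}. norm (p (min s t) z y - p t z y) \<le> 1 - p (gap s) z z"
      by (auto simp: eventually_at intro: exI[of _ 1])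
    then have "((\<lambda>s. p (min s t) z y - p t z y) \<longlongrightarrow> 0) (at t within {0..})"
      using lim by (auto intro: Lim_null_comparison)
    then show ?thesis by (simp add: LIM_zero_iff)
  qed
  have main: "((\<lambda>s. \<Sum>z\<in>F. \<psi> z (gap s) * p (min s t) z y) \<longlongrightarrow> (\<Sum>z\<in>F. q x z * p t z y)) (at t within {0..})"
    using F by (intro tendsto_sum tendsto_mult \<psi> cont) auto
  \<comment> \<open>Minus this sum is the discarded mass divided by the elapsed time; its limit is
    \<open>0\<close> because \<open>F\<close> carries the whole row of the generator.\<close>
  have rest: "((\<lambda>s. \<Sum>z\<in>F. \<psi> z (gap s)) \<longlongrightarrow> (\<Sum>z\<in>F. q x z)) (at t within {0..})"
    by (intro tendsto_sum \<psi>)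
  have upper: "((\<lambda>s. (\<Sum>z\<in>F. \<psi> z (gap s) * p (min s t) z y) - (\<Sum>z\<in>F. \<psi> z (gap s))) \<longlongrightarrow>
      (\<Sum>z\<in>F. q x z * p t z y)) (at t within {0..})"
    using tendsto_diff[OF main rest] q by simp
  have est: "(\<Sum>z\<in>F. \<psi> z (gap s) * p (min s t) z y) \<le> (p s x y - p t x y) / (s - t) \<and>
      (p s x y - p t x y) / (s - t) \<le> (\<Sum>z\<in>F. \<psi> z (gap s) * p (min s t) z y) - (\<Sum>z\<in>F. \<psi> z (gap s))"
    if s: "0 \<le> s" "s \<noteq> t" for s
  proof -
    define h where "h = gap s"
    define a where "a = min s t"
    have h: "0 < h" "0 \<le> a" using s t by (auto simp: h_def gap_def a_def)
    have eq: "(p s x y - p t x y) / (s - t) = (p (h + a) x y - p a x y) / h"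
    proof (cases "s < t")
      case True
      then have "h + a = t" "a = s" "h = - (s - t)" by (simp_all add: h_def gap_def a_def)
      moreover have "(p s x y - p t x y) / (s - t) = (p t x y - p s x y) / (t - s)"
        by (metis minus_diff_eq minus_divide_divide)
      ultimately show ?thesis by simp
    next
      case False
      then have "h + a = s" "a = t" "h = s - t" using s by (simp_all add: h_def gap_def a_def)
      then show ?thesis by simp
    qed
    have delta: "(\<Sum>z\<in>F. of_bool (x = z) * f z) = f x" for f :: "'a \<Rightarrow> real"
      using F by (simp add: of_bool_def if_distrib[of "\<lambda>c. c * _"] cong: if_cong)
    have s1: "(\<Sum>z\<in>F. \<psi> z h * f z) = ((\<Sum>z\<in>F. p h x z * f z) - f x) / h" for f
    proof -
      have "(\<Sum>z\<in>F. \<psi> z h * f z) = (\<Sum>z\<in>F. p h x z * f z - of_bool (x = z) * f z) / h"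
        by (simp add: \<psi>_def sum_divide_distrib algebra_simps diff_divide_distrib)
      then show ?thesis by (simp only: sum_subtractf delta)
    qed
    have b: "(\<Sum>z\<in>F. p h x z * p a z y) \<le> p (h + a) x y"
      "p (h + a) x y \<le> (\<Sum>z\<in>F. p h x z * p a z y) + (1 - (\<Sum>z\<in>F. p h x z))"
      using tf_bounds[of h a x y F] h x y F by auto
    have s2: "(\<Sum>z\<in>F. \<psi> z h) = ((\<Sum>z\<in>F. p h x z) - 1) / h"
      using s1[of "\<lambda>_. 1"] by simp
    have l: "(\<Sum>z\<in>F. \<psi> z h * p a z y) \<le> (p (h + a) x y - p a x y) / h"
      unfolding s1 using b(1) h(1) by (intro divide_right_mono) auto
    have "(p (h + a) x y - p a x y) / h \<le> ((\<Sum>z\<in>F. p h x z * p a z y) - p a x y - ((\<Sum>z\<in>F. p h x z) - 1)) / h"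
      using b(2) h(1) by (intro divide_right_mono) auto
    then have u: "(p (h + a) x y - p a x y) / h \<le> (\<Sum>z\<in>F. \<psi> z h * p a z y) - (\<Sum>z\<in>F. \<psi> z h)"
      unfolding s1 s2 by (simp add: diff_divide_distrib)
    show ?thesis using l u unfolding eq h_def[symmetric] a_def[symmetric] by blast
  qed
  show ?thesis
    unfolding has_field_derivative_iff
  proof (rule tendsto_sandwich[OF _ _ main upper])
    show "\<forall>\<^sub>F s in at t within {0..}. (\<Sum>z\<in>F. \<psi> z (gap s) * p (min s t) z y) \<le> (p s x y - p t x y) / (s - t)"
      using est by (auto simp: eventually_at intro: exI[of _ 1])
    show "\<forall>\<^sub>F s in at t within {0..}. (p s x y - p t x y) / (s - t) \<le> (\<Sum>z\<in>F. \<psi> z (gap s) * p (min s t) z y) - (\<Sum>z\<in>F. \<psi> z (gap s))"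
      using est by (auto simp: eventually_at intro: exI[of _ 1])
  qed
qed

end

section \<open>Comparison of derivatives and Poisson sums\<close>

lemma abs_le_by_derivative:
  fixes D B :: "real \<Rightarrow> real"
  assumes D: "\<And>u. 0 \<le> u \<Longrightarrow> (D has_real_derivative D' u) (at u within {0..})"
    and B: "\<And>u. 0 \<le> u \<Longrightarrow> (B has_real_derivative B' u) (at u within {0..})"
    and le: "\<And>u. 0 \<le> u \<Longrightarrow> \<bar>D' u\<bar> \<le> B' u" and 0: "D 0 = 0" "0 \<le> B 0" and t: "0 \<le> t"
  shows "\<bar>D t\<bar> \<le> B t"
proof -
  have mono: "f 0 \<le> f t"
    if f: "\<And>u. 0 \<le> u \<Longrightarrow> (f has_real_derivative f' u) (at u within {0..})" and f': "\<And>u. 0 \<le> u \<Longrightarrow> 0 \<le> f' u"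
    for f f' :: "real \<Rightarrow> real"
  proof (rule DERIV_nonneg_imp_increasing_open[OF t])
    fix u assume u: "0 < u" "u < t"
    then have "at u within {0..} = at u" by (intro at_within_interior) simp
    then show "\<exists>y. DERIV f u :> y \<and> 0 \<le> y" using f[of u] f'[of u] u by auto
  next
    have "continuous_on {0..} f" using f by (intro DERIV_continuous_on) auto
    then show "continuous_on {0..t} f" by (rule continuous_on_subset) auto
  qed
  have "(\<lambda>u. B u - D u) 0 \<le> (\<lambda>u. B u - D u) t"
  proof (rule mono)
    show "((\<lambda>u. B u - D u) has_real_derivative B' u - D' u) (at u within {0..})" if "0 \<le> u" for u
      using that by (intro DERIV_diff B D)
    show "0 \<le> B' u - D' u" if "0 \<le> u" for u using le[OF that] by linarith
  qed
  moreover have "(\<lambda>u. B u + D u) 0 \<le> (\<lambda>u. B u + D u) t"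
  proof (rule mono)
    show "((\<lambda>u. B u + D u) has_real_derivative B' u + D' u) (at u within {0..})" if "0 \<le> u" for u
      using that by (intro DERIV_add B D)
    show "0 \<le> B' u + D' u" if "0 \<le> u" for u using le[OF that] by linarith
  qed
  ultimately show ?thesis using 0 by simp
qed

lemma power_over_fact_Suc:
  "x ^ Suc k / fact (Suc k) * real (Suc k) = x * (x ^ k / fact k)" for x :: real
  unfolding fact_Suc power_Suc by (simp del: of_nat_Suc)

lemma poisson_mean_sums: "(\<lambda>k. exp (- x) * (x ^ k / fact k) * real k) sums (x :: real)"
proof -
  have "(\<lambda>k. x ^ k / fact k) sums exp x"
    using exp_converges[of x] by (simp add: field_simps)
  then have "(\<lambda>k. exp (- x) * x * (x ^ k / fact k)) sums (exp (- x) * x * exp x)"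
    by (rule sums_mult)
  also have "exp (- x) * x * exp x = x" by (simp add: exp_minus field_simps)
  also have "(\<lambda>k. exp (- x) * x * (x ^ k / fact k)) = (\<lambda>k. exp (- x) * (x ^ Suc k / fact (Suc k)) * real (Suc k))"
    by (rule ext) (simp only: mult.assoc power_over_fact_Suc)
  finally show ?thesis
    using sums_Suc_iff[of "\<lambda>k. exp (- x) * (x ^ k / fact k) * real k" x] by simp
qed

lemma poisson_sums: "(\<lambda>k. exp (- x) * (x ^ k / fact k)) sums (1 :: real)"
proof -
  have "(\<lambda>k. exp (- x) * (x ^ k / fact k)) sums (exp (- x) * exp x)"
    using exp_converges[of x] by (intro sums_mult) (simp add: field_simps)
  then show ?thesis by (simp add: exp_minus)
qed

section \<open>The law and the speed of the random walk\<close>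

context finite_coxeter
begin

lemma lazy_weights_step_abs_le:
  assumes w: "lazy_weights w" and f: "\<And>y. y \<in> carrier G \<Longrightarrow> \<bar>f y\<bar> \<le> B" and x: "x \<in> carrier G"
  shows "\<bar>step w f x\<bar> \<le> B"
proof -
  have "step w f x \<le> step w (\<lambda>_. B) x" "step w (\<lambda>_. - B) x \<le> step w f x"
    using f by (auto intro!: step_mono[OF w _ x]) (simp_all add: abs_le_iff minus_le_iff)
  then show ?thesis by (simp add: step_const abs_le_iff)
qed

text \<open>Uniformisation: \<open>exp (l * t) * p t x y\<close> solves
  \<open>v' = l * step w v\<close>, whose Taylor coefficients are the iterates of
  \<open>step\<close>. Any transition function with this generator is thereby determined.\<close>

lemma transition_series:
  assumes tf: "transition_function (carrier G) p"
    and gen: "has_generator (carrier G) p (walk_generator G S r)"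
    and w: "lazy_weights w" and l: "0 < l" and rw: "\<And>s. s \<in> S \<Longrightarrow> r s = l * w s"
    and y: "y \<in> carrier G" and x: "x \<in> carrier G" and t: "0 \<le> t"
  shows "(\<lambda>k. exp (- (l * t)) * ((l * t) ^ k / fact k) * steps w k (\<lambda>z. of_bool (z = y)) x) sums p t x y"
proof -
  define \<delta> where "\<delta> z = (of_bool (z = y) :: real)" for z
  define v where "v t x = exp (l * t) * p t x y" for t x
  have dp: "((\<lambda>u. p u x y) has_real_derivative l * (step w (\<lambda>z. p t z y) x - p t x y)) (at t within {0..})"
    if x: "x \<in> carrier G" and t: "0 \<le> t" for x t
  proof -
    \<comment> \<open>The state \<open>x\<close> and all targets of a single jump: the row of the
      generator is supported there and sums to \<open>0\<close>.\<close>
    define F where "F = insert x ((\<lambda>s. x \<otimes> s) ` S)"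
    have F: "finite F" "F \<subseteq> carrier G" "x \<in> F" using finite_S x by (auto simp: F_def)
    have q: "(\<Sum>z\<in>F. walk_generator G S r x z * f z) = (\<Sum>s\<in>S. r s * (f (x \<otimes> s) - f x))" for f
    proof -
      have "(\<Sum>z\<in>F. walk_generator G S r x z * f z) =
          (\<Sum>z\<in>F. \<Sum>s | s \<in> S \<and> x \<otimes> s = z. r s * f (x \<otimes> s)) - (\<Sum>z\<in>F. if x = z then sum r S * f z else 0)"
        unfolding sum_subtractf[symmetric] walk_generator_def
        by (intro sum.cong refl) (auto simp: left_diff_distrib sum_distrib_right)
      also have "(\<Sum>z\<in>F. \<Sum>s | s \<in> S \<and> x \<otimes> s = z. r s * f (x \<otimes> s)) = (\<Sum>s\<in>S. r s * f (x \<otimes> s))"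
        using finite_S F by (intro sum.group) (auto simp: F_def)
      also have "(\<Sum>z\<in>F. if x = z then sum r S * f z else 0) = (\<Sum>s\<in>S. r s * f x)"
        using F by (simp add: sum_distrib_right)
      finally show ?thesis by (simp add: sum_subtractf[symmetric] algebra_simps)
    qed
    have "(\<Sum>z\<in>F. walk_generator G S r x z) = 0" using q[of "\<lambda>_. 1"] by simp
    from backward_equation[OF tf gen t x y F this]
    have "((\<lambda>u. p u x y) has_real_derivative (\<Sum>s\<in>S. r s * (p t (x \<otimes> s) y - p t x y))) (at t within {0..})"
      unfolding q .
    moreover have "(\<Sum>s\<in>S. r s * (p t (x \<otimes> s) y - p t x y)) = l * (step w (\<lambda>z. p t z y) x - p t x y)"
      by (simp add: step_def rw sum_distrib_left mult.assoc)
    ultimately show ?thesis by simp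
  qed
  have dv: "((\<lambda>u. v u x) has_real_derivative l * step w (v t) x) (at t within {0..})"
    if x: "x \<in> carrier G" and t: "0 \<le> t" for x t
  proof -
    have "((\<lambda>u. v u x) has_real_derivative
        exp (l * t) * l * p t x y + l * (step w (\<lambda>z. p t z y) x - p t x y) * exp (l * t)) (at t within {0..})"
      unfolding v_def by (rule DERIV_mult[OF _ dp[OF x t]]) (auto intro!: derivative_eq_intros)
    moreover have "step w (v t) x = exp (l * t) * step w (\<lambda>z. p t z y) x"
      unfolding v_def[abs_def] by (rule step_cmult)
    ultimately show ?thesis by (simp add: algebra_simps)
  qed
  \<comment> \<open>The remainder of order \<open>n + 1\<close> vanishes at \<open>0\<close> and has
    derivative \<open>l * step w\<close> of the remainder of order \<open>n\<close>. The factor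
    \<open>exp (l * t)\<close> bounds the remainder of order \<open>0\<close>, and its own
    derivative only adds slack.\<close>
  have taylor: "\<forall>x\<in>carrier G. \<forall>t\<ge>0. \<bar>v t x - (\<Sum>k<n. (l * t) ^ k / fact k * steps w k \<delta> x)\<bar> \<le> exp (l * t) * ((l * t) ^ n / fact n)" for n
  proof (induction n)
    case 0
    show ?case
    proof (intro ballI allI impI)
      fix x and t :: real assume "x \<in> carrier G" "0 \<le> t"
      then have "0 \<le> p t x y" "p t x y \<le> 1" using tf_nonneg[OF tf] tf_le_1[OF tf] y by auto
      then show "\<bar>v t x - (\<Sum>k<0. (l * t) ^ k / fact k * steps w k \<delta> x)\<bar> \<le> exp (l * t) * ((l * t) ^ 0 / fact 0)"
        by (simp add: v_def)
    qed
  next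
    case (Suc n)
    show ?case
    proof (intro ballI allI impI)
      fix x and t :: real assume x: "x \<in> carrier G" and t: "0 \<le> t"
      have pow: "((\<lambda>t. (l * t) ^ Suc k / fact (Suc k)) has_real_derivative l * ((l * t) ^ k / fact k)) (at t within {0..})" for k t
      proof -
        have "((\<lambda>t. (l * t) ^ Suc k) has_real_derivative real (Suc k) * (l * (l * t) ^ k)) (at t within {0..})"
          by (rule derivative_eq_intros refl)+ simp
        then have "((\<lambda>t. (l * t) ^ Suc k / fact (Suc k)) has_real_derivative
            real (Suc k) * (l * (l * t) ^ k) / fact (Suc k)) (at t within {0..})"
          by (rule DERIV_cdivide)
        moreover have "real (Suc k) * (l * (l * t) ^ k) / fact (Suc k) = l * ((l * t) ^ k / fact k)"
          unfolding fact_Suc by (simp del: of_nat_Suc)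
        ultimately show ?thesis by simp
      qed
      show "\<bar>v t x - (\<Sum>k<Suc n. (l * t) ^ k / fact k * steps w k \<delta> x)\<bar> \<le> exp (l * t) * ((l * t) ^ Suc n / fact (Suc n))"
      proof (rule abs_le_by_derivative[where t = t])
        fix u :: real assume u: "0 \<le> u"
        define f where "f z = v u z - (\<Sum>k<n. (l * u) ^ k / fact k * steps w k \<delta> z)" for z
        have "((\<lambda>t. \<Sum>k<n. (l * t) ^ Suc k / fact (Suc k) * steps w (Suc k) \<delta> x) has_real_derivative
            (\<Sum>k<n. l * ((l * u) ^ k / fact k) * steps w (Suc k) \<delta> x)) (at u within {0..})"
          by (intro DERIV_sum DERIV_cmult_right pow)
        then have "((\<lambda>t. v t x - (\<delta> x + (\<Sum>k<n. (l * t) ^ Suc k / fact (Suc k) * steps w (Suc k) \<delta> x))) has_real_derivative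
            l * step w (v u) x - (0 + (\<Sum>k<n. l * ((l * u) ^ k / fact k) * steps w (Suc k) \<delta> x))) (at u within {0..})"
          by (intro DERIV_diff DERIV_add dv x u DERIV_const)
        moreover have "(\<lambda>t. v t x - (\<delta> x + (\<Sum>k<n. (l * t) ^ Suc k / fact (Suc k) * steps w (Suc k) \<delta> x))) =
            (\<lambda>t. v t x - (\<Sum>k<Suc n. (l * t) ^ k / fact k * steps w k \<delta> x))"
          by (subst sum.lessThan_Suc_shift) simp
        moreover have "l * step w (v u) x - (0 + (\<Sum>k<n. l * ((l * u) ^ k / fact k) * steps w (Suc k) \<delta> x)) = l * step w f x"
        proof -
          have "step w f x = step w (v u) x - step w (\<lambda>z. \<Sum>k<n. (l * u) ^ k / fact k * steps w k \<delta> z) x"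
            using steps_diff[of 1 w "v u" _ x] unfolding f_def[abs_def] by simp
          also have "step w (\<lambda>z. \<Sum>k<n. (l * u) ^ k / fact k * steps w k \<delta> z) x = (\<Sum>k<n. (l * u) ^ k / fact k * steps w (Suc k) \<delta> x)"
            using steps_sum[of "{..<n}" 1 w "\<lambda>k z. (l * u) ^ k / fact k * steps w k \<delta> z" x] by (simp add: step_cmult del: times_divide_eq_left)
          finally have A: "step w f x = step w (v u) x - (\<Sum>k<n. (l * u) ^ k / fact k * steps w (Suc k) \<delta> x)" .
          show ?thesis unfolding A by (simp only: right_diff_distrib sum_distrib_left mult.assoc add_0)
        qed
        ultimately show "((\<lambda>t. v t x - (\<Sum>k<Suc n. (l * t) ^ k / fact k * steps w k \<delta> x)) has_real_derivative l * step w f x) (at u within {0..})"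
          by (simp only:)
        show "((\<lambda>t. exp (l * t) * ((l * t) ^ Suc n / fact (Suc n))) has_real_derivative
            exp (l * u) * l * ((l * u) ^ Suc n / fact (Suc n)) + l * ((l * u) ^ n / fact n) * exp (l * u)) (at u within {0..})"
          by (rule DERIV_mult[OF _ pow]) (auto intro!: derivative_eq_intros)
        have "\<bar>step w f x\<bar> \<le> exp (l * u) * ((l * u) ^ n / fact n)"
          using Suc u by (intro lazy_weights_step_abs_le[OF w _ x]) (simp add: f_def)
        then have "\<bar>l * step w f x\<bar> \<le> l * (exp (l * u) * ((l * u) ^ n / fact n))"
          unfolding abs_mult using l by (simp only: abs_of_pos mult_left_mono less_imp_le)
        moreover have "0 \<le> exp (l * u) * l * ((l * u) ^ Suc n / fact (Suc n))" using l u by simp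
        ultimately show "\<bar>l * step w f x\<bar> \<le> exp (l * u) * l * ((l * u) ^ Suc n / fact (Suc n)) + l * ((l * u) ^ n / fact n) * exp (l * u)"
          by (simp add: mult_ac)
      next
        show "v 0 x - (\<Sum>k<Suc n. (l * 0) ^ k / fact k * steps w k \<delta> x) = 0"
          using tf_0[OF tf x y] by (subst sum.lessThan_Suc_shift) (simp add: v_def \<delta>_def)
      qed (use t in simp_all)
    qed
  qed
  have "(\<lambda>n. (l * t) ^ n / fact n) \<longlonglongrightarrow> 0"
    using summable_LIMSEQ_zero[OF summable_exp[of "l * t"]] by (simp add: field_simps)
  then have lim: "(\<lambda>n. exp (l * t) * ((l * t) ^ n / fact n)) \<longlonglongrightarrow> 0"
    by (rule tendsto_mult_right_zero)
  have bd: "norm (v t x - (\<Sum>k<n. (l * t) ^ k / fact k * steps w k \<delta> x)) \<le> exp (l * t) * ((l * t) ^ n / fact n)" for n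
    unfolding real_norm_def using taylor x t by blast
  have "(\<lambda>n. v t x - (\<Sum>k<n. (l * t) ^ k / fact k * steps w k \<delta> x)) \<longlonglongrightarrow> 0"
    by (rule Lim_null_comparison[OF always_eventually[OF allI[OF bd]] lim])
  then have "(\<lambda>n. v t x - (v t x - (\<Sum>k<n. (l * t) ^ k / fact k * steps w k \<delta> x))) \<longlonglongrightarrow> v t x - 0"
    by (intro tendsto_intros)
  then have "(\<lambda>k. (l * t) ^ k / fact k * steps w k \<delta> x) sums v t x" by (simp add: sums_def)
  then have "(\<lambda>k. exp (- (l * t)) * ((l * t) ^ k / fact k * steps w k \<delta> x)) sums (exp (- (l * t)) * v t x)"
    by (rule sums_mult)
  moreover have "exp (- (l * t)) * v t x = p t x y" by (simp add: v_def exp_minus)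
  ultimately show ?thesis by (simp only: \<delta>_def[abs_def] mult.assoc)
qed

lemma steps_nonneg:
  assumes "lazy_weights w" "\<And>y. y \<in> carrier G \<Longrightarrow> 0 \<le> f y" "x \<in> carrier G"
  shows "0 \<le> steps w n f x"
  using steps_mono[OF assms(1), of "\<lambda>_. 0" f x n] assms by (simp add: steps_const)

text \<open>Recovers an expectation from the point masses of the walk. Extended nonnegative
  integrals admit an unbounded \<open>f\<close> such as the length without a question of
  integrability.\<close>

lemma nn_integral_steps:
  assumes w: "lazy_weights w" and f: "\<And>y. y \<in> carrier G \<Longrightarrow> 0 \<le> f y"
  shows "x \<in> carrier G \<Longrightarrow> (\<integral>\<^sup>+y. ennreal (steps w k (\<lambda>z. of_bool (z = y)) x) * ennreal (f y) \<partial>count_space (carrier G)) =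
    ennreal (steps w k f x)"
proof (induction k arbitrary: x)
  case 0
  then show ?case by (subst nn_integral_count_space'[of "{x}"]) auto
next
  case (Suc k)
  have w0: "0 \<le> w s" if "s \<in> S" for s using w that by (simp add: lazy_weights_def)
  have w1: "0 \<le> 1 - sum w S" using w by (simp add: lazy_weights_def)
  have nn: "0 \<le> steps w k (\<lambda>z. of_bool (z = y)) z" if "z \<in> carrier G" for y z
    using that by (intro steps_nonneg w) auto
  have split: "ennreal (steps w (Suc k) g x) =
      ennreal (1 - sum w S) * ennreal (steps w k g x) + (\<Sum>s\<in>S. ennreal (w s) * ennreal (steps w k g (x \<otimes> s)))"
    if g: "\<And>z. z \<in> carrier G \<Longrightarrow> 0 \<le> steps w k g z" for g
  proof -
    have "ennreal (steps w (Suc k) g x) =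
        ennreal ((1 - sum w S) * steps w k g x) + ennreal (\<Sum>s\<in>S. w s * steps w k g (x \<otimes> s))"
      using g w0 w1 Suc.prems by (subst ennreal_plus[symmetric]) (auto simp: step_alt intro!: sum_nonneg)
    also have "ennreal (\<Sum>s\<in>S. w s * steps w k g (x \<otimes> s)) = (\<Sum>s\<in>S. ennreal (w s * steps w k g (x \<otimes> s)))"
      using g w0 Suc.prems by (intro sum_ennreal[symmetric]) auto
    also have "\<dots> = (\<Sum>s\<in>S. ennreal (w s) * ennreal (steps w k g (x \<otimes> s)))"
      using g w0 Suc.prems by (intro sum.cong refl ennreal_mult) auto
    finally show ?thesis using g w1 Suc.prems by (simp add: ennreal_mult)
  qed
  have "(\<integral>\<^sup>+y. ennreal (steps w (Suc k) (\<lambda>z. of_bool (z = y)) x) * ennreal (f y) \<partial>count_space (carrier G)) =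
    (\<integral>\<^sup>+y. ennreal (1 - sum w S) * (ennreal (steps w k (\<lambda>z. of_bool (z = y)) x) * ennreal (f y)) +
       (\<Sum>s\<in>S. ennreal (w s) * (ennreal (steps w k (\<lambda>z. of_bool (z = y)) (x \<otimes> s)) * ennreal (f y))) \<partial>count_space (carrier G))"
    by (intro nn_integral_cong, subst split) (use nn in \<open>auto simp: distrib_right sum_distrib_right mult.assoc\<close>)
  also have "\<dots> = ennreal (1 - sum w S) * ennreal (steps w k f x) + (\<Sum>s\<in>S. ennreal (w s) * ennreal (steps w k f (x \<otimes> s)))"
    using Suc by (simp add: nn_integral_add nn_integral_sum nn_integral_cmult cong: sum.cong)
  also have "\<dots> = ennreal (steps w (Suc k) f x)"
    using split[of f] steps_nonneg[OF w f] by simp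
  finally show ?case .
qed

lemma countable_carrier: "countable (carrier G)"
proof -
  have "carrier G = (\<Union>n. {x \<in> carrier G. len x \<le> n})" by auto
  moreover have "countable (\<Union>n. {x \<in> carrier G. len x \<le> n})"
    by (rule countable_UN[OF countableI_type], rule countable_finite, rule finite_ball[OF finite_S])
  ultimately show ?thesis by (rule ssubst)
qed

lemma mean_len_nonneg: "lazy_weights w \<Longrightarrow> 0 \<le> mean_len w n"
  unfolding mean_len_def by (intro steps_nonneg) auto

lemma mean_len_le: "lazy_weights w \<Longrightarrow> mean_len w n \<le> real n"
proof (induction n)
  case (Suc n)
  have "(\<Sum>s\<in>S. w s * bias w s n) \<le> (\<Sum>s\<in>S. w s * 1)"
    using Suc.prems by (intro sum_mono mult_left_mono bias_le_1) (auto simp: lazy_weights_def)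
  also have "\<dots> \<le> 1" using Suc.prems by (simp add: lazy_weights_def)
  finally show ?case using Suc by (simp add: mean_len_Suc)
qed simp

lemma random_walk_law:
  assumes rw: "random_walk G S r M Z"
  obtains p where "transition_function (carrier G) p"
    and "has_generator (carrier G) p (walk_generator G S r)"
    and "\<And>t y. 0 < t \<Longrightarrow> y \<in> carrier G \<Longrightarrow> measure M {\<omega> \<in> space M. Z t \<omega> = y} = p t \<one> y"
proof -
  have mc: "continuous_time_markov_chain (carrier G) (walk_generator G S r) M Z"
    and Z0: "AE \<omega> in M. Z 0 \<omega> = \<one>" using rw by (simp_all add: random_walk_def)
  interpret prob_space M using mc by (simp add: continuous_time_markov_chain_def)
  have meas: "Z t \<in> measurable M (count_space (carrier G))" if "0 \<le> t" for t
    using mc that by (simp add: continuous_time_markov_chain_def)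
  have sets: "{\<omega> \<in> space M. Z t \<omega> = y} \<in> sets M" if "0 \<le> t" for t y
  proof -
    have "{\<omega> \<in> space M. Z t \<omega> = y} = Z t -` ({y} \<inter> carrier G) \<inter> space M"
      using measurable_space[OF meas[OF that]] by auto
    then show ?thesis using measurable_sets[OF meas[OF that], of "{y} \<inter> carrier G"] by simp
  qed
  obtain p where p: "transition_function (carrier G) p" "has_generator (carrier G) p (walk_generator G S r)"
    and fdd: "\<And>n \<tau> \<xi>. 0 \<le> \<tau> 0 \<Longrightarrow> (\<forall>i\<le>n. \<tau> i < \<tau> (Suc i)) \<Longrightarrow> (\<forall>i\<le>Suc n. \<xi> i \<in> carrier G) \<Longrightarrow>
           measure M {\<omega> \<in> space M. \<forall>i\<le>Suc n. Z (\<tau> i) \<omega> = \<xi> i} =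
           measure M {\<omega> \<in> space M. \<forall>i\<le>n. Z (\<tau> i) \<omega> = \<xi> i} *
             p (\<tau> (Suc n) - \<tau> n) (\<xi> n) (\<xi> (Suc n))"
    using mc unfolding continuous_time_markov_chain_def by blast
  \<comment> \<open>The joint law at times \<open>0\<close> and \<open>t\<close> suffices, as
    \<open>Z 0\<close> is almost surely \<open>\<one>\<close>; times in the Markov property increase
    strictly, hence \<open>0 < t\<close>.\<close>
  have "measure M {\<omega> \<in> space M. Z t \<omega> = y} = p t \<one> y" if t: "0 < t" and y: "y \<in> carrier G" for t y
  proof -
    have le1: "i \<le> Suc 0 \<longleftrightarrow> i = 0 \<or> i = Suc 0" for i by auto
    have "measure M {\<omega> \<in> space M. Z 0 \<omega> = \<one> \<and> Z t \<omega> = y} = measure M {\<omega> \<in> space M. Z 0 \<omega> = \<one>} * p t \<one> y"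
      using fdd[of "\<lambda>i. if i = 0 then 0 else t" 0 "\<lambda>i. if i = 0 then \<one> else y"] t y by (simp add: le1 all_conj_distrib)
    moreover have "measure M {\<omega> \<in> space M. Z 0 \<omega> = \<one>} = 1"
      using Z0 by (intro prob_Collect_eq_1[THEN iffD2] sets) auto
    moreover have "measure M {\<omega> \<in> space M. Z 0 \<omega> = \<one> \<and> Z t \<omega> = y} = measure M {\<omega> \<in> space M. Z t \<omega> = y}"
    proof (rule finite_measure_eq_AE)
      have "{\<omega> \<in> space M. Z 0 \<omega> = \<one> \<and> Z t \<omega> = y} = {\<omega> \<in> space M. Z 0 \<omega> = \<one>} \<inter> {\<omega> \<in> space M. Z t \<omega> = y}" by auto
      then show "{\<omega> \<in> space M. Z 0 \<omega> = \<one> \<and> Z t \<omega> = y} \<in> sets M" using sets[of 0 \<one>] sets[of t y] t by simp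
      show "{\<omega> \<in> space M. Z t \<omega> = y} \<in> sets M" using sets t by simp
    qed (use Z0 in auto)
    ultimately show ?thesis by simp
  qed
  then show ?thesis using that p by blast
qed

text \<open>The law of \<open>Z t\<close> mixes the discrete laws with Poisson weights, and Tonelli
  interchanges the sums. Finiteness comes from \<open>mean_len w k \<le> real k\<close> and the
  Poisson mean.\<close>

lemma expected_length_series:
  assumes rw: "random_walk G S r M Z" and w: "lazy_weights w" and l: "0 < l"
    and rl: "\<And>s. s \<in> S \<Longrightarrow> r s = l * w s" and t: "0 < t"
  shows "(\<lambda>k. exp (- (l * t)) * ((l * t) ^ k / fact k) * mean_len w k) sums (\<integral>\<omega>. real (len (Z t \<omega>)) \<partial>M)"
proof -
  obtain p where tf: "transition_function (carrier G) p"
    and gen: "has_generator (carrier G) p (walk_generator G S r)"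
    and law: "\<And>t y. 0 < t \<Longrightarrow> y \<in> carrier G \<Longrightarrow> measure M {\<omega> \<in> space M. Z t \<omega> = y} = p t \<one> y"
    using random_walk_law[OF rw] by blast
  have mc: "continuous_time_markov_chain (carrier G) (walk_generator G S r) M Z"
    using rw by (simp add: random_walk_def)
  interpret prob_space M using mc by (simp add: continuous_time_markov_chain_def)
  have meas: "Z t \<in> measurable M (count_space (carrier G))"
    using mc t by (simp add: continuous_time_markov_chain_def)
  define X where "X = count_space (carrier G)"
  define c where "c k = exp (- (l * t)) * ((l * t) ^ k / fact k)" for k
  have c0: "0 \<le> c k" for k using l t by (simp add: c_def)
  define d where "d k y = steps w k (\<lambda>z. of_bool (z = y)) \<one>" for k y
  have d0: "0 \<le> d k y" for k y unfolding d_def by (intro steps_nonneg w) auto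
  have p: "(\<lambda>k. c k * d k y) sums p t \<one> y" if "y \<in> carrier G" for y
    unfolding c_def d_def using transition_series[OF tf gen w l rl that one_closed] t by simp
  have distr: "distr M X (Z t) = density X (\<lambda>y. ennreal (p t \<one> y))"
  proof (rule measure_eqI_countable[of _ "carrier G"])
    fix y assume y: "y \<in> carrier G"
    have "Z t -` {y} \<inter> space M = {\<omega> \<in> space M. Z t \<omega> = y}" by auto
    then have "emeasure (distr M X (Z t)) {y} = ennreal (p t \<one> y)"
      using y meas law[OF t y] by (simp add: emeasure_distr X_def emeasure_eq_measure)
    moreover have "emeasure (density X (\<lambda>y. ennreal (p t \<one> y))) {y} = ennreal (p t \<one> y)"
    proof -
      have "emeasure (density X (\<lambda>y. ennreal (p t \<one> y))) {y} = (\<integral>\<^sup>+z. ennreal (p t \<one> z) * indicator {y} z \<partial>X)"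
        using y by (intro emeasure_density) (auto simp: X_def)
      also have "\<dots> = ennreal (p t \<one> y)"
        unfolding X_def using y by (subst nn_integral_count_space'[of "{y}"]) auto
      finally show ?thesis .
    qed
    ultimately show "emeasure (distr M X (Z t)) {y} = emeasure (density X (\<lambda>y. ennreal (p t \<one> y))) {y}" by simp
  qed (auto simp: X_def countable_carrier)
  have nn: "(\<integral>\<^sup>+\<omega>. ennreal (real (len (Z t \<omega>))) \<partial>M) = (\<Sum>k. ennreal (c k * mean_len w k))"
  proof -
    have "(\<integral>\<^sup>+\<omega>. ennreal (real (len (Z t \<omega>))) \<partial>M) = (\<integral>\<^sup>+y. ennreal (real (len y)) \<partial>distr M X (Z t))"
      using meas by (subst nn_integral_distr) (auto simp: X_def)
    also have "\<dots> = (\<integral>\<^sup>+y. ennreal (p t \<one> y) * ennreal (real (len y)) \<partial>X)"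
      unfolding distr by (subst nn_integral_density) (auto simp: X_def)
    also have "\<dots> = (\<integral>\<^sup>+y. (\<Sum>k. ennreal (c k) * (ennreal (d k y) * ennreal (real (len y)))) \<partial>X)"
    proof (rule nn_integral_cong)
      fix y assume "y \<in> space X"
      then have "ennreal (p t \<one> y) = (\<Sum>k. ennreal (c k * d k y))"
        using c0 d0 by (intro suminf_ennreal_eq[symmetric] p) (auto simp: X_def)
      then show "ennreal (p t \<one> y) * ennreal (real (len y)) = (\<Sum>k. ennreal (c k) * (ennreal (d k y) * ennreal (real (len y))))"
        using c0 d0 by (simp add: ennreal_mult mult.assoc[symmetric])
    qed
    also have "\<dots> = (\<Sum>k. \<integral>\<^sup>+y. ennreal (c k) * (ennreal (d k y) * ennreal (real (len y))) \<partial>X)"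
      by (intro nn_integral_suminf) (simp add: X_def)
    also have "\<dots> = (\<Sum>k. ennreal (c k) * ennreal (mean_len w k))"
      using nn_integral_steps[OF w, of "\<lambda>x. real (len x)" \<one>]
      by (simp add: nn_integral_cmult X_def d_def mean_len_def)
    finally show ?thesis using c0 mean_len_nonneg[OF w] by (simp add: ennreal_mult)
  qed
  have summ: "summable (\<lambda>k. c k * mean_len w k)"
  proof (rule summable_comparison_test')
    show "summable (\<lambda>k. c k * real k)" unfolding c_def by (rule sums_summable[OF poisson_mean_sums])
    show "norm (c k * mean_len w k) \<le> c k * real k" for k
      using c0[of k] mean_len_nonneg[OF w, of k] mean_len_le[OF w, of k] by (auto simp: abs_mult intro!: mult_left_mono)
  qed
  then have "(\<integral>\<^sup>+\<omega>. ennreal (real (len (Z t \<omega>))) \<partial>M) = ennreal (\<Sum>k. c k * mean_len w k)"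
    unfolding nn using c0 mean_len_nonneg[OF w] by (intro suminf_ennreal_eq summable_sums) auto
  moreover have "(\<lambda>\<omega>. real (len (Z t \<omega>))) \<in> borel_measurable M"
    using measurable_compose[OF meas, of "\<lambda>y. real (len y)" borel] by simp
  moreover have "0 \<le> (\<Sum>k. c k * mean_len w k)"
    using summ c0 mean_len_nonneg[OF w] by (intro suminf_nonneg) auto
  ultimately have "(\<integral>\<omega>. real (len (Z t \<omega>)) \<partial>M) = (\<Sum>k. c k * mean_len w k)"
    by (subst integral_eq_nn_integral) auto
  then show ?thesis using summable_sums[OF summ] by (simp add: c_def)
qed

section \<open>Existence and comparison of speeds\<close>

lemma mean_len_speed:
  assumes w: "lazy_weights w"
  obtains v where "\<And>n. real n * v \<le> mean_len w n"
    and "\<And>\<epsilon>. 0 < \<epsilon> \<Longrightarrow> \<exists>K\<ge>0. \<forall>n. mean_len w n \<le> real n * (v + \<epsilon>) + K"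
proof -
  define d where "d n = (\<Sum>s\<in>S. w s * bias w s n)" for n
  have w0: "0 \<le> w s" if "s \<in> S" for s using w that by (simp add: lazy_weights_def)
  have dec: "d (Suc n) \<le> d n" for n
    unfolding d_def using w0 bias_Suc_le[OF w] by (intro sum_mono mult_left_mono) auto
  have d0: "0 \<le> d n" for n
    unfolding d_def using w0 bias_nonneg[OF w] by (intro sum_nonneg mult_nonneg_nonneg) auto
  have "decseq d" using dec by (rule decseq_SucI)
  \<comment> \<open>The mean increments decrease, so their limit is the speed per step.\<close>
  then obtain v where lim: "d \<longlonglongrightarrow> v" and v: "\<And>n. v \<le> d n"
    using decseq_convergent[of d 0] d0 by blast
  have low: "real n * v \<le> mean_len w n" for n
  proof (induction n)
    case (Suc n)
    then show ?case using v[of n] by (simp add: mean_len_Suc d_def[symmetric] algebra_simps)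
  qed simp
  have up: "\<exists>K\<ge>0. \<forall>n. mean_len w n \<le> real n * (v + \<epsilon>) + K" if \<epsilon>: "0 < \<epsilon>" for \<epsilon>
  proof -
    obtain N where N: "\<And>n. N \<le> n \<Longrightarrow> d n < v + \<epsilon>"
      using order_tendstoD(2)[OF lim, of "v + \<epsilon>"] \<epsilon> by (auto simp: eventually_sequentially)
    have v0: "0 \<le> v" using LIMSEQ_le_const[OF lim, of 0] d0 by auto
    have "mean_len w n \<le> real n * (v + \<epsilon>) + real N" for n
    proof (induction n)
      case (Suc n)
      show ?case
      proof (cases "N \<le> n")
        case True
        then show ?thesis using Suc N[of n] by (simp add: mean_len_Suc d_def[symmetric] algebra_simps)
      next
        case False
        then have "mean_len w (Suc n) \<le> real N" using mean_len_le[OF w, of "Suc n"] by linarith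
        moreover have "0 \<le> real (Suc n) * (v + \<epsilon>)" using v0 \<epsilon> by simp
        ultimately show ?thesis by linarith
      qed
    qed simp
    then show ?thesis by (intro exI[of _ "real N"]) auto
  qed
  show ?thesis using that low up by blast
qed

text \<open>Affine bounds on \<open>mean_len\<close> integrate exactly against Poisson weights of
  mean \<open>l * t\<close>, hence the form of \<open>low\<close> and \<open>up\<close>. As
  \<open>limiting_speed\<close> is a \<open>Lim\<close>, convergence itself has to be shown.\<close>

lemma limiting_speed_eq:
  assumes rw: "random_walk G S r M Z" and w: "lazy_weights w" and l: "0 < l"
    and rl: "\<And>s. s \<in> S \<Longrightarrow> r s = l * w s"
    and low: "\<And>n. real n * v \<le> mean_len w n"
    and up: "\<And>\<epsilon>. 0 < \<epsilon> \<Longrightarrow> \<exists>K\<ge>0. \<forall>n. mean_len w n \<le> real n * (v + \<epsilon>) + K"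
  shows "limiting_speed G S M Z = l * v"
proof -
  define E where "E t = (\<integral>\<omega>. real (len (Z t \<omega>)) \<partial>M)" for t
  define c where "c t k = exp (- (l * t)) * ((l * t) ^ k / fact k)" for t k
  have E: "(\<lambda>k. c t k * mean_len w k) sums E t" if "0 < t" for t
    unfolding c_def E_def using that by (intro expected_length_series[OF rw w l rl])
  have c0: "0 \<le> c t k" if "0 < t" for t k using that l by (simp add: c_def)
  have c1: "(\<lambda>k. c t k) sums 1" for t unfolding c_def by (rule poisson_sums)
  have c2: "(\<lambda>k. c t k * real k) sums (l * t)" for t unfolding c_def by (rule poisson_mean_sums)
  have lower: "l * t * v \<le> E t" if t: "0 < t" for t
  proof (rule sums_le[OF _ sums_mult2[OF c2] E[OF t]])
    show "c t k * real k * v \<le> c t k * mean_len w k" for k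
      using mult_left_mono[OF low[of k] c0[OF t]] by (simp add: mult.assoc)
  qed
  have "((\<lambda>t. E t / t) \<longlongrightarrow> l * v) at_top"
  proof (rule tendstoI)
    fix \<eta> :: real assume \<eta>: "0 < \<eta>"
    define \<epsilon> where "\<epsilon> = \<eta> / (2 * l)"
    have \<epsilon>: "0 < \<epsilon>" "l * \<epsilon> = \<eta> / 2" using \<eta> l by (simp_all add: \<epsilon>_def)
    obtain K where K: "0 \<le> K" "\<And>n. mean_len w n \<le> real n * (v + \<epsilon>) + K" using up[OF \<epsilon>(1)] by blast
    have upper: "E t \<le> l * t * (v + \<epsilon>) + K" if t: "0 < t" for t
    proof (rule sums_le[OF _ E[OF t]])
      show "c t k * mean_len w k \<le> c t k * real k * (v + \<epsilon>) + c t k * K" for k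
        using mult_left_mono[OF K(2)[of k] c0[OF t]] by (simp add: algebra_simps)
      show "(\<lambda>k. c t k * real k * (v + \<epsilon>) + c t k * K) sums (l * t * (v + \<epsilon>) + K)"
        using sums_add[OF sums_mult2[OF c2] sums_mult2[OF c1]] by simp
    qed
    have "dist (E t / t) (l * v) < \<eta>" if t: "t > max 1 (2 * K / \<eta>)" for t
    proof -
      have t0: "0 < t" using t by simp
      have 1: "K / t < \<eta> / 2" using t \<eta> t0 by (simp add: field_simps)
      have 2: "E t / t \<le> (l * t * (v + \<epsilon>) + K) / t"
        using upper[OF t0] t0 by (intro divide_right_mono) auto
      have 3: "(l * t * (v + \<epsilon>) + K) / t = l * v + \<eta> / 2 + K / t"
        using t0 \<epsilon>(2) by (simp add: add_divide_distrib distrib_left)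
      have 4: "l * v \<le> E t / t" using lower[OF t0] t0 by (simp add: field_simps)
      show ?thesis using 1 2[unfolded 3] 4 unfolding dist_real_def abs_less_iff by argo
    qed
    then show "\<forall>\<^sub>F t in at_top. dist (E t / t) (l * v) < \<eta>"
      using eventually_gt_at_top[of "max 1 (2 * K / \<eta>)"] by (rule eventually_mono[rotated])
  qed
  then show ?thesis
    unfolding limiting_speed_def E_def by (intro tendsto_Lim) auto
qed

lemma speed_comparison:
  fixes v v' \<kappa> :: real
  assumes "\<And>n. real n * v \<le> e n" and "\<And>n. e n + real n * \<kappa> \<le> e' n"
    and "\<And>\<epsilon>. 0 < \<epsilon> \<Longrightarrow> \<exists>K\<ge>0. \<forall>n. e' n \<le> real n * (v' + \<epsilon>) + K"
  shows "v + \<kappa> \<le> v'"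
proof (rule field_le_epsilon)
  fix \<epsilon> :: real assume "0 < \<epsilon>"
  then obtain K where K: "\<And>n. e' n \<le> real n * (v' + \<epsilon>) + K" using assms(3) by blast
  show "v + \<kappa> \<le> v' + \<epsilon>"
  proof (rule ccontr)
    assume "\<not> ?thesis"
    then obtain n where "K < real n * (v + \<kappa> - (v' + \<epsilon>))"
      using reals_Archimedean3[of "v + \<kappa> - (v' + \<epsilon>)"] by auto
    moreover have "real n * (v + \<kappa>) \<le> real n * (v' + \<epsilon>) + K"
      using assms(1)[of n] assms(2)[of n] K[of n] by (simp add: algebra_simps)
    ultimately show False by (simp add: algebra_simps)
  qed
qed

theorem speed_monotone:
  assumes r: "\<forall>s\<in>S. 0 < r s" and r': "\<forall>s\<in>S. 0 < r' s"
    and rw: "random_walk G S r M Z" and rw': "random_walk G S r' M' Z'"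
    and le: "\<forall>s\<in>S. r s \<le> r' s"
  shows "limiting_speed G S M Z \<le> limiting_speed G S M' Z'"
    and "irreducible_coxeter S m \<Longrightarrow> nonelementary_hyperbolic G \<Longrightarrow> \<exists>s\<in>S. r s < r' s \<Longrightarrow>
      limiting_speed G S M Z < limiting_speed G S M' Z'"
proof -
  \<comment> \<open>One clock for both walks, so that only the weights differ. The factor
    \<open>2\<close> makes the weights lazy; the summand \<open>1\<close> keeps \<open>l\<close>
    positive when \<open>S\<close> is empty.\<close>
  define l where "l = 2 * sum r' S + 1"
  have sum0: "0 \<le> sum r' S" "sum r S \<le> sum r' S"
    using r' le by (simp_all add: sum_nonneg sum_mono less_imp_le)
  then have l: "0 < l" by (simp add: l_def)
  define w where "w s = r s / l" for s
  define w' where "w' s = r' s / l" for s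
  have w: "lazy_weights w" "\<And>s. s \<in> S \<Longrightarrow> 0 < w s" and w': "lazy_weights w'" "\<And>s. s \<in> S \<Longrightarrow> 0 < w' s"
    using r r' l sum0 by (auto simp: lazy_weights_def w_def w'_def sum_divide_distrib[symmetric] less_imp_le field_simps)
      (simp_all add: l_def)
  have rl: "r s = l * w s" "r' s = l * w' s" for s using l by (simp_all add: w_def w'_def)
  have ww': "w s \<le> w' s" if "s \<in> S" for s using le that l by (simp add: w_def w'_def divide_right_mono)
  obtain v where v: "\<And>n. real n * v \<le> mean_len w n"
    "\<And>\<epsilon>. 0 < \<epsilon> \<Longrightarrow> \<exists>K\<ge>0. \<forall>n. mean_len w n \<le> real n * (v + \<epsilon>) + K"
    by (rule mean_len_speed[OF w(1)]) blast
  obtain v' where v': "\<And>n. real n * v' \<le> mean_len w' n"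
    "\<And>\<epsilon>. 0 < \<epsilon> \<Longrightarrow> \<exists>K\<ge>0. \<forall>n. mean_len w' n \<le> real n * (v' + \<epsilon>) + K"
    by (rule mean_len_speed[OF w'(1)]) blast
  have speed: "limiting_speed G S M Z = l * v" "limiting_speed G S M' Z' = l * v'"
    using limiting_speed_eq[OF rw w(1) l rl(1) v] limiting_speed_eq[OF rw' w'(1) l rl(2) v'] by auto
  define D where "D k j s = (w' s - w s) * (bias w' s k * bias w s j)" for k j s
  have D0: "0 \<le> D k j s" if "s \<in> S" for k j s
    unfolding D_def using ww'[OF that] bias_nonneg[OF w(1)] bias_nonneg[OF w'(1)] that by auto
  have diff: "mean_len w n + (\<Sum>k<n. \<Sum>s\<in>S. D k (n - Suc k) s) \<le> mean_len w' n" for n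
    unfolding D_def by (rule mean_len_diff[OF w(1) w'(1) ww'])
  have "mean_len w n + real n * 0 \<le> mean_len w' n" for n
  proof -
    have "0 \<le> (\<Sum>k<n. \<Sum>s\<in>S. D k (n - Suc k) s)" using D0 by (intro sum_nonneg) auto
    then show ?thesis using diff[of n] by linarith
  qed
  from speed_comparison[OF v(1) this v'(2)] have "v \<le> v'" by simp
  then show "limiting_speed G S M Z \<le> limiting_speed G S M' Z'" using speed l by simp
  assume irr: "irreducible_coxeter S m" and hyp: "nonelementary_hyperbolic G" and "\<exists>s\<in>S. r s < r' s"
  then obtain s where s: "s \<in> S" "r s < r' s" by blast
  obtain c where c: "0 < c" "\<And>n. c \<le> bias w s n" using bias_bounded_below[OF w irr hyp s(1)] by blast
  obtain c' where c': "0 < c'" "\<And>n. c' \<le> bias w' s n" using bias_bounded_below[OF w' irr hyp s(1)] by blast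
  have ws: "0 < w' s - w s" using s(2) l by (simp add: w_def w'_def divide_strict_right_mono)
  \<comment> \<open>With both biases bounded away from \<open>0\<close>, exchanging a single step
    gains at least \<kappa> wherever it stands; a total gain linear in \<open>n\<close> survives in
    the speed.\<close>
  define \<kappa> where "\<kappa> = (w' s - w s) * (c' * c)"
  have \<kappa>: "0 < \<kappa>" using ws c c' by (simp add: \<kappa>_def)
  have "mean_len w n + real n * \<kappa> \<le> mean_len w' n" for n
  proof -
    have "\<kappa> \<le> (\<Sum>u\<in>S. D k (n - Suc k) u)" for k
    proof -
      have "\<kappa> \<le> D k (n - Suc k) s"
        unfolding \<kappa>_def D_def using ws c c' by (intro mult_left_mono mult_mono) (auto intro: order_trans[OF less_imp_le])
      also have "\<dots> \<le> (\<Sum>u\<in>S. D k (n - Suc k) u)" using D0 s finite_S by (intro member_le_sum) auto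
      finally show ?thesis .
    qed
    then have "(\<Sum>k<n. \<kappa>) \<le> (\<Sum>k<n. \<Sum>s\<in>S. D k (n - Suc k) s)" by (intro sum_mono)
    then show ?thesis using diff[of n] by simp
  qed
  from speed_comparison[OF v(1) this v'(2)] \<kappa> have "v < v'" by simp
  then show "limiting_speed G S M Z < limiting_speed G S M' Z'" using speed l by simp
qed

end

theorem theorem1p1:
  fixes G :: "('a, 'b) monoid_scheme"
    and S :: "'a set"
    and m :: "'a \<Rightarrow> 'a \<Rightarrow> enat"
    and r r' :: "'a \<Rightarrow> real"
    and M :: "'w measure" and Z :: "real \<Rightarrow> 'w \<Rightarrow> 'a"
    and M' :: "'v measure" and Z' :: "real \<Rightarrow> 'v \<Rightarrow> 'a"
  assumes "coxeter_system G S m" and "finite S"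
    and "\<forall>s\<in>S. 0 < r s" and "\<forall>s\<in>S. 0 < r' s"
    and "random_walk G S r M Z" and "random_walk G S r' M' Z'"
    and "\<forall>s\<in>S. r s \<le> r' s"
  shows "limiting_speed G S M Z \<le> limiting_speed G S M' Z' \<and>
    (irreducible_coxeter S m \<and> nonelementary_hyperbolic G \<and> (\<exists>s\<in>S. r s < r' s) \<longrightarrow>
      limiting_speed G S M Z < limiting_speed G S M' Z')"
proof -
  have "group G" using assms(1) by (simp add: coxeter_system_def group_presentation_def)
  then interpret finite_coxeter G S m
    by (intro finite_coxeter.intro coxeter.intro coxeter_axioms.intro finite_coxeter_axioms.intro assms)
  show ?thesis using speed_monotone[OF assms(3-7)] by blast
qed

end
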